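(* Let $T$ be a concentrated rooted plane tree of depth $n\ge1$ which is not a path. The realized concentrated $n$-associahedron $P(T)$ is the Minkowski sum $$P(T)=\sum_{S}\mathbf y_S\,\Delta(S),$$ over nonempty subsets $S$ of the coordinate set $\{(k,i):1\le k\le n,\ 1\le i\le t_k\}$, where $\mathbf y_S=1$ if $S=S(\mathbf c)$ for some collision unit $\mathbf c\in U(T)$ and $\mathbf y_S=0$ otherwise.
   Context: **Trees.** A rooted plane tree $T$ is a finite rooted tree with a total order on the set $\mathrm{ch}(u)$ of children of every vertex $u$. $V^k(T)$ is the set of vertices at distance $k$ from the root; the depth of $T$ is the largest $k$ with $V^k(T)\ne\emptyset$. $V^k(T)$ is totally ordered lexicographically; $u^k_i$ is its $i$-th element. $T$ has depth $n\ge1$, is not a path, and is concentrated: for every $k<n$ exactly one vertex of depth $k$ has children. $t_k=|V^k(T)|-1$, $m=\sum_{k=1}^nt_k$; $\mathbb R^m$ has coordinates $x^k_i$, $1\le k\le n$, $1\le i\le t_k$. **Brackets.** For $0\le k\le n$ a $k$-bracket of $T$ is $A=(A^0,\dots,A^k)$ with $A^i\subseteq V^i(T)$, $A^k\neq\emptyset$, such that the parent of every $u\in A^i$ ($i\ge 1$) lies in $A^{i-1}$, and for every $u\in A^{i-1}$ the set $A^i\cap\mathrm{ch}(u)$ is a (possibly empty) set of consecutive elements of $\mathrm{ch}(u)$. For $k$-brackets, $A\subseteq A'$ means $A^i\subseteq A'^i$ for all $i$. For $k\ge1$, $\pi(A)=(A^0,\dots,A^{k-1})$. The singleton $k$-bracket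 $A(u)$ of $u\in V^k(T)$ has $A(u)^i=\{\text{the depth-}i\text{ vertex on the path from the root to }u\}$; the maximum $k$-bracket is $(V^0(T),\dots,V^k(T))$. A bracket is nontrivial if it is neither singleton nor maximum. **$n$-bracketings.** An $n$-bracketing $\mathcal B$ of $T$ consists of sets $\mathcal B^k$ of $k$-brackets ($0\le k\le n$) and a strict partial order $<_{\mathcal B}$ on $\bigsqcup_k\mathcal B^k$ such that, writing $\mathcal B_A=\{A'\in\mathcal B^{k}:\pi(A')=A\}$ for $A\in\mathcal B^{k-1}$: (1) $\mathcal B^k$ contains the maximum and all singleton $k$-brackets; (2) $A\in\mathcal B^k$, $k\ge1$, implies $\pi(A)\in\mathcal B^{k-1}$; (3) if $A_1,A_2\in\mathcal B^k$ and $A_1^k\cap A_2^k\ne\emptyset$ then $A_1\subseteq A_2$ or $A_2\subseteq A_1$; (4a) for $A\in\mathcal B^{k-1}$, $1\le k\le n$: $\bigcup_{A'\in\mathcal B_A}A'^k=\bigcup_{u\in A^{k-1}}\mathrm{ch}(u)$; (4b) if $A_1,A_2\in\mathcal B_A$, $A_2\subsetneq A_1$, then every $u'\in A_1^k$ lies in $A_3^k$ for some $A_3\in\mathcal B_A$ with $A_3\subsetneq A_1$; (5a) distinct elements $A_1,A_2\in\mathcal B^k$ are comparable under $<_{\mathcal B}$ iff $\pi(A_1)=\pi(A_2)$ and $A_1^k\cap A_2^k=\emptyset$ (elements of different levels are incomparable); (5b) if $u_1$ precedes $u_2$ in $\mathrm{ch}(u)$ then $A(u_1)<_{\mathcal B}A(u_2)$;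 (5c) if $A,\tilde A\in\mathcal B^{k-1}$, $\tilde A\subseteq A$, $A_1\ne A_2\in\mathcal B_A$ are comparable, $\tilde A_1\ne\tilde A_2\in\mathcal B_{\tilde A}$ are comparable, and $\tilde A_i\subseteq A_i$ for $i=1,2$, then $A_1<_{\mathcal B}A_2\iff\tilde A_1<_{\mathcal B}\tilde A_2$. $\mathcal K(T)$ is the set of $n$-bracketings of $T$ ordered by: $\mathcal B_1\le\mathcal B_2$ iff $\mathcal B_1^k\subseteq\mathcal B_2^k$ for all $k$ and $<_{\mathcal B_1}$ is the restriction of $<_{\mathcal B_2}$. Its minimum $\mathcal B_{\min}$ has only singleton and maximum brackets. **Collisions.** A collision is an atom of $\mathcal K(T)$. The fusion bracket of a collision $\mathcal C$ is the (unique) nonsingleton bracket $E_0$ of $\mathcal C$ such that $\pi(E_0)$ is singleton and $E_0=\pi^{l}(A')$ for some nontrivial $A'$ in $\mathcal C$, $l\ge0$. A bracket $E$ of $\mathcal C$ is essential if $E=\pi^l(A')$ for some nontrivial $A'$ in $\mathcal C$, $l\ge0$, and $\pi^j(E)=E_0$ for some $j\ge0$. For concentrated $T$ the velocity-fan ray generator of $\mathcal C$ is the $0$-$1$ vector $\rho(\mathcal C)\in\mathbb R^m$ with $\rho(\mathcal C)^k_i=1$ iff $u^k_i,u^k_{i+1}\in E^k$ for some essential $E\in\mathcal C^k$. **Collision units.** A collision unit is $\mathbf c=(\mathbf c_1,\dots,\mathbf c_n)$ where each $\mathbf c_k$ is $\emptyset$ or a pair $\{u^k_i,u^k_j\}$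 of distinct depth-$k$ vertices, at least one $\mathbf c_k$ is nonempty, and if at least two are nonempty then each nonempty $\mathbf c_k$ is of the form $\{u^k_i,u^k_{i+1}\}$. $U(T)$ is the set of collision units. The level of $\mathbf c$ is the largest $k$ with $\mathbf c_k\ne\emptyset$. A collision unit of level $k$ is contained in a $k$-bracket $A$ if $\mathbf c_i\subseteq A^i$ for all $i\le k$; $U(A)$ is the set of level-$k$ collision units contained in the $k$-bracket $A$. **The polytope.** $P(T)$ is the polytope determined by the support function $h_T$ taking the value $\sum_{E\text{ essential in }\mathcal C}|U(E)|$ on $\rho(\mathcal C)$ and $|U(T)|$ on the all-ones vector: $$P(T)=\Big\{x\in\mathbb R^m:\sum_{k,i}x^k_i=|U(T)|,\ \langle\rho(\mathcal C),x\rangle\ge\sum_{E\text{ essential in }\mathcal C}|U(E)|\text{ for every collision }\mathcal C\Big\}.$$ **Simplices.** $\Delta(S)$ is the convex hull of the standard basis vectors indexed by $S$. For a collision unit $\mathbf c$ of level $l$, let $A(\mathbf c)$ be the smallest $l$-bracket containing $\mathbf c$; $S(\mathbf c)$ is the support of the ray of the smallest (possibly extended) collision having $A(\mathbf c)$ as an essential bracket, that is, $S(\mathbf c)=\{(r,i):r\le l,\ u^r_i,u^r_{i+1}\in A(\mathbf c)^r\}$. *)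

theory Defs
  imports "HOL-Analysis.Analysis" "HOL-Library.List_Lexorder" "HOL-Library.Set_Algebras"
begin

section \<open>Rooted plane trees\<close>

datatype plane_tree = Node (subtrees: "plane_tree list")

text \<open>Vertices are addressed by their position: the root is the empty list, and the children
  of \<open>u\<close>, in their given order, are \<open>u @ [0]\<close>, \<open>u @ [1]\<close>, \dots. The depth of a vertex is the length
  of its address, its parent is obtained by \<^const>\<open>butlast\<close>, and both the order on \<open>ch T u\<close> and the
  lexicographic order on \<open>VT T k\<close> are the order on lists from List_Lexorder.\<close>

type_synonym vertex = "nat list"

primrec is_vertex :: "vertex \<Rightarrow> plane_tree \<Rightarrow> bool" where
  "is_vertex [] T \<longleftrightarrow> True"
| "is_vertex (i # u) T \<longleftrightarrow> i < length (subtrees T) \<and> is_vertex u (subtrees T ! i)"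

definition verts :: "plane_tree \<Rightarrow> vertex set" where
  "verts T = {u. is_vertex u T}"

definition VT :: "plane_tree \<Rightarrow> nat \<Rightarrow> vertex set" where
  "VT T k = {u \<in> verts T. length u = k}"

definition ch :: "plane_tree \<Rightarrow> vertex \<Rightarrow> vertex set" where
  "ch T u = {v \<in> verts T. v \<noteq> [] \<and> butlast v = u}"

definition depth :: "plane_tree \<Rightarrow> nat" where
  "depth T = Max {k. VT T k \<noteq> {}}"

definition is_path :: "plane_tree \<Rightarrow> bool" where
  "is_path T \<longleftrightarrow> (\<forall>u\<in>verts T. card (ch T u) \<le> 1)"

definition concentrated :: "plane_tree \<Rightarrow> bool" where
  "concentrated T \<longleftrightarrow> (\<forall>k<depth T. \<exists>!u. u \<in> VT T k \<and> ch T u \<noteq> {})"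

text \<open>The enumeration of \<open>VT T k\<close> is 1-based: \<open>vtx T k i\<close> is \<open>u\<^sup>k\<^sub>i\<close> for \<open>1 \<le> i \<le> card (VT T k)\<close>.\<close>

definition vtx :: "plane_tree \<Rightarrow> nat \<Rightarrow> nat \<Rightarrow> vertex" where
  "vtx T k i = sorted_list_of_set (VT T k) ! (i - 1)"

definition tnum :: "plane_tree \<Rightarrow> nat \<Rightarrow> nat" where
  "tnum T k = card (VT T k) - 1"

definition coords :: "plane_tree \<Rightarrow> (nat \<times> nat) set" where
  "coords T = {(k, i). 1 \<le> k \<and> k \<le> depth T \<and> 1 \<le> i \<and> i \<le> tnum T k}"


section \<open>Brackets\<close>

text \<open>A \<open>k\<close>-bracket \<open>(A\<^sup>0, \<dots>, A\<^sup>k)\<close> is the list of its \<open>k + 1\<close> components; hence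
  \<open>A\<^sup>i = A ! i\<close>, \<open>A\<^sup>k = last A\<close>, and the projection \<open>\<pi>\<close> is \<^const>\<open>butlast\<close>.\<close>

type_synonym bracket = "vertex set list"

abbreviation proj :: "bracket \<Rightarrow> bracket" where
  "proj \<equiv> butlast"

definition consecutive_in :: "vertex set \<Rightarrow> vertex set \<Rightarrow> bool" where
  "consecutive_in Y X \<longleftrightarrow> X \<subseteq> Y \<and> (\<forall>a\<in>X. \<forall>b\<in>X. \<forall>c\<in>Y. a \<le> c \<and> c \<le> b \<longrightarrow> c \<in> X)"

definition is_bracket :: "plane_tree \<Rightarrow> nat \<Rightarrow> bracket \<Rightarrow> bool" where
  "is_bracket T k A \<longleftrightarrow>
     length A = Suc k \<and>
     (\<forall>i\<le>k. A ! i \<subseteq> VT T i) \<and>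
     A ! k \<noteq> {} \<and>
     (\<forall>i<k. \<forall>u\<in>A ! Suc i. butlast u \<in> A ! i) \<and>
     (\<forall>i<k. \<forall>u\<in>A ! i. consecutive_in (ch T u) (A ! Suc i \<inter> ch T u))"

definition bracket_le :: "bracket \<Rightarrow> bracket \<Rightarrow> bool"  (infix "\<sqsubseteq>\<^sub>b" 50) where
  "A \<sqsubseteq>\<^sub>b A' \<longleftrightarrow> list_all2 (\<subseteq>) A A'"

definition bracket_less :: "bracket \<Rightarrow> bracket \<Rightarrow> bool"  (infix "\<sqsubset>\<^sub>b" 50) where
  "A \<sqsubset>\<^sub>b A' \<longleftrightarrow> A \<sqsubseteq>\<^sub>b A' \<and> A \<noteq> A'"

definition singleton_bracket :: "vertex \<Rightarrow> bracket" where
  "singleton_bracket u = map (\<lambda>i. {take i u}) [0..<Suc (length u)]"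

definition is_singleton_bracket :: "plane_tree \<Rightarrow> bracket \<Rightarrow> bool" where
  "is_singleton_bracket T A \<longleftrightarrow> (\<exists>u\<in>verts T. A = singleton_bracket u)"

definition max_bracket :: "plane_tree \<Rightarrow> nat \<Rightarrow> bracket" where
  "max_bracket T k = map (VT T) [0..<Suc k]"

definition nontrivial :: "plane_tree \<Rightarrow> bracket \<Rightarrow> bool" where
  "nontrivial T A \<longleftrightarrow>
     \<not> is_singleton_bracket T A \<and> A \<noteq> max_bracket T (length A - 1)"


section \<open>Bracketings\<close>

text \<open>As brackets of different levels have different lengths, the disjoint union of the
  \<open>\<B>\<^sup>k\<close> is stored as one set \<open>brackets B\<close>; \<open>prec B\<close> is the graph of \<open><\<^sub>\<B>\<close>.\<close>

record bracketing =
  brackets :: "bracket set"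
  prec :: "(bracket \<times> bracket) set"

definition level_set :: "bracketing \<Rightarrow> nat \<Rightarrow> bracket set" where
  "level_set B k = {A \<in> brackets B. length A = Suc k}"

definition fibre :: "bracketing \<Rightarrow> bracket \<Rightarrow> bracket set" where
  "fibre B A = {A' \<in> level_set B (length A). proj A' = A}"

definition comparable :: "bracketing \<Rightarrow> bracket \<Rightarrow> bracket \<Rightarrow> bool" where
  "comparable B A1 A2 \<longleftrightarrow> (A1, A2) \<in> prec B \<or> (A2, A1) \<in> prec B"

definition is_bracketing :: "plane_tree \<Rightarrow> bracketing \<Rightarrow> bool" where
  "is_bracketing T B \<longleftrightarrow>
     (\<forall>A\<in>brackets B. \<exists>k\<le>depth T. is_bracket T k A) \<and>
     prec B \<subseteq> brackets B \<times> brackets B \<and> irrefl (prec B) \<and> trans (prec B) \<and>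
     (\<forall>k\<le>depth T. max_bracket T k \<in> level_set B k \<and>
        (\<forall>u\<in>VT T k. singleton_bracket u \<in> level_set B k)) \<and>
     (\<forall>k\<in>{1..depth T}. \<forall>A\<in>level_set B k. proj A \<in> level_set B (k - 1)) \<and>
     (\<forall>k\<le>depth T. \<forall>A1\<in>level_set B k. \<forall>A2\<in>level_set B k.
        A1 ! k \<inter> A2 ! k \<noteq> {} \<longrightarrow> A1 \<sqsubseteq>\<^sub>b A2 \<or> A2 \<sqsubseteq>\<^sub>b A1) \<and>
     (\<forall>k\<in>{1..depth T}. \<forall>A\<in>level_set B (k - 1).
        (\<Union>A'\<in>fibre B A. A' ! k) = (\<Union>u\<in>A ! (k - 1). ch T u)) \<and>
     (\<forall>k\<in>{1..depth T}. \<forall>A\<in>level_set B (k - 1). \<forall>A1\<in>fibre B A. \<forall>A2\<in>fibre B A.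
        A2 \<sqsubset>\<^sub>b A1 \<longrightarrow> (\<forall>u'\<in>A1 ! k. \<exists>A3\<in>fibre B A. u' \<in> A3 ! k \<and> A3 \<sqsubset>\<^sub>b A1)) \<and>
     (\<forall>A1\<in>brackets B. \<forall>A2\<in>brackets B. A1 \<noteq> A2 \<longrightarrow>
        (comparable B A1 A2 \<longleftrightarrow>
           length A1 = length A2 \<and> proj A1 = proj A2 \<and> last A1 \<inter> last A2 = {})) \<and>
     (\<forall>u\<in>verts T. \<forall>u1\<in>ch T u. \<forall>u2\<in>ch T u.
        u1 < u2 \<longrightarrow> (singleton_bracket u1, singleton_bracket u2) \<in> prec B) \<and>
     (\<forall>k\<in>{1..depth T}. \<forall>A\<in>level_set B (k - 1). \<forall>A'\<in>level_set B (k - 1).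
        \<forall>A1\<in>fibre B A. \<forall>A2\<in>fibre B A. \<forall>A1'\<in>fibre B A'. \<forall>A2'\<in>fibre B A'.
          A' \<sqsubseteq>\<^sub>b A \<and> A1 \<noteq> A2 \<and> comparable B A1 A2 \<and> A1' \<noteq> A2' \<and> comparable B A1' A2' \<and>
          A1' \<sqsubseteq>\<^sub>b A1 \<and> A2' \<sqsubseteq>\<^sub>b A2 \<longrightarrow>
          ((A1, A2) \<in> prec B \<longleftrightarrow> (A1', A2') \<in> prec B))"

definition KT :: "plane_tree \<Rightarrow> bracketing set" where
  "KT T = {B. is_bracketing T B}"

definition bracketing_le :: "bracketing \<Rightarrow> bracketing \<Rightarrow> bool"  (infix "\<le>\<^sub>K" 50) where
  "B1 \<le>\<^sub>K B2 \<longleftrightarrow>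
     brackets B1 \<subseteq> brackets B2 \<and> prec B1 = prec B2 \<inter> (brackets B1 \<times> brackets B1)"


section \<open>Collisions\<close>

definition is_minimum :: "plane_tree \<Rightarrow> bracketing \<Rightarrow> bool" where
  "is_minimum T B \<longleftrightarrow> B \<in> KT T \<and> (\<forall>B'\<in>KT T. B \<le>\<^sub>K B')"

definition is_collision :: "plane_tree \<Rightarrow> bracketing \<Rightarrow> bool" where
  "is_collision T C \<longleftrightarrow>
     C \<in> KT T \<and> \<not> is_minimum T C \<and>
     (\<forall>B\<in>KT T. B \<le>\<^sub>K C \<longrightarrow> B = C \<or> is_minimum T B)"

definition below_nontrivial :: "plane_tree \<Rightarrow> bracketing \<Rightarrow> bracket \<Rightarrow> bool" where
  "below_nontrivial T C E \<longleftrightarrow>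
     (\<exists>A'\<in>brackets C. nontrivial T A' \<and> (\<exists>l. E = (proj ^^ l) A'))"

text \<open>For a collision of a concentrated tree exactly one bracket satisfies this description.\<close>

definition fusion_bracket :: "plane_tree \<Rightarrow> bracketing \<Rightarrow> bracket" where
  "fusion_bracket T C =
     (THE E0. E0 \<in> brackets C \<and> \<not> is_singleton_bracket T E0 \<and>
        is_singleton_bracket T (proj E0) \<and> below_nontrivial T C E0)"

definition essential :: "plane_tree \<Rightarrow> bracketing \<Rightarrow> bracket \<Rightarrow> bool" where
  "essential T C E \<longleftrightarrow>
     E \<in> brackets C \<and> below_nontrivial T C E \<and> (\<exists>j. (proj ^^ j) E = fusion_bracket T C)"

definition ray_support :: "plane_tree \<Rightarrow> bracketing \<Rightarrow> (nat \<times> nat) set" where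
  "ray_support T C = {(k, i) \<in> coords T. \<exists>E\<in>level_set C k. essential T C E \<and>
     vtx T k i \<in> E ! k \<and> vtx T k (i + 1) \<in> E ! k}"


section \<open>Collision units\<close>

text \<open>The tuple \<open>(\<c>\<^sub>1, \<dots>, \<c>\<^sub>n)\<close> is a function on levels that is empty outside \<open>{1..n}\<close>.\<close>

type_synonym collision_unit = "nat \<Rightarrow> vertex set"

definition collision_units :: "plane_tree \<Rightarrow> collision_unit set" where
  "collision_units T = {c.
     (\<forall>k. k \<notin> {1..depth T} \<longrightarrow> c k = {}) \<and>
     (\<forall>k\<in>{1..depth T}. c k = {} \<or> (\<exists>u\<in>VT T k. \<exists>v\<in>VT T k. u \<noteq> v \<and> c k = {u, v})) \<and>
     (\<exists>k. c k \<noteq> {}) \<and>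
     ((\<exists>k k'. k \<noteq> k' \<and> c k \<noteq> {} \<and> c k' \<noteq> {}) \<longrightarrow>
        (\<forall>k. c k \<noteq> {} \<longrightarrow> (\<exists>i\<in>{1..tnum T k}. c k = {vtx T k i, vtx T k (i + 1)})))}"

definition unit_level :: "collision_unit \<Rightarrow> nat" where
  "unit_level c = Max {k. c k \<noteq> {}}"

definition contained_in :: "collision_unit \<Rightarrow> bracket \<Rightarrow> bool" where
  "contained_in c A \<longleftrightarrow> (\<forall>i\<le>unit_level c. c i \<subseteq> A ! i)"

definition units_in :: "plane_tree \<Rightarrow> bracket \<Rightarrow> collision_unit set" where
  "units_in T A = {c \<in> collision_units T. length A = Suc (unit_level c) \<and> contained_in c A}"

text \<open>For a collision unit \<open>c\<close> of a concentrated tree the smallest bracket exists: the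
  componentwise intersection of the brackets of this level containing \<open>c\<close> is again one.\<close>

definition smallest_bracket :: "plane_tree \<Rightarrow> collision_unit \<Rightarrow> bracket" where
  "smallest_bracket T c =
     (THE A. is_bracket T (unit_level c) A \<and> contained_in c A \<and>
        (\<forall>A'. is_bracket T (unit_level c) A' \<and> contained_in c A' \<longrightarrow> A \<sqsubseteq>\<^sub>b A'))"

definition unit_support :: "plane_tree \<Rightarrow> collision_unit \<Rightarrow> (nat \<times> nat) set" where
  "unit_support T c = {(r, i) \<in> coords T. r \<le> unit_level c \<and>
     vtx T r i \<in> smallest_bracket T c ! r \<and> vtx T r (i + 1) \<in> smallest_bracket T c ! r}"


section \<open>The polytope and the simplices\<close>

text \<open>\<open>\<real>\<^sup>m\<close> is \<open>real ^ 'm\<close> together with a bijection \<open>lab\<close> from the index type \<open>'m\<close> onto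
  \<open>coords T\<close> (so \<open>CARD('m) = m\<close>): the component of \<open>x\<close> at \<open>c\<close> is the coordinate \<open>x\<^sup>k\<^sub>i\<close>
  with \<open>(k, i) = lab c\<close>.\<close>

definition ray :: "plane_tree \<Rightarrow> ('m::finite \<Rightarrow> nat \<times> nat) \<Rightarrow> bracketing \<Rightarrow> real ^ 'm" where
  "ray T lab C = (\<chi> c. if lab c \<in> ray_support T C then 1 else 0)"

definition ray_height :: "plane_tree \<Rightarrow> bracketing \<Rightarrow> nat" where
  "ray_height T C = (\<Sum>E\<in>{E. essential T C E}. card (units_in T E))"

definition PT :: "plane_tree \<Rightarrow> ('m::finite \<Rightarrow> nat \<times> nat) \<Rightarrow> (real ^ 'm) set" where
  "PT T lab = {x. (\<Sum>c\<in>UNIV. x $ c) = real (card (collision_units T)) \<and>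
     (\<forall>C. is_collision T C \<longrightarrow> ray T lab C \<bullet> x \<ge> real (ray_height T C))}"

definition simplex_on :: "('m::finite \<Rightarrow> nat \<times> nat) \<Rightarrow> (nat \<times> nat) set \<Rightarrow> (real ^ 'm) set" where
  "simplex_on lab S = convex hull {axis c 1 | c. lab c \<in> S}"

definition ycoef :: "plane_tree \<Rightarrow> (nat \<times> nat) set \<Rightarrow> real" where
  "ycoef T S = (if \<exists>c\<in>collision_units T. S = unit_support T c then 1 else 0)"

end

theory Submission
  imports Defs
begin

text \<open>In a concentrated tree each level is the set of children of one vertex, so a set \<open>X\<close> of
  coordinates is a set of gaps between neighbouring siblings. Cutting every level at the gaps
  outside \<open>X\<close> yields a family of brackets \<open>fam T X u\<close>, one part for each vertex \<open>u\<close>; the empty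
  set gives the singleton brackets and \<open>coords T\<close> the maximum brackets. The order of a bracketing is
  forced by the order of siblings, the families of a chain of sets form a bracketing, and every
  bracket of a bracketing lies in a family contained in it. Hence collisions correspond to the proper
  connected \<open>X\<close>: those whose lowest level is a single interval, which touches the vertex with
  children if \<open>X\<close> has higher levels. The ray of this collision is the indicator of \<open>X\<close> and its height
  is the number of units \<open>c\<close> with \<open>S(c) \<subseteq> X\<close>. On the other side, the Minkowski sum of the simplices
  is cut out by the inequalities \<open>x(X) \<ge> card {c. S(c) \<subseteq> X}\<close> for all \<open>X\<close>, as \<open>S\<close> is injective. Any \<open>X\<close>
  splits into connected components such that each \<open>S(c) \<subseteq> X\<close> lies in one of them, so the connected
  ones suffice.\<close>

section \<open>Vertices and gaps\<close>

text \<open>A bracket contains, at every level below its top, the vertex with children; so it is a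
  list of intervals passing through these vertices. Comparing it with a family bracket that shares a
  top vertex then only requires comparing gaps, and the smallest bracket of a unit is a levelwise
  hull. The set \<open>S(c)\<close> determines \<open>c\<close> for two different reasons. At the
  top level the hull of a pair remembers its two ends. Below it the hull also contains the forced
  vertex, which can hide an end, and the pair is recovered only because units with several nonempty
  levels consist of adjacent pairs. Collisions are defined by minimality among all bracketings. This
  is handled by two facts: every nonminimal bracketing lies above the bracketing of some proper
  connected set, and an inclusion between two such bracketings is an equality. A complication is
  that an essential bracket may be a maximum bracket, hence not nontrivial itself; that
  \<open>X\<close> is proper provides a nontrivial bracket above it. Heights count units because a
  unit with \<open>S(c)\<close> inside \<open>X\<close> lies in exactly one essential bracket, the
  one through its top pair.\<close>

lemma is_vertex_appendD: "is_vertex (u @ v) T \<Longrightarrow> is_vertex u T"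
  by (induction u arbitrary: T) auto

lemma finite_verts: "finite (verts T)"
proof (induction T)
  case (Node ts)
  have "verts (Node ts) \<subseteq> insert [] (\<Union>i<length ts. (#) i ` verts (ts ! i))"
  proof
    fix u assume "u \<in> verts (Node ts)"
    then show "u \<in> insert [] (\<Union>i<length ts. (#) i ` verts (ts ! i))"
      by (cases u) (auto simp: verts_def)
  qed
  moreover have "finite (insert [] (\<Union>i<length ts. (#) i ` verts (ts ! i)))"
    using Node by auto
  ultimately show ?case
    by (rule finite_subset)
qed

lemma take_VT:
  assumes "u \<in> VT T k" "i \<le> k"
  shows "take i u \<in> VT T i"
  using assms is_vertex_appendD[of "take i u" "drop i u" T] by (auto simp: VT_def verts_def)

lemma VT_0 [simp]: "VT T 0 = {[]}"
  by (auto simp: VT_def verts_def)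

lemma finite_VT [simp]: "finite (VT T k)"
  by (rule finite_subset[OF _ finite_verts[of T]]) (auto simp: VT_def)

lemma finite_levels: "finite {k. VT T k \<noteq> {}}"
  by (rule finite_subset[OF _ finite_imageI[OF finite_verts[of T], of length]]) (auto simp: VT_def)

lemma VT_nonempty:
  assumes "k \<le> depth T"
  shows "VT T k \<noteq> {}"
proof -
  have "depth T \<in> {k. VT T k \<noteq> {}}"
    unfolding depth_def by (rule Max_in[OF finite_levels], use VT_0 in blast)
  then obtain u where "u \<in> VT T (depth T)"
    by blast
  with take_VT[OF this assms] show ?thesis
    by blast
qed

lemma length_VT: "u \<in> VT T k \<Longrightarrow> length u = k"
  by (simp add: VT_def)

lemma VT_le_depth: "u \<in> VT T k \<Longrightarrow> k \<le> depth T"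
  unfolding depth_def by (rule Max_ge[OF finite_levels]) blast

lemma verts_iff_VT: "u \<in> verts T \<longleftrightarrow> u \<in> VT T (length u)"
  by (simp add: VT_def)

lemma ch_iff: "v \<in> ch T u \<longleftrightarrow> v \<in> VT T (Suc (length u)) \<and> butlast v = u"
  by (auto simp: ch_def VT_def)

lemma VT_Suc_ch: "v \<in> VT T (Suc k) \<Longrightarrow> v \<in> ch T (take k v)"
  by (auto simp: ch_def VT_def butlast_conv_take)

lemma vtx_enum:
  "strict_mono_on {1..card (VT T k)} (vtx T k)"
  "vtx T k ` {1..card (VT T k)} = VT T k"
proof -
  let ?xs = "sorted_list_of_set (VT T k)"
  have len: "length ?xs = card (VT T k)"
    by simp
  have "sorted_wrt (<) ?xs"
    by simp
  then show "strict_mono_on {1..card (VT T k)} (vtx T k)"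
    unfolding strict_mono_on_def vtx_def using len
    by (intro allI impI) (rule sorted_wrt_nth_less[of "(<)"], auto)
  have "vtx T k ` {1..card (VT T k)} = (!) ?xs ` {..<length ?xs}"
  proof -
    \<comment> \<open>\<open>vtx\<close> counts from 1 and list positions from 0; subtraction
      truncates, so the shift is a bijection only because 0 is excluded from the range.\<close>
    have "{..<length ?xs} = (\<lambda>i. i - 1) ` {1..card (VT T k)}" (is "_ = ?R")
    proof
      show "{..<length ?xs} \<subseteq> ?R"
        unfolding len using image_eqI[of _ "\<lambda>i. i - 1" "Suc _" "{1..card (VT T k)}"] by fastforce
    qed (auto simp: len)
    then show ?thesis
      by (simp add: image_image vtx_def)
  qed
  also have "\<dots> = set ?xs"
    by (auto simp: set_conv_nth)
  finally show "vtx T k ` {1..card (VT T k)} = VT T k"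
    by simp
qed

lemma gap_vtx:
  assumes "1 \<le> i" "i \<le> tnum T k"
  shows "vtx T k i \<in> VT T k" "vtx T k (Suc i) \<in> VT T k" "vtx T k i < vtx T k (Suc i)"
proof -
  have *: "i \<in> {1..card (VT T k)}" "Suc i \<in> {1..card (VT T k)}"
    using assms by (auto simp: tnum_def)
  show "vtx T k i \<in> VT T k" "vtx T k (Suc i) \<in> VT T k"
    using * vtx_enum(2)[of T k] by blast+
  show "vtx T k i < vtx T k (Suc i)"
    using strict_mono_onD[OF vtx_enum(1) *] by simp
qed

lemma vtx_less_iff:
  assumes "1 \<le> i" "i \<le> Suc (tnum T k)" "1 \<le> j" "j \<le> Suc (tnum T k)" "VT T k \<noteq> {}"
  shows "vtx T k i < vtx T k j \<longleftrightarrow> i < j"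
proof -
  have "i \<in> {1..card (VT T k)}" "j \<in> {1..card (VT T k)}"
    using assms by (auto simp: tnum_def Suc_diff_Suc card_gt_0_iff)
  then show ?thesis
    using strict_mono_on_less[OF vtx_enum(1)] by blast
qed

lemma gap_no_between:
  assumes "1 \<le> i" "i \<le> tnum T k" "v \<in> VT T k"
  shows "v \<le> vtx T k i \<or> vtx T k (Suc i) \<le> v"
proof -
  obtain j where j: "j \<in> {1..card (VT T k)}" "v = vtx T k j"
    using vtx_enum(2)[of T k] assms(3) by blast
  have *: "i \<in> {1..card (VT T k)}" "Suc i \<in> {1..card (VT T k)}"
    using assms by (auto simp: tnum_def)
  have "j \<le> i \<or> Suc i \<le> j"
    by linarith
  then show ?thesis
    using j * strict_mono_on_leD[OF vtx_enum(1)[of T k]] by blast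
qed

lemma gap_above:
  assumes "u \<in> VT T k" "v \<in> VT T k" "u < v"
  shows "\<exists>i. 1 \<le> i \<and> i \<le> tnum T k \<and> vtx T k i = u \<and> vtx T k (Suc i) \<le> v"
proof -
  obtain i j where ij: "i \<in> {1..card (VT T k)}" "u = vtx T k i" "j \<in> {1..card (VT T k)}" "v = vtx T k j"
    using vtx_enum(2)[of T k] assms(1,2) by blast
  then have "i < j"
    using assms(3) strict_mono_on_less[OF vtx_enum(1)] by blast
  then have "Suc i \<in> {1..card (VT T k)}" "Suc i \<le> j"
    using ij by auto
  then have "vtx T k (Suc i) \<le> v"
    using ij strict_mono_on_leD[OF vtx_enum(1)[of T k]] by blast
  moreover have "1 \<le> i \<and> i \<le> tnum T k"
    using ij \<open>i < j\<close> by (auto simp: tnum_def)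
  ultimately show ?thesis
    using ij by blast
qed

lemma gap_below:
  assumes "u \<in> VT T k" "v \<in> VT T k" "u < v"
  shows "\<exists>i. 1 \<le> i \<and> i \<le> tnum T k \<and> u \<le> vtx T k i \<and> vtx T k (Suc i) = v"
proof -
  obtain i j where ij: "i \<in> {1..card (VT T k)}" "u = vtx T k i" "j \<in> {1..card (VT T k)}" "v = vtx T k j"
    using vtx_enum(2)[of T k] assms(1,2) by blast
  then have "i < j"
    using assms(3) strict_mono_on_less[OF vtx_enum(1)] by blast
  then have m: "j - 1 \<in> {1..card (VT T k)}" "i \<le> j - 1"
    using ij by auto
  then have "u \<le> vtx T k (j - 1)"
    using ij strict_mono_on_leD[OF vtx_enum(1)[of T k]] by blast
  moreover have "1 \<le> j - 1 \<and> j - 1 \<le> tnum T k \<and> Suc (j - 1) = j"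
    using ij m by (auto simp: tnum_def)
  ultimately show ?thesis
    using ij by metis
qed

section \<open>Cutting a level at the gaps outside a set\<close>

definition linked :: "plane_tree \<Rightarrow> (nat \<times> nat) set \<Rightarrow> nat \<Rightarrow> vertex \<Rightarrow> vertex \<Rightarrow> bool" where
  "linked T X k u v \<longleftrightarrow> (\<forall>i. 1 \<le> i \<longrightarrow> i \<le> tnum T k \<longrightarrow>
     (u \<le> vtx T k i \<and> vtx T k (Suc i) \<le> v \<or> v \<le> vtx T k i \<and> vtx T k (Suc i) \<le> u) \<longrightarrow> (k, i) \<in> X)"

definition cls :: "plane_tree \<Rightarrow> (nat \<times> nat) set \<Rightarrow> nat \<Rightarrow> vertex \<Rightarrow> vertex set" where
  "cls T X k u = {v \<in> VT T k. linked T X k u v}"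

lemma linked_refl: "linked T X k u u"
  unfolding linked_def using gap_vtx(3)[of _ T k] by (meson leD le_less_trans order_trans)

lemma linked_sym: "linked T X k u v \<Longrightarrow> linked T X k v u"
  unfolding linked_def by blast

text \<open>A vertex never lies strictly inside a gap, so each gap between \<open>u\<close> and
  \<open>w\<close> is on one side of \<open>v\<close> and hence between \<open>u\<close> and
  \<open>v\<close> or between \<open>v\<close> and \<open>w\<close>.\<close>

lemma linked_trans:
  assumes "linked T X k u v" "linked T X k v w" "v \<in> VT T k"
  shows "linked T X k u w"
  unfolding linked_def
proof (intro allI impI)
  fix i assume i: "1 \<le> i" "i \<le> tnum T k"
    and "u \<le> vtx T k i \<and> vtx T k (Suc i) \<le> w \<or> w \<le> vtx T k i \<and> vtx T k (Suc i) \<le> u"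
  moreover have "v \<le> vtx T k i \<or> vtx T k (Suc i) \<le> v"
    by (rule gap_no_between[OF i assms(3)])
  ultimately show "(k, i) \<in> X"
    using assms(1,2) unfolding linked_def by blast
qed

lemma linked_between: "linked T X k u v \<Longrightarrow> u \<le> w \<Longrightarrow> w \<le> v \<Longrightarrow> linked T X k u w"
  unfolding linked_def by (meson order_trans)

lemma linked_cong: "(\<And>i. (k, i) \<in> X \<longleftrightarrow> (k, i) \<in> Y) \<Longrightarrow> linked T X k = linked T Y k"
  by (auto simp: linked_def fun_eq_iff)

lemma cls_cong: "(\<And>i. (k, i) \<in> X \<longleftrightarrow> (k, i) \<in> Y) \<Longrightarrow> cls T X k = cls T Y k"
  using linked_cong[of k X Y T] by (auto simp: cls_def fun_eq_iff)

lemma cls_mono: "X \<subseteq> Y \<Longrightarrow> cls T X k u \<subseteq> cls T Y k u"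
  by (auto simp: cls_def linked_def)

lemma cls_self: "u \<in> VT T k \<Longrightarrow> u \<in> cls T X k u"
  by (simp add: cls_def linked_refl)

lemma cls_subset: "cls T X k u \<subseteq> VT T k"
  by (auto simp: cls_def)

lemma cls_eq:
  assumes "u \<in> VT T k" "v \<in> cls T X k u"
  shows "cls T X k v = cls T X k u"
  using assms linked_trans[of T X k] linked_sym[of T X k] unfolding cls_def by blast

lemma cls_eqI:
  assumes "u \<in> VT T k" "v \<in> VT T k" "w \<in> cls T X k u" "w \<in> cls T X k v"
  shows "cls T X k u = cls T X k v"
  using cls_eq[OF assms(1,3)] cls_eq[OF assms(2,4)] by simp

lemma cls_convex:
  assumes "u \<in> VT T k" "a \<in> cls T X k u" "b \<in> cls T X k u" "c \<in> VT T k" "a \<le> c" "c \<le> b"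
  shows "c \<in> cls T X k u"
proof -
  have "linked T X k a b" "linked T X k u a"
    using assms linked_trans[of T X k] linked_sym[of T X k] unfolding cls_def by blast+
  then show ?thesis
    using assms linked_between[of T X k a b c] linked_trans[of T X k u a c] unfolding cls_def by blast
qed

text \<open>Between two neighbours the only gap is their own. This is how \<open>X\<close> is read
  off from its classes.\<close>

lemma gap_linked_iff:
  assumes "(k, i) \<in> coords T"
  shows "linked T X k (vtx T k i) (vtx T k (Suc i)) \<longleftrightarrow> (k, i) \<in> X"
proof -
  have i: "1 \<le> i" "i \<le> tnum T k"
    using assms by (auto simp: coords_def)
  have "j = i" if j: "1 \<le> j" "j \<le> tnum T k"
    "vtx T k i \<le> vtx T k j" "vtx T k (Suc j) \<le> vtx T k (Suc i)" for j
  proof -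
    have ne: "VT T k \<noteq> {}" using gap_vtx(1)[OF i] by auto
    have "\<not> j < i" "\<not> Suc i < Suc j"
      using vtx_less_iff[of j T k i] vtx_less_iff[of "Suc i" T k "Suc j"] i j ne by (auto simp: not_less)
    then show ?thesis by simp
  qed
  moreover have False if j: "1 \<le> j" "j \<le> tnum T k"
    "vtx T k (Suc i) \<le> vtx T k j" "vtx T k (Suc j) \<le> vtx T k i" for j
    using gap_vtx(3)[OF i] gap_vtx(3)[OF j(1,2)] j by simp
  ultimately show ?thesis
    using i unfolding linked_def by blast
qed

lemma gap_cls:
  assumes "(k, i) \<in> coords T" "(k, i) \<in> X"
  shows "vtx T k (Suc i) \<in> cls T X k (vtx T k i)"
  using assms gap_linked_iff[OF assms(1)] gap_vtx(2)[of i T k] by (auto simp: cls_def coords_def)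

lemma gap_in_X:
  assumes "(k, i) \<in> coords T" "u \<in> VT T k" "vtx T k i \<in> cls T X k u" "vtx T k (Suc i) \<in> cls T X k u"
  shows "(k, i) \<in> X"
  using cls_eq[OF assms(2,3)] assms gap_linked_iff[OF assms(1)] by (auto simp: cls_def)

text \<open>The gap next to \<open>u\<close> on the side of \<open>v\<close> lies between them. This
  turns a nonsingleton class into an element of \<open>X\<close> at that level.\<close>

lemma linked_gap:
  assumes "u \<in> VT T k" "v \<in> cls T X k u" "v \<noteq> u" "1 \<le> k"
  obtains i where "(k, i) \<in> X" "(k, i) \<in> coords T" "vtx T k i = u \<or> vtx T k (Suc i) = u"
    "vtx T k i \<in> cls T X k u" "vtx T k (Suc i) \<in> cls T X k u"
proof -
  have v: "v \<in> VT T k" "linked T X k u v" and self: "u \<in> cls T X k u"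
    using assms(1,2) by (auto simp: cls_def linked_refl)
  have "k \<le> depth T" using assms(1) by (rule VT_le_depth)
  show ?thesis
  proof (cases "u < v")
    case True
    then obtain i where i: "1 \<le> i" "i \<le> tnum T k" "vtx T k i = u" "vtx T k (Suc i) \<le> v"
      using gap_above[OF assms(1) v(1)] by blast
    then have X: "(k, i) \<in> X" using v(2) unfolding linked_def by blast
    have c: "(k, i) \<in> coords T" using i assms(4) \<open>k \<le> depth T\<close> by (simp add: coords_def)
    show ?thesis
      by (rule that[OF X c]) (use i self gap_cls[OF c X] in auto)
  next
    case False
    then have "v < u" using assms(3) by simp
    then obtain i where i: "1 \<le> i" "i \<le> tnum T k" "vtx T k (Suc i) = u" "v \<le> vtx T k i"
      using gap_below[OF v(1) assms(1)] by blast
    then have X: "(k, i) \<in> X" using v(2) unfolding linked_def by blast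
    have c: "(k, i) \<in> coords T" using i assms(4) \<open>k \<le> depth T\<close> by (simp add: coords_def)
    have "cls T X k (vtx T k i) = cls T X k u"
      using cls_eq[OF gap_vtx(1)[OF i(1,2)] gap_cls[OF c X]] i by simp
    then show ?thesis
      by (intro that[OF X c]) (use i self cls_self[OF gap_vtx(1)[OF i(1,2)], of X] in auto)
  qed
qed

lemma cls_empty:
  assumes "u \<in> VT T k"
  shows "cls T {} k u = {u}"
proof (cases k)
  case 0
  then show ?thesis using assms cls_self[OF assms, of "{}"] cls_subset[of T "{}" k u] by auto
next
  case (Suc k')
  then have "v = u" if "v \<in> cls T {} k u" for v
    using linked_gap[OF assms that] by auto
  then show ?thesis using cls_self[OF assms] by blast
qed

lemma cls_coords:
  assumes "u \<in> VT T k"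
  shows "cls T (coords T) k u = VT T k"
proof (cases k)
  case 0
  then show ?thesis using assms cls_self[OF assms, of "coords T"] cls_subset[of T "coords T" k u] by auto
next
  case (Suc k')
  then show ?thesis
    using VT_le_depth[OF assms] by (auto simp: cls_def linked_def coords_def)
qed

text \<open>The gaps between two elements of an interval have both ends in the interval. This is the
  standard way below to show that an interval stays in one class.\<close>

lemma convex_linked:
  assumes "W \<subseteq> VT T k" "1 \<le> k" "k \<le> depth T"
    and conv: "\<And>a b c. a \<in> W \<Longrightarrow> b \<in> W \<Longrightarrow> c \<in> VT T k \<Longrightarrow> a \<le> c \<Longrightarrow> c \<le> b \<Longrightarrow> c \<in> W"
    and gaps: "\<And>i. (k, i) \<in> coords T \<Longrightarrow> vtx T k i \<in> W \<Longrightarrow> vtx T k (Suc i) \<in> W \<Longrightarrow> (k, i) \<in> X"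
    and "u \<in> W"
  shows "W \<subseteq> cls T X k u"
proof
  fix v assume v: "v \<in> W"
  have "(k, i) \<in> X" if i: "1 \<le> i" "i \<le> tnum T k" and
    uv: "u \<le> vtx T k i \<and> vtx T k (Suc i) \<le> v \<or> v \<le> vtx T k i \<and> vtx T k (Suc i) \<le> u" for i
  proof (rule gaps)
    show "(k, i) \<in> coords T" using i assms(2,3) by (simp add: coords_def)
    have lt: "vtx T k i < vtx T k (Suc i)" using gap_vtx(3)[OF i] .
    from uv consider "u \<le> vtx T k i" "vtx T k (Suc i) \<le> v" | "v \<le> vtx T k i" "vtx T k (Suc i) \<le> u"
      by blast
    then have "vtx T k i \<in> W \<and> vtx T k (Suc i) \<in> W"
    proof cases
      case 1
      then show ?thesis
        using conv[OF \<open>u \<in> W\<close> v gap_vtx(1)[OF i]] conv[OF \<open>u \<in> W\<close> v gap_vtx(2)[OF i]] lt by simp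
    next
      case 2
      then show ?thesis
        using conv[OF v \<open>u \<in> W\<close> gap_vtx(1)[OF i]] conv[OF v \<open>u \<in> W\<close> gap_vtx(2)[OF i]] lt by simp
    qed
    then show "vtx T k i \<in> W" "vtx T k (Suc i) \<in> W" by auto
  qed
  then show "v \<in> cls T X k u"
    using v assms(1) unfolding cls_def linked_def by blast
qed

section \<open>Families of brackets\<close>

text \<open>Indexing by a vertex instead of a part makes projection the passage to an ancestor
  (\<open>take_fam\<close>, \<open>butlast_fam\<close>); in a concentrated tree vertices of one part
  give the same bracket (\<open>fam_cong_cls\<close>).\<close>

definition fam :: "plane_tree \<Rightarrow> (nat \<times> nat) set \<Rightarrow> vertex \<Rightarrow> bracket" where
  "fam T X u = map (\<lambda>i. cls T X i (take i u)) [0..<Suc (length u)]"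

lemma length_fam [simp]: "length (fam T X u) = Suc (length u)"
  by (simp add: fam_def)

lemma fam_nonempty [simp]: "fam T X u \<noteq> []"
  by (metis length_0_conv length_fam nat.distinct(1))

lemma nth_fam [simp]: "i \<le> length u \<Longrightarrow> fam T X u ! i = cls T X i (take i u)"
  unfolding fam_def by (subst nth_map) (auto simp del: upt_Suc)

lemma last_fam: "last (fam T X u) = cls T X (length u) u"
  by (simp add: last_conv_nth)

lemma take_fam: "j \<le> length u \<Longrightarrow> take (Suc j) (fam T X u) = fam T X (take j u)"
  by (rule nth_equalityI) (auto simp: less_Suc_eq_le min_def split: if_splits)

lemma butlast_fam: "u \<noteq> [] \<Longrightarrow> butlast (fam T X u) = fam T X (butlast u)"
  using take_fam[of "length u - 1" u T X] by (simp add: butlast_conv_take)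

lemma fam_eq_iff:
  "fam T X u = fam T Y v \<longleftrightarrow>
     length u = length v \<and> (\<forall>i\<le>length u. cls T X i (take i u) = cls T Y i (take i v))"
proof -
  have "fam T X u = fam T Y v \<longleftrightarrow>
     length u = length v \<and> (\<forall>i<Suc (length u). fam T X u ! i = fam T Y v ! i)"
    unfolding list_eq_iff_nth_eq by auto
  then show ?thesis
    by (auto simp: less_Suc_eq_le)
qed

lemma take_verts: "u \<in> verts T \<Longrightarrow> i \<le> length u \<Longrightarrow> take i u \<in> VT T i"
  using take_VT[of u T "length u" i] verts_iff_VT[of u T] by blast

lemma take_in_verts: "u \<in> verts T \<Longrightarrow> take i u \<in> verts T"
  using is_vertex_appendD[of "take i u" "drop i u" T] by (auto simp: verts_def)

lemma VT_verts: "u \<in> VT T k \<Longrightarrow> u \<in> verts T"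
  by (simp add: VT_def)

lemma fam_empty: "u \<in> verts T \<Longrightarrow> fam T {} u = singleton_bracket u"
  unfolding fam_def singleton_bracket_def using take_verts[of u T]
  by (auto simp: cls_empty simp del: upt_Suc)

lemma fam_coords: "u \<in> verts T \<Longrightarrow> fam T (coords T) u = max_bracket T (length u)"
  unfolding fam_def max_bracket_def using take_verts[of u T]
  by (auto simp: cls_coords simp del: upt_Suc)

text \<open>A vertex lies in its own top part, so the only singleton bracket that its family bracket
  can equal is its own.\<close>

lemma is_singleton_fam:
  assumes "u \<in> verts T"
  shows "is_singleton_bracket T (fam T X u) \<longleftrightarrow> fam T X u = fam T {} u"
proof
  assume "is_singleton_bracket T (fam T X u)"
  then obtain v where v: "v \<in> verts T" "fam T X u = fam T {} v"
    using fam_empty unfolding is_singleton_bracket_def by metis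
  then have "length u = length v" "cls T X (length u) u = cls T {} (length u) v"
    unfolding fam_eq_iff by auto
  then have "u = v"
    using cls_self[of u T "length u" X] cls_empty[of v T "length u"] assms v(1) verts_iff_VT
    by auto
  then show "fam T X u = fam T {} u" using v by simp
next
  assume "fam T X u = fam T {} u"
  then show "is_singleton_bracket T (fam T X u)"
    using assms fam_empty unfolding is_singleton_bracket_def by metis
qed

lemma bracket_le_iff: "A \<sqsubseteq>\<^sub>b B \<longleftrightarrow> length A = length B \<and> (\<forall>i<length A. A ! i \<subseteq> B ! i)"
  by (auto simp: bracket_le_def list_all2_conv_all_nth)

lemma bracket_le_refl: "A \<sqsubseteq>\<^sub>b A"
  by (simp add: bracket_le_iff)

lemma bracket_le_antisym: "A \<sqsubseteq>\<^sub>b B \<Longrightarrow> B \<sqsubseteq>\<^sub>b A \<Longrightarrow> A = B"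
  unfolding bracket_le_iff by (intro nth_equalityI) auto

lemma bracket_le_last:
  assumes "A \<sqsubseteq>\<^sub>b B" "A \<noteq> []"
  shows "last A \<subseteq> last B"
proof -
  have "B \<noteq> []" "length A = length B" using assms by (auto simp: bracket_le_iff)
  then show ?thesis using assms by (simp add: last_conv_nth bracket_le_iff)
qed

lemma bracket_le_proj: "A \<sqsubseteq>\<^sub>b B \<Longrightarrow> proj A \<sqsubseteq>\<^sub>b proj B"
  by (auto simp: bracket_le_iff nth_butlast)

lemma is_bracket_length: "is_bracket T k A \<Longrightarrow> length A = Suc k"
  by (simp add: is_bracket_def)

lemma is_bracket_subset: "is_bracket T k A \<Longrightarrow> i \<le> k \<Longrightarrow> A ! i \<subseteq> VT T i"
  by (simp add: is_bracket_def)

lemma is_bracket_last: "is_bracket T k A \<Longrightarrow> last A = A ! k"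
  by (cases A rule: rev_cases) (auto simp: is_bracket_def)

text \<open>Descending induction from the top component: the parent of a member lies in the
  component below.\<close>

lemma is_bracket_nonempty:
  assumes "is_bracket T k A" "i \<le> k"
  shows "A ! i \<noteq> {}"
  using assms(2)
proof (induction i rule: inc_induct)
  case base
  then show ?case using assms(1) by (simp add: is_bracket_def)
next
  case (step i)
  then show ?case using assms(1) unfolding is_bracket_def by blast
qed

section \<open>Brackets of concentrated trees\<close>

locale conc_tree =
  fixes T :: plane_tree
  assumes conc: "concentrated T"
begin

definition cv :: "nat \<Rightarrow> vertex" where
  "cv k = (THE u. u \<in> VT T k \<and> ch T u \<noteq> {})"

lemma cv_ex1: "k < depth T \<Longrightarrow> \<exists>!u. u \<in> VT T k \<and> ch T u \<noteq> {}"
  using conc by (simp add: concentrated_def)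

lemma cv_in: "k < depth T \<Longrightarrow> cv k \<in> VT T k"
  unfolding cv_def using theI'[OF cv_ex1] by blast

lemma ch_cases:
  assumes "v \<in> ch T u" "u \<in> VT T k"
  shows "k < depth T" "u = cv k" "v \<in> VT T (Suc k)"
proof -
  show v: "v \<in> VT T (Suc k)"
    using assms by (auto simp: ch_iff VT_def)
  then show k: "k < depth T"
    using VT_le_depth by fastforce
  then show "u = cv k"
    unfolding cv_def using assms by (intro the1_equality[symmetric] cv_ex1) auto
qed

text \<open>The ancestor at depth \<open>i < k\<close> has a child, namely the next ancestor, and
  only one vertex of that depth has children.\<close>

lemma take_cv:
  assumes "u \<in> VT T k" "i < k"
  shows "take i u = cv i"
proof -
  have "take (Suc i) u \<in> ch T (take i u)"
    using VT_Suc_ch[OF take_VT[of u T k "Suc i"]] assms by (simp add: min_def)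
  then show ?thesis
    using ch_cases(2) take_VT[of u T k i] assms by simp
qed

lemma butlast_cv: "u \<in> VT T (Suc k) \<Longrightarrow> butlast u = cv k"
  using take_cv[of u "Suc k" k] by (simp add: butlast_conv_take VT_def)

lemma VT_SucD: "u \<in> VT T (Suc k) \<Longrightarrow> k < depth T"
  using VT_le_depth by fastforce

lemma ch_cv: "k < depth T \<Longrightarrow> ch T (cv k) = VT T (Suc k)"
  using ch_cases(3)[OF _ cv_in] VT_Suc_ch[of _ T k] take_cv[of _ "Suc k" k] by fastforce

text \<open>Vertices of one level have the same proper ancestors by \<open>take_cv\<close>, so two
  of them can differ only in their top parts.\<close>

lemma fam_cong_cls:
  assumes "u \<in> VT T k" "v \<in> cls T X k u"
  shows "fam T X v = fam T X u"
proof -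
  have v: "v \<in> VT T k" using assms cls_subset by blast
  have "cls T X i (take i v) = cls T X i (take i u)" if "i \<le> k" for i
    using that take_cv[OF v, of i] take_cv[OF assms(1), of i] cls_eq[OF assms] v assms(1)
    by (cases "i = k") (auto simp: VT_def)
  then show ?thesis
    using v assms(1) by (auto simp: fam_eq_iff VT_def)
qed

lemma is_bracket_cv:
  assumes "is_bracket T k A" "i < k"
  shows "cv i \<in> A ! i"
proof -
  obtain v where v: "v \<in> A ! Suc i"
    using is_bracket_nonempty[OF assms(1), of "Suc i"] assms(2) by auto
  then have "v \<in> VT T (Suc i)"
    using is_bracket_subset[OF assms(1), of "Suc i"] assms(2) by auto
  then show ?thesis
    using v assms butlast_cv[of v i] unfolding is_bracket_def by metis
qed

text \<open>Brackets are only required to be consecutive among siblings, but a level below the root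
  consists of the children of one vertex, and the bracket contains that vertex.\<close>

lemma is_bracket_convex:
  assumes "is_bracket T k A" "i \<le> k" "a \<in> A ! i" "b \<in> A ! i" "c \<in> VT T i" "a \<le> c" "c \<le> b"
  shows "c \<in> A ! i"
proof (cases i)
  case 0
  then show ?thesis
    using assms is_bracket_subset[OF assms(1), of 0] by auto
next
  case (Suc j)
  have j: "j < depth T" using assms(5) Suc VT_SucD by simp
  have "consecutive_in (ch T (cv j)) (A ! Suc j \<inter> ch T (cv j))"
    using is_bracket_cv[OF assms(1), of j] assms(1,2) Suc unfolding is_bracket_def by auto
  moreover have "A ! Suc j \<subseteq> VT T (Suc j)"
    using is_bracket_subset[OF assms(1)] assms(2) Suc by blast
  ultimately show ?thesis
    using assms(3-7) Suc ch_cv[OF j] unfolding consecutive_in_def by blast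
qed

text \<open>Converse of \<open>is_bracket_cv\<close> and \<open>is_bracket_convex\<close>: together
  they describe the brackets of a concentrated tree as lists of intervals through the vertices with
  children.\<close>

lemma is_bracketI:
  assumes "length A = Suc k" "\<And>i. i \<le> k \<Longrightarrow> A ! i \<subseteq> VT T i" "A ! k \<noteq> {}"
    and "\<And>i. i < k \<Longrightarrow> cv i \<in> A ! i"
    and conv: "\<And>i a b c. i \<le> k \<Longrightarrow> a \<in> A ! i \<Longrightarrow> b \<in> A ! i \<Longrightarrow> c \<in> VT T i \<Longrightarrow> a \<le> c \<Longrightarrow> c \<le> b \<Longrightarrow> c \<in> A ! i"
  shows "is_bracket T k A"
  unfolding is_bracket_def
proof (intro conjI allI impI ballI)
  fix i u assume "i < k" "u \<in> A ! Suc i"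
  then show "butlast u \<in> A ! i"
    using assms(2)[of "Suc i"] assms(4)[of i] butlast_cv[of u i] by auto
next
  fix i u assume i: "i < k" and u: "u \<in> A ! i"
  show "consecutive_in (ch T u) (A ! Suc i \<inter> ch T u)"
    unfolding consecutive_in_def
  proof (intro conjI ballI impI)
    fix a b c assume *: "a \<in> A ! Suc i \<inter> ch T u" "b \<in> A ! Suc i \<inter> ch T u" "c \<in> ch T u" "a \<le> c \<and> c \<le> b"
    have "u \<in> VT T i" using u i assms(2)[of i] by auto
    then have "c \<in> VT T (Suc i)" using * ch_cases(3) by blast
    then show "c \<in> A ! Suc i \<inter> ch T u" using conv[of "Suc i" a b c] * i by auto
  qed simp
qed (use assms in auto)

lemma is_bracket_fam:
  assumes "u \<in> VT T k"
  shows "is_bracket T k (fam T X u)"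
proof (rule is_bracketI)
  have len: "length u = k" using assms by (rule length_VT)
  then show "length (fam T X u) = Suc k" by simp
  show "fam T X u ! i \<subseteq> VT T i" if "i \<le> k" for i
    using that len cls_subset by simp
  show "fam T X u ! k \<noteq> {}"
    using len cls_self[OF assms] by auto
  show "cv i \<in> fam T X u ! i" if "i < k" for i
    using that len take_cv[OF assms that] cls_self[OF take_VT[OF assms, of i]] by simp
  show "c \<in> fam T X u ! i" if "i \<le> k" "a \<in> fam T X u ! i" "b \<in> fam T X u ! i" "c \<in> VT T i" "a \<le> c" "c \<le> b"
    for i a b c
    using that len cls_convex[OF take_VT[OF assms that(1)], of a X b c] by simp
qed

text \<open>Both brackets equal those of the common vertex \<open>w\<close>, where
  \<open>cls_mono\<close> applies at each level. This is the source of laminarity for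
  chains.\<close>

lemma fam_le:
  assumes "X \<subseteq> Y" "u \<in> VT T k" "v \<in> VT T k" "w \<in> cls T X k u" "w \<in> cls T Y k v"
  shows "fam T X u \<sqsubseteq>\<^sub>b fam T Y v"
proof -
  have w: "w \<in> VT T k" using assms(4) cls_subset by blast
  have "fam T X w \<sqsubseteq>\<^sub>b fam T Y w"
    using cls_mono[OF assms(1)] by (auto simp: bracket_le_iff less_Suc_eq_le subset_iff)
  then show ?thesis
    using fam_cong_cls[OF assms(2,4)] fam_cong_cls[OF assms(3,5)] by simp
qed

lemma singleton_le:
  assumes "is_bracket T k A" "u \<in> A ! k"
  shows "singleton_bracket u \<sqsubseteq>\<^sub>b A"
proof -
  have u: "u \<in> VT T k" using assms is_bracket_subset[of T k A k] by auto
  have "fam T {} u ! i \<subseteq> A ! i" if "i \<le> k" for i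
    using that take_cv[OF u, of i] is_bracket_cv[OF assms(1), of i] assms(2) length_VT[OF u]
      cls_empty[OF take_VT[OF u that]] by (cases "i = k") auto
  then have "fam T {} u \<sqsubseteq>\<^sub>b A"
    using is_bracket_length[OF assms(1)] length_VT[OF u] by (auto simp: bracket_le_iff less_Suc_eq_le)
  then show ?thesis using fam_empty[OF VT_verts[OF u]] by simp
qed

end

text \<open>The candidate for the order of a bracketing, depending on the set of brackets alone;
  \<open>prec_eq\<close> shows that there is no other choice.\<close>

definition bracket_order :: "bracket set \<Rightarrow> (bracket \<times> bracket) set" where
  "bracket_order \<A> = {(A1, A2). A1 \<in> \<A> \<and> A2 \<in> \<A> \<and> length A1 = length A2 \<and> proj A1 = proj A2 \<and>
     (\<forall>a\<in>last A1. \<forall>b\<in>last A2. a < b)}"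

section \<open>The axioms of a bracketing, one at a time\<close>

lemma
  assumes "B \<in> KT T"
  shows KT_bracket: "\<And>A k. A \<in> level_set B k \<Longrightarrow> is_bracket T k A \<and> k \<le> depth T"
    and KT_level: "\<And>A. A \<in> brackets B \<Longrightarrow> \<exists>k. A \<in> level_set B k"
proof -
  have *: "\<forall>A\<in>brackets B. \<exists>k\<le>depth T. is_bracket T k A"
    using assms unfolding KT_def is_bracketing_def by (elim CollectE conjE)
  show "is_bracket T k A \<and> k \<le> depth T" if "A \<in> level_set B k" for A k
  proof -
    have "A \<in> brackets B" "length A = Suc k" using that by (auto simp: level_set_def)
    then show ?thesis using * is_bracket_length[of T _ A] by fastforce
  qed
  show "\<exists>k. A \<in> level_set B k" if "A \<in> brackets B" for A
    using that * is_bracket_length[of T _ A] by (fastforce simp: level_set_def)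
qed

lemma
  assumes "B \<in> KT T"
  shows KT_max: "\<And>k. k \<le> depth T \<Longrightarrow> max_bracket T k \<in> level_set B k"
    and KT_singleton: "\<And>u k. u \<in> VT T k \<Longrightarrow> singleton_bracket u \<in> level_set B k"
proof -
  have *: "\<forall>k\<le>depth T. max_bracket T k \<in> level_set B k \<and>
        (\<forall>u\<in>VT T k. singleton_bracket u \<in> level_set B k)"
    using assms unfolding KT_def is_bracketing_def by (elim CollectE conjE)
  then show "max_bracket T k \<in> level_set B k" if "k \<le> depth T" for k
    using that by blast
  show "singleton_bracket u \<in> level_set B k" if "u \<in> VT T k" for u k
    using that * VT_le_depth by blast
qed

lemma KT_proj:
  assumes "B \<in> KT T" "A \<in> level_set B (Suc k)"
  shows "proj A \<in> level_set B k"
proof -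
  have "\<forall>k\<in>{1..depth T}. \<forall>A\<in>level_set B k. proj A \<in> level_set B (k - 1)"
    using assms(1) unfolding KT_def is_bracketing_def by (elim CollectE conjE)
  moreover have "Suc k \<in> {1..depth T}"
    using KT_bracket[OF assms] by simp
  ultimately show ?thesis using assms(2) by fastforce
qed

lemma KT_laminar:
  assumes "B \<in> KT T" "A1 \<in> level_set B k" "A2 \<in> level_set B k" "A1 ! k \<inter> A2 ! k \<noteq> {}"
  shows "A1 \<sqsubseteq>\<^sub>b A2 \<or> A2 \<sqsubseteq>\<^sub>b A1"
proof -
  have "\<forall>k\<le>depth T. \<forall>A1\<in>level_set B k. \<forall>A2\<in>level_set B k.
        A1 ! k \<inter> A2 ! k \<noteq> {} \<longrightarrow> A1 \<sqsubseteq>\<^sub>b A2 \<or> A2 \<sqsubseteq>\<^sub>b A1"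
    using assms(1) unfolding KT_def is_bracketing_def by (elim CollectE conjE)
  then show ?thesis using KT_bracket[OF assms(1,2)] assms by blast
qed

lemma KT_cover:
  assumes "B \<in> KT T" "A \<in> level_set B k" "k < depth T"
  shows "(\<Union>A'\<in>fibre B A. A' ! Suc k) = (\<Union>u\<in>A ! k. ch T u)"
proof -
  have "\<forall>k\<in>{1..depth T}. \<forall>A\<in>level_set B (k - 1).
        (\<Union>A'\<in>fibre B A. A' ! k) = (\<Union>u\<in>A ! (k - 1). ch T u)"
    using assms(1) unfolding KT_def is_bracketing_def by (elim CollectE conjE)
  from bspec[OF this, of "Suc k"] show ?thesis using assms by simp
qed

lemma KT_refine:
  assumes "B \<in> KT T" "A \<in> level_set B k" "k < depth T" "A1 \<in> fibre B A" "A2 \<in> fibre B A"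
    and "A2 \<sqsubset>\<^sub>b A1" "u \<in> A1 ! Suc k"
  shows "\<exists>A3\<in>fibre B A. u \<in> A3 ! Suc k \<and> A3 \<sqsubset>\<^sub>b A1"
proof -
  have "\<forall>k\<in>{1..depth T}. \<forall>A\<in>level_set B (k - 1). \<forall>A1\<in>fibre B A. \<forall>A2\<in>fibre B A.
        A2 \<sqsubset>\<^sub>b A1 \<longrightarrow> (\<forall>u'\<in>A1 ! k. \<exists>A3\<in>fibre B A. u' \<in> A3 ! k \<and> A3 \<sqsubset>\<^sub>b A1)"
    using assms(1) unfolding KT_def is_bracketing_def by (elim CollectE conjE)
  from bspec[OF this, of "Suc k"] show ?thesis using assms(2-) by auto
qed

lemma KT_comparable:
  assumes "B \<in> KT T" "A1 \<in> brackets B" "A2 \<in> brackets B" "A1 \<noteq> A2"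
  shows "comparable B A1 A2 \<longleftrightarrow> length A1 = length A2 \<and> proj A1 = proj A2 \<and> last A1 \<inter> last A2 = {}"
proof -
  have "\<forall>A1\<in>brackets B. \<forall>A2\<in>brackets B. A1 \<noteq> A2 \<longrightarrow>
        (comparable B A1 A2 \<longleftrightarrow>
           length A1 = length A2 \<and> proj A1 = proj A2 \<and> last A1 \<inter> last A2 = {})"
    using assms(1) unfolding KT_def is_bracketing_def by (elim CollectE conjE)
  then show ?thesis using assms by blast
qed

lemma
  assumes "B \<in> KT T"
  shows KT_prec_subset: "prec B \<subseteq> brackets B \<times> brackets B"
    and KT_prec_irrefl: "irrefl (prec B)"
    and KT_prec_trans: "trans (prec B)"
proof -
  have "prec B \<subseteq> brackets B \<times> brackets B \<and> irrefl (prec B) \<and> trans (prec B)"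
    using assms unfolding KT_def is_bracketing_def by (elim CollectE conjE) (intro conjI)
  then show "prec B \<subseteq> brackets B \<times> brackets B" "irrefl (prec B)" "trans (prec B)"
    by auto
qed

lemma KT_prec_singleton:
  assumes "B \<in> KT T" "u \<in> verts T" "u1 \<in> ch T u" "u2 \<in> ch T u" "u1 < u2"
  shows "(singleton_bracket u1, singleton_bracket u2) \<in> prec B"
proof -
  have "\<forall>u\<in>verts T. \<forall>u1\<in>ch T u. \<forall>u2\<in>ch T u.
        u1 < u2 \<longrightarrow> (singleton_bracket u1, singleton_bracket u2) \<in> prec B"
    using assms(1) unfolding KT_def is_bracketing_def by (elim CollectE conjE)
  then show ?thesis using assms by blast
qed

lemma KT_prec_coherent:
  assumes "B \<in> KT T" "k < depth T" "A \<in> level_set B k" "A' \<in> level_set B k"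
    and "A1 \<in> fibre B A" "A2 \<in> fibre B A" "A1' \<in> fibre B A'" "A2' \<in> fibre B A'"
    and "A' \<sqsubseteq>\<^sub>b A" "A1 \<noteq> A2" "comparable B A1 A2" "A1' \<noteq> A2'" "comparable B A1' A2'"
    and "A1' \<sqsubseteq>\<^sub>b A1" "A2' \<sqsubseteq>\<^sub>b A2"
  shows "(A1, A2) \<in> prec B \<longleftrightarrow> (A1', A2') \<in> prec B"
proof -
  have "\<forall>k\<in>{1..depth T}. \<forall>A\<in>level_set B (k - 1). \<forall>A'\<in>level_set B (k - 1).
        \<forall>A1\<in>fibre B A. \<forall>A2\<in>fibre B A. \<forall>A1'\<in>fibre B A'. \<forall>A2'\<in>fibre B A'.
          A' \<sqsubseteq>\<^sub>b A \<and> A1 \<noteq> A2 \<and> comparable B A1 A2 \<and> A1' \<noteq> A2' \<and> comparable B A1' A2' \<and>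
          A1' \<sqsubseteq>\<^sub>b A1 \<and> A2' \<sqsubseteq>\<^sub>b A2 \<longrightarrow>
          ((A1, A2) \<in> prec B \<longleftrightarrow> (A1', A2') \<in> prec B)"
    using assms(1) unfolding KT_def is_bracketing_def by (elim CollectE conjE)
  from bspec[OF this, of "Suc k"] have "\<forall>A\<in>level_set B k. \<forall>A'\<in>level_set B k.
        \<forall>A1\<in>fibre B A. \<forall>A2\<in>fibre B A. \<forall>A1'\<in>fibre B A'. \<forall>A2'\<in>fibre B A'.
          A' \<sqsubseteq>\<^sub>b A \<and> A1 \<noteq> A2 \<and> comparable B A1 A2 \<and> A1' \<noteq> A2' \<and> comparable B A1' A2' \<and>
          A1' \<sqsubseteq>\<^sub>b A1 \<and> A2' \<sqsubseteq>\<^sub>b A2 \<longrightarrow>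
          ((A1, A2) \<in> prec B \<longleftrightarrow> (A1', A2') \<in> prec B)"
    using assms(2) by simp
  then show ?thesis using assms(3-) by blast
qed

section \<open>Bracketings from chains of sets of gaps\<close>

lemma last_singleton_bracket: "last (singleton_bracket u) = {u}"
  by (simp add: singleton_bracket_def)

lemma length_singleton_bracket: "length (singleton_bracket u) = Suc (length u)"
  by (simp add: singleton_bracket_def)

lemma length_fibre: "A' \<in> fibre B A \<Longrightarrow> length A' = Suc (length A) \<and> proj A' = A \<and> A' \<in> brackets B"
  by (auto simp: fibre_def level_set_def)

lemma level_setD: "A \<in> level_set B k \<Longrightarrow> A \<in> brackets B \<and> length A = Suc k"
  by (simp add: level_set_def)

context conc_tree
begin

lemma butlast_fam_cv: "u \<in> VT T (Suc k) \<Longrightarrow> proj (fam T X u) = fam T X (cv k)"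
  using butlast_fam[of u T X] butlast_cv[of u k] length_VT[of u T "Suc k"] by fastforce

lemma proj_singleton:
  assumes "u \<in> VT T (Suc k)"
  shows "proj (singleton_bracket u) = singleton_bracket (cv k)"
  using butlast_fam_cv[OF assms, of "{}"] fam_empty[OF VT_verts[OF assms]]
    fam_empty[OF VT_verts[OF cv_in[OF VT_SucD[OF assms]]]] by simp

text \<open>Comparable brackets have disjoint top parts. For \<open>a\<close> and \<open>b\<close>
  in these parts, coherence compares the two brackets with the singleton brackets of
  \<open>a\<close> and \<open>b\<close>, whose order is that of the siblings.\<close>

lemma prec_eq:
  assumes B: "B \<in> KT T"
  shows "prec B = bracket_order (brackets B)"
proof -
  have lt: "\<forall>a\<in>last A1. \<forall>b\<in>last A2. a < b"
    if p: "(A1, A2) \<in> prec B" for A1 A2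
  proof (intro ballI)
    fix a b assume a: "a \<in> last A1" and b: "b \<in> last A2"
    have in_B: "A1 \<in> brackets B" "A2 \<in> brackets B" "A1 \<noteq> A2"
      using p KT_prec_subset[OF B] KT_prec_irrefl[OF B] by (auto simp: irrefl_def)
    have cmp: "comparable B A1 A2" using p by (simp add: comparable_def)
    then have *: "length A1 = length A2" "proj A1 = proj A2" "last A1 \<inter> last A2 = {}"
      using KT_comparable[OF B in_B] by auto
    obtain k where k: "A1 \<in> level_set B k" "A2 \<in> level_set B k"
      using KT_level[OF B in_B(1)] in_B(2) *(1) by (auto simp: level_set_def)
    note br = KT_bracket[OF B k(1), THEN conjunct1] KT_bracket[OF B k(2), THEN conjunct1]
    have ab: "a \<in> A1 ! k" "b \<in> A2 ! k" using a b br by (simp_all add: is_bracket_last)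
    then have V: "a \<in> VT T k" "b \<in> VT T k"
      using is_bracket_subset[OF br(1), of k] is_bracket_subset[OF br(2), of k] by auto
    have "a \<noteq> b" using * a b by blast
    show "a < b"
    proof (rule ccontr)
      assume "\<not> a < b"
      then have "b < a" using \<open>a \<noteq> b\<close> by simp
      \<comment> \<open>Level 0 contains the root alone, so the distinct \<open>a\<close> and
        \<open>b\<close> have a parent level.\<close>
      obtain j where j: "k = Suc j"
        using V \<open>a \<noteq> b\<close> by (cases k) auto
      have jd: "j < depth T" using V(1) j VT_SucD by simp
      let ?s = "singleton_bracket (cv j)"
      have P: "proj A1 \<in> level_set B j" using KT_proj[OF B] k(1) j by simp
      have lenP: "length (proj A1) = Suc j" "length ?s = Suc j"
        using level_setD[OF P] length_VT[OF cv_in[OF jd]] by (auto simp: length_singleton_bracket)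
      have s: "?s \<in> level_set B j" by (rule KT_singleton[OF B cv_in[OF jd]])
      have sab: "singleton_bracket a \<in> fibre B ?s" "singleton_bracket b \<in> fibre B ?s"
        using KT_singleton[OF B V(1)] KT_singleton[OF B V(2)] V j proj_singleton lenP(2)
        by (auto simp: fibre_def)
      have A12: "A1 \<in> fibre B (proj A1)" "A2 \<in> fibre B (proj A1)"
        using k lenP *(2) j by (auto simp: fibre_def)
      have ba: "(singleton_bracket b, singleton_bracket a) \<in> prec B"
        using KT_prec_singleton[OF B VT_verts[OF cv_in[OF jd]], of b a] ch_cv[OF jd] V j \<open>b < a\<close> by simp
      have le: "singleton_bracket a \<sqsubseteq>\<^sub>b A1" "singleton_bracket b \<sqsubseteq>\<^sub>b A2"
        using singleton_le[OF br(1) ab(1)] singleton_le[OF br(2) ab(2)] .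
      have sle: "?s \<sqsubseteq>\<^sub>b proj A1"
        using bracket_le_proj[OF le(1)] proj_singleton V(1) j by simp
      have ne: "singleton_bracket a \<noteq> singleton_bracket b"
        using \<open>a \<noteq> b\<close> last_singleton_bracket by (metis singleton_inject)
      have "(singleton_bracket a, singleton_bracket b) \<in> prec B"
        using KT_prec_coherent[OF B jd P s A12 sab sle in_B(3) cmp ne _ le] ba p
        by (simp add: comparable_def)
      then show False
        using ba KT_prec_trans[OF B] KT_prec_irrefl[OF B] unfolding trans_def irrefl_def by blast
    qed
  qed
  show ?thesis
  proof (intro equalityI subrelI)
    fix A1 A2 assume p: "(A1, A2) \<in> prec B"
    have in_B: "A1 \<in> brackets B" "A2 \<in> brackets B" "A1 \<noteq> A2"
      using p KT_prec_subset[OF B] KT_prec_irrefl[OF B] by (auto simp: irrefl_def)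
    then have "length A1 = length A2 \<and> proj A1 = proj A2"
      using KT_comparable[OF B in_B] p by (auto simp: comparable_def)
    then show "(A1, A2) \<in> bracket_order (brackets B)"
      using in_B lt[OF p] by (simp add: bracket_order_def)
  next
    fix A1 A2 assume "(A1, A2) \<in> bracket_order (brackets B)"
    then have *: "A1 \<in> brackets B" "A2 \<in> brackets B" "length A1 = length A2" "proj A1 = proj A2"
      "\<forall>a\<in>last A1. \<forall>b\<in>last A2. a < b"
      by (auto simp: bracket_order_def)
    obtain k where "A1 \<in> level_set B k" "A2 \<in> level_set B k"
      using KT_level[OF B *(1)] *(2,3) by (auto simp: level_set_def)
    then have "is_bracket T k A1" "is_bracket T k A2"
      using KT_bracket[OF B] by blast+
    then obtain a b where ab: "a \<in> last A1" "b \<in> last A2"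
      using is_bracket_nonempty[of T k A1 k] is_bracket_nonempty[of T k A2 k] is_bracket_last by blast
    have "last A1 \<inter> last A2 = {}" using *(5) by blast
    moreover from this ab have "A1 \<noteq> A2" by auto
    ultimately have "comparable B A1 A2"
      using KT_comparable[OF B *(1,2)] *(3,4) by blast
    moreover have "(A2, A1) \<notin> prec B"
      using lt[of A2 A1] ab *(5) by (meson less_asym)
    ultimately show "(A1, A2) \<in> prec B"
      by (simp add: comparable_def)
  qed
qed

definition chain_bracketing :: "(nat \<times> nat) set set \<Rightarrow> bracketing" where
  "chain_bracketing \<X> = (let \<A> = \<Union>X\<in>\<X>. fam T X ` verts T in
     \<lparr>brackets = \<A>, prec = bracket_order \<A>\<rparr>)"

lemma brackets_chain: "brackets (chain_bracketing \<X>) = (\<Union>X\<in>\<X>. fam T X ` verts T)"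
  by (simp add: chain_bracketing_def Let_def)

lemma prec_chain: "prec (chain_bracketing \<X>) = bracket_order (brackets (chain_bracketing \<X>))"
  by (simp add: chain_bracketing_def Let_def)

lemma level_chain: "level_set (chain_bracketing \<X>) k = (\<Union>X\<in>\<X>. fam T X ` VT T k)"
  by (auto simp: level_set_def brackets_chain VT_def)

lemma fibre_chain:
  assumes "length A = Suc k"
  shows "fibre (chain_bracketing \<X>) A = {fam T X u |X u. X \<in> \<X> \<and> u \<in> VT T (Suc k) \<and> fam T X (cv k) = A}"
  unfolding fibre_def level_chain assms by (force simp: butlast_fam_cv)

text \<open>The families given by a chain of sets of gaps are nested, hence together satisfy the
  laminarity and refinement axioms.\<close>

lemma chain_bracketing_KT:
  assumes chain: "\<And>X Y. X \<in> \<X> \<Longrightarrow> Y \<in> \<X> \<Longrightarrow> X \<subseteq> Y \<or> Y \<subseteq> X"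
    and ends: "{} \<in> \<X>" "coords T \<in> \<X>"
  shows "chain_bracketing \<X> \<in> KT T"
proof -
  let ?B = "chain_bracketing \<X>"
  have lam: "fam T X u \<sqsubseteq>\<^sub>b fam T Y v \<or> fam T Y v \<sqsubseteq>\<^sub>b fam T X u"
    if "X \<in> \<X>" "Y \<in> \<X>" "u \<in> VT T k" "v \<in> VT T k" "w \<in> cls T X k u" "w \<in> cls T Y k v" for X Y u v w k
    using chain[OF that(1,2)] that fam_le[of X Y u k v w] fam_le[of Y X v k u w] by blast
  have nth: "fam T X u ! k = cls T X k u" if "u \<in> VT T k" for X u k
    using that by (simp add: VT_def)
  have lst: "last (fam T X u) = cls T X k u" if "u \<in> VT T k" for X u k
    using that by (simp add: VT_def last_fam)
  have br: "is_bracket T k A \<and> k \<le> depth T" if "A \<in> level_set ?B k" for A k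
    using that is_bracket_fam VT_le_depth unfolding level_chain by blast
  have lev: "\<exists>k. A \<in> level_set ?B k" if "A \<in> brackets ?B" for A
    using that unfolding level_chain brackets_chain using verts_iff_VT by fast
  have cmp: "comparable ?B A1 A2 \<longleftrightarrow> length A1 = length A2 \<and> proj A1 = proj A2 \<and> last A1 \<inter> last A2 = {}"
    if A: "A1 \<in> brackets ?B" "A2 \<in> brackets ?B" for A1 A2
  proof
    show "length A1 = length A2 \<and> proj A1 = proj A2 \<and> last A1 \<inter> last A2 = {}" if "comparable ?B A1 A2"
      using that unfolding comparable_def prec_chain bracket_order_def by auto
  next
    assume *: "length A1 = length A2 \<and> proj A1 = proj A2 \<and> last A1 \<inter> last A2 = {}"
    obtain k where "A1 \<in> level_set ?B k" "A2 \<in> level_set ?B k"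
      using lev[OF A(1)] A(2) * by (auto simp: level_set_def)
    then have b: "is_bracket T k A1" "is_bracket T k A2"
      using br by auto
    then obtain a b where ab: "a \<in> last A1" "b \<in> last A2"
      using is_bracket_nonempty[of T k A1 k] is_bracket_nonempty[of T k A2 k] is_bracket_last by blast
    have V: "last A1 \<subseteq> VT T k" "last A2 \<subseteq> VT T k"
      using b is_bracket_subset[of T k _ k] is_bracket_last by auto
    have c1: "z \<in> last A1" if "x \<in> last A1" "y \<in> last A1" "z \<in> VT T k" "x \<le> z" "z \<le> y" for x y z
      using is_bracket_convex[OF b(1), of k x y z] that is_bracket_last[OF b(1)] by simp
    have c2: "z \<in> last A2" if "x \<in> last A2" "y \<in> last A2" "z \<in> VT T k" "x \<le> z" "z \<le> y" for x y z
      using is_bracket_convex[OF b(2), of k x y z] that is_bracket_last[OF b(2)] by simp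
    \<comment> \<open>The top parts are disjoint intervals of one level, so the order of one pair of
      representatives decides the order of all pairs.\<close>
    have sep: "x < y" if "a < b" "x \<in> last A1" "y \<in> last A2" for x y
    proof (rule ccontr)
      assume "\<not> x < y"
      then have "y \<le> x" by simp
      show False
      proof (cases "y \<le> a")
        case True
        then have "a \<in> last A2" using c2[of y b a] that ab V by auto
        then show False using * ab by blast
      next
        case False
        then have "y \<in> last A1" using c1[of a x y] that ab V \<open>y \<le> x\<close> by auto
        then show False using * that by blast
      qed
    qed
    have sep': "x < y" if "b < a" "x \<in> last A2" "y \<in> last A1" for x y
    proof (rule ccontr)
      assume "\<not> x < y"
      then have "y \<le> x" by simp
      show False
      proof (cases "y \<le> b")
        case True
        then have "b \<in> last A1" using c1[of y a b] that ab V by auto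
        then show False using * ab by blast
      next
        case False
        then have "y \<in> last A2" using c2[of b x y] that ab V \<open>y \<le> x\<close> by auto
        then show False using * that by blast
      qed
    qed
    have "a < b \<or> b < a" using * ab by (metis disjoint_iff linorder_neqE)
    then show "comparable ?B A1 A2"
    proof
      assume lt: "a < b"
      have "(A1, A2) \<in> prec ?B"
        unfolding prec_chain bracket_order_def using A * sep[OF lt] by blast
      then show ?thesis by (simp add: comparable_def)
    next
      assume lt: "b < a"
      have "(A2, A1) \<in> prec ?B"
        unfolding prec_chain bracket_order_def mem_Collect_eq case_prod_conv
        using A * sep'[OF lt] by simp
      then show ?thesis by (simp add: comparable_def)
    qed
  qed
  have ord_lt: "(A1, A2) \<in> prec ?B \<Longrightarrow> a \<in> last A1 \<Longrightarrow> b \<in> last A2 \<Longrightarrow> a < b" for A1 A2 a b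
    unfolding prec_chain bracket_order_def by blast
  have ne: "last A \<noteq> {} \<and> A \<noteq> []" if "A \<in> brackets ?B" for A
  proof -
    obtain k where "A \<in> level_set ?B k" using lev \<open>A \<in> brackets ?B\<close> by blast
    then have "is_bracket T k A" using br by blast
    then show ?thesis
      using is_bracket_last is_bracket_nonempty is_bracket_length by fastforce
  qed
  have "is_bracketing T ?B"
    unfolding is_bracketing_def
  proof (intro conjI ballI allI impI)
    show "\<exists>k\<le>depth T. is_bracket T k A" if "A \<in> brackets ?B" for A
      using lev[OF that] br by blast
    show "prec ?B \<subseteq> brackets ?B \<times> brackets ?B"
      unfolding prec_chain bracket_order_def by auto
    show "irrefl (prec ?B)"
      using ne ord_lt unfolding irrefl_def prec_chain bracket_order_def by fastforce
    show "trans (prec ?B)"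
    proof (rule transI)
      fix A1 A2 A3 assume *: "(A1, A2) \<in> prec ?B" "(A2, A3) \<in> prec ?B"
      then obtain b where b: "b \<in> last A2"
        using ne[of A2] unfolding prec_chain bracket_order_def by blast
      have "\<forall>a\<in>last A1. \<forall>c\<in>last A3. a < c"
        using ord_lt[OF *(1) _ b] ord_lt[OF *(2) b] by (meson less_trans)
      then show "(A1, A3) \<in> prec ?B"
        using * unfolding prec_chain bracket_order_def by simp
    qed
    show "max_bracket T k \<in> level_set ?B k" if "k \<le> depth T" for k
    proof -
      obtain u where u: "u \<in> VT T k" using VT_nonempty[OF \<open>k \<le> depth T\<close>] by blast
      then have "max_bracket T k = fam T (coords T) u"
        using fam_coords[OF VT_verts[OF u]] length_VT[OF u] by simp
      then show ?thesis using ends(2) u unfolding level_chain by blast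
    qed
    show "singleton_bracket u \<in> level_set ?B k" if "u \<in> VT T k" for u k
      using fam_empty[OF VT_verts[OF that]] ends(1) that unfolding level_chain by (metis UN_iff imageI)
    show "proj A \<in> level_set ?B (k - 1)" if "k \<in> {1..depth T}" "A \<in> level_set ?B k" for k A
    proof -
      obtain j where j: "k = Suc j" using \<open>k \<in> {1..depth T}\<close> by (cases k) auto
      then have "j < depth T" using \<open>k \<in> {1..depth T}\<close> by auto
      show ?thesis
        using that(2) butlast_fam_cv cv_in[OF \<open>j < depth T\<close>] unfolding level_chain j by fastforce
    qed
    show "A1 \<sqsubseteq>\<^sub>b A2 \<or> A2 \<sqsubseteq>\<^sub>b A1"
      if "A1 \<in> level_set ?B k" "A2 \<in> level_set ?B k" "A1 ! k \<inter> A2 ! k \<noteq> {}" for k A1 A2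
      using that lam nth unfolding level_chain by fastforce
    show "(\<Union>A'\<in>fibre ?B A. A' ! k) = (\<Union>u\<in>A ! (k - 1). ch T u)"
      if "k \<in> {1..depth T}" "A \<in> level_set ?B (k - 1)" for k A
    proof -
      obtain j where j: "k = Suc j" using \<open>k \<in> {1..depth T}\<close> by (cases k) auto
      then have jd: "j < depth T" using \<open>k \<in> {1..depth T}\<close> by auto
      obtain X w where X: "X \<in> \<X>" "w \<in> VT T j" "A = fam T X w"
        using \<open>A \<in> level_set ?B (k - 1)\<close> j unfolding level_chain by auto
      have len: "length A = Suc j" using X length_VT by simp
      have Aj: "A ! j = cls T X j w" using X nth by simp
      show ?thesis
      proof (intro equalityI subsetI)
        fix v assume "v \<in> (\<Union>A'\<in>fibre ?B A. A' ! k)"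
        then obtain Y u where Y: "u \<in> VT T (Suc j)" "fam T Y (cv j) = A" "v \<in> fam T Y u ! Suc j"
          unfolding fibre_chain[OF len] j by blast
        have "v \<in> ch T (cv j)"
          using Y(3) nth[OF Y(1)] cls_subset ch_cv[OF jd] by fastforce
        moreover have "cv j \<in> A ! j"
          using Y(2) nth[OF cv_in[OF jd]] cls_self[OF cv_in[OF jd]] by metis
        ultimately show "v \<in> (\<Union>u\<in>A ! (k - 1). ch T u)"
          using j by auto
      next
        fix v assume "v \<in> (\<Union>u\<in>A ! (k - 1). ch T u)"
        then obtain u where u: "u \<in> cls T X j w" "v \<in> ch T u"
          using j Aj by auto
        then have "u \<in> VT T j" using cls_subset by blast
        from ch_cases[OF u(2) this] have v: "u = cv j" "v \<in> VT T (Suc j)" by auto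
        then have "fam T X (cv j) = A"
          using fam_cong_cls[OF X(2), of "cv j" X] u X(3) by simp
        then have "fam T X v \<in> fibre ?B A"
          unfolding fibre_chain[OF len] using X v by blast
        then show "v \<in> (\<Union>A'\<in>fibre ?B A. A' ! k)"
          using nth[OF v(2)] cls_self[OF v(2)] j by blast
      qed
    qed
    show "\<exists>A3\<in>fibre ?B A. u' \<in> A3 ! k \<and> A3 \<sqsubset>\<^sub>b A1"
      if "k \<in> {1..depth T}" and A: "A \<in> level_set ?B (k - 1)" and f: "A1 \<in> fibre ?B A" "A2 \<in> fibre ?B A"
        and lt: "A2 \<sqsubset>\<^sub>b A1" and u': "u' \<in> A1 ! k" for k A A1 A2 u'
    proof -
      obtain j where j: "k = Suc j" using \<open>k \<in> {1..depth T}\<close> by (cases k) auto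
      have len: "length A = Suc j" using A j level_setD by fastforce
      obtain X u where X: "X \<in> \<X>" "u \<in> VT T k" "A1 = fam T X u"
        using f(1) unfolding fibre_chain[OF len] j by blast
      obtain Y v where Y: "Y \<in> \<X>" "v \<in> VT T k" "fam T Y (cv j) = A" "A2 = fam T Y v"
        using f(2) unfolding fibre_chain[OF len] j by blast
      have uX: "u' \<in> cls T X k u" using u' X nth by simp
      then have u'V: "u' \<in> VT T k" using cls_subset by blast
      have A3: "fam T Y u' \<in> fibre ?B A"
        unfolding fibre_chain[OF len] using Y u'V j by blast
      \<comment> \<open>The refining bracket is taken from the family of the smaller bracket
        \<open>A2\<close>. If it contained \<open>A1\<close>, then its part at \<open>u'\<close>
        would contain the part of \<open>v\<close>, so it would be \<open>A2\<close> itself, which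
        is strictly smaller than \<open>A1\<close>.\<close>
      have "\<not> A1 \<sqsubseteq>\<^sub>b fam T Y u'"
      proof
        assume le: "A1 \<sqsubseteq>\<^sub>b fam T Y u'"
        have "v \<in> cls T Y k v" by (rule cls_self[OF Y(2)])
        also have "\<dots> \<subseteq> cls T X k u"
          using bracket_le_last[of A2 A1] lt X Y lst by (auto simp: bracket_less_def)
        also have "\<dots> \<subseteq> cls T Y k u'"
          using bracket_le_last[OF le] X lst u'V by auto
        finally have "A2 = fam T Y u'"
          using fam_cong_cls[OF u'V] Y(4) by simp
        then show False
          using le lt bracket_le_antisym by (auto simp: bracket_less_def)
      qed
      moreover from this have "fam T Y u' \<sqsubseteq>\<^sub>b A1"
        using lam[OF Y(1) X(1) u'V X(2) cls_self[OF u'V] uX] X(3) by blast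
      ultimately have "fam T Y u' \<sqsubset>\<^sub>b A1"
        using bracket_le_refl by (auto simp: bracket_less_def)
      then show ?thesis
        using A3 nth[OF u'V] cls_self[OF u'V] by blast
    qed
    show "comparable ?B A1 A2 \<longleftrightarrow> length A1 = length A2 \<and> proj A1 = proj A2 \<and> last A1 \<inter> last A2 = {}"
      if "A1 \<in> brackets ?B" "A2 \<in> brackets ?B" for A1 A2
      by (rule cmp[OF that])
    show "(singleton_bracket u1, singleton_bracket u2) \<in> prec ?B"
      if "u \<in> verts T" "u1 \<in> ch T u" "u2 \<in> ch T u" "u1 < u2" for u u1 u2
    proof -
      have uV: "u \<in> VT T (length u)" using \<open>u \<in> verts T\<close> verts_iff_VT by blast
      note c = ch_cases[OF that(2) uV] ch_cases[OF that(3) uV]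
      have "singleton_bracket u1 \<in> brackets ?B" "singleton_bracket u2 \<in> brackets ?B"
        using fam_empty[OF VT_verts[OF c(3)]] fam_empty[OF VT_verts[OF c(6)]] ends(1) VT_verts[OF c(3)] VT_verts[OF c(6)]
        unfolding brackets_chain by (metis UN_iff imageI)+
      moreover have "length u1 = length u2" using c(3,6) by (simp add: VT_def)
      ultimately show ?thesis
        unfolding prec_chain bracket_order_def
        using that(4) proj_singleton[OF c(3)] proj_singleton[OF c(6)]
        by (simp add: last_singleton_bracket length_singleton_bracket)
    qed
    show "(A1, A2) \<in> prec ?B \<longleftrightarrow> (A1', A2') \<in> prec ?B"
      if f: "A1 \<in> fibre ?B A" "A2 \<in> fibre ?B A" "A1' \<in> fibre ?B A'" "A2' \<in> fibre ?B A'"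
        and *: "A' \<sqsubseteq>\<^sub>b A \<and> A1 \<noteq> A2 \<and> comparable ?B A1 A2 \<and> A1' \<noteq> A2' \<and> comparable ?B A1' A2' \<and>
          A1' \<sqsubseteq>\<^sub>b A1 \<and> A2' \<sqsubseteq>\<^sub>b A2" for A A' A1 A2 A1' A2'
    proof -
      note in_B = f[THEN length_fibre]
      \<comment> \<open>The same two vertices represent both pairs of brackets, so both orders are
        the order of \<open>a\<close> and \<open>b\<close>.\<close>
      obtain a b where ab: "a \<in> last A1'" "b \<in> last A2'"
        using ne[of A1'] ne[of A2'] in_B by blast
      then have ab': "a \<in> last A1" "b \<in> last A2"
        using bracket_le_last[of A1' A1] bracket_le_last[of A2' A2] ne[of A1'] ne[of A2'] in_B * by blast+
      then show ?thesis
        using * ord_lt[of A1 A2 a b] ord_lt[of A1' A2' a b] ord_lt[of A2 A1 b a] ord_lt[of A2' A1' b a] ab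
        unfolding comparable_def by (meson less_asym)
    qed
  qed
  then show ?thesis by (simp add: KT_def)
qed

end

section \<open>Families inside an arbitrary bracketing\<close>

lemma butlast_last_eqI:
  "xs \<noteq> [] \<Longrightarrow> ys \<noteq> [] \<Longrightarrow> butlast xs = butlast ys \<Longrightarrow> last xs = last ys \<Longrightarrow> xs = ys"
  by (metis append_butlast_last_id)

lemma take_level_set:
  assumes B: "B \<in> KT T" and "A \<in> level_set B m" "j \<le> m"
  shows "take (Suc j) A \<in> level_set B j"
  using assms(3,2)
proof (induction arbitrary: A rule: dec_induct)
  case base
  then show ?case by (simp add: level_set_def)
next
  case (step m)
  have "take (Suc j) (proj A) \<in> level_set B j"
    using step.IH[OF KT_proj[OF B step.prems]] .
  moreover have "take (Suc j) (proj A) = take (Suc j) A"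
    using step.hyps level_setD[OF step.prems] by (simp add: butlast_conv_take min_def)
  ultimately show ?case by simp
qed

context conc_tree
begin

text \<open>The elements of a fibre that are minimal for inclusion partition the vertices of the next
  level, because of the refinement axiom; the same holds after replacing those inside a given
  element by that element.\<close>

lemma fibre_partition:
  assumes B: "B \<in> KT T" and P: "P \<in> level_set B j" and jd: "j < depth T" and cvP: "cv j \<in> P ! j"
    and A0: "A0 \<in> fibre B P"
  obtains g where "\<And>u. u \<in> VT T (Suc j) \<Longrightarrow> g u \<in> fibre B P \<and> u \<in> last (g u)"
    and "\<And>u v. u \<in> VT T (Suc j) \<Longrightarrow> v \<in> last (g u) \<Longrightarrow> g v = g u"
    and "\<And>u. u \<in> last A0 \<Longrightarrow> g u = A0"
proof -
  let ?F = "fibre B P"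
  have lev: "D \<in> level_set B (Suc j)" and pr: "proj D = P" if "D \<in> ?F" for D
    using that level_setD[OF P] by (auto simp: fibre_def)
  have br: "is_bracket T (Suc j) D" if "D \<in> ?F" for D
    using KT_bracket[OF B lev[OF that]] by simp
  have lst: "last D = D ! Suc j" if "D \<in> ?F" for D
    using is_bracket_last[OF br[OF that]] .
  have sub: "last D \<subseteq> VT T (Suc j)" if "D \<in> ?F" for D
    using is_bracket_subset[OF br[OF that], of "Suc j"] lst[OF that] by simp
  have eqI: "D = D'" if "D \<in> ?F" "D' \<in> ?F" "last D = last D'" for D D'
    using that pr is_bracket_length[OF br] by (metis append_butlast_last_id list.size(3) nat.distinct(1))
  have lam: "D \<sqsubseteq>\<^sub>b D' \<or> D' \<sqsubseteq>\<^sub>b D" if "D \<in> ?F" "D' \<in> ?F" "w \<in> last D" "w \<in> last D'" for D D' w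
    using KT_laminar[OF B lev[OF that(1)] lev[OF that(2)]] lst that by blast
  have ne: "D \<noteq> []" if "D \<in> ?F" for D
    using is_bracket_length[OF br[OF that]] by auto
  have "\<exists>D. (D \<in> ?F \<and> u \<in> last D) \<and> (\<forall>D'. D' \<in> ?F \<longrightarrow> \<not> D' \<sqsubset>\<^sub>b D)" if u: "u \<in> VT T (Suc j)" for u
  proof -
    have "u \<in> (\<Union>u\<in>P ! j. ch T u)"
      using u cvP ch_cv[OF jd] by blast
    then obtain D0 where "D0 \<in> ?F \<and> u \<in> last D0"
      using KT_cover[OF B P jd] lst by blast
    \<comment> \<open>A bracket of the fibre with the fewest top vertices among those through
      \<open>u\<close> is minimal in the whole fibre: any smaller bracket, even one missing
      \<open>u\<close>, would by refinement yield a smaller one through \<open>u\<close>.\<close>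
    then obtain D where D: "D \<in> ?F \<and> u \<in> last D"
      and least: "\<And>D'. D' \<in> ?F \<and> u \<in> last D' \<Longrightarrow> card (last D) \<le> card (last D')"
      using ex_has_least_nat[of "\<lambda>D. D \<in> ?F \<and> u \<in> last D" D0 "\<lambda>D. card (last D)"] by blast
    have "\<not> D' \<sqsubset>\<^sub>b D" if D': "D' \<in> ?F" for D'
    proof
      assume "D' \<sqsubset>\<^sub>b D"
      then obtain D3 where D3: "D3 \<in> ?F" "u \<in> last D3" "D3 \<sqsubset>\<^sub>b D"
        using KT_refine[OF B P jd, of D D' u] D D' lst by blast
      have "last D3 \<subseteq> last D"
        using bracket_le_last[of D3 D] D3 ne by (auto simp: bracket_less_def)
      moreover have "finite (last D)"
        using sub D finite_subset[OF _ finite_VT] by blast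
      ultimately have "last D3 = last D"
        using least[of D3] D3 card_seteq by blast
      then show False
        using eqI[of D3 D] D D3 by (simp add: bracket_less_def)
    qed
    then show ?thesis using D by blast
  qed
  then obtain h where h: "\<And>u. u \<in> VT T (Suc j) \<Longrightarrow> h u \<in> ?F \<and> u \<in> last (h u)"
    and hmin: "\<And>u D'. u \<in> VT T (Suc j) \<Longrightarrow> D' \<in> ?F \<Longrightarrow> \<not> D' \<sqsubset>\<^sub>b h u"
    by metis
  have hh: "h u = h v" if "u \<in> VT T (Suc j)" "v \<in> VT T (Suc j)" "w \<in> last (h u)" "w \<in> last (h v)" for u v w
    using lam[of "h u" "h v" w] h hmin that unfolding bracket_less_def by metis
  \<comment> \<open>A minimal bracket that meets \<open>A0\<close> lies inside it by laminarity, so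
    substituting \<open>A0\<close> for the minimal brackets within it cuts through no part.\<close>
  have hA: "u \<in> last A0" if u: "u \<in> VT T (Suc j)" "w \<in> last (h u)" "w \<in> last A0" for u w
  proof -
    have "h u \<sqsubseteq>\<^sub>b A0"
      using lam[of "h u" A0 w] h[OF u(1)] A0 hmin[OF u(1) A0] u bracket_le_refl unfolding bracket_less_def by metis
    then show ?thesis
      using bracket_le_last[of "h u" A0] ne h[OF u(1)] by blast
  qed
  let ?g = "\<lambda>u. if u \<in> last A0 then A0 else h u"
  show ?thesis
  proof (rule that[of ?g])
    show "?g u \<in> ?F \<and> u \<in> last (?g u)" if "u \<in> VT T (Suc j)" for u
      using h[OF that] A0 by simp
    show "?g v = ?g u" if uv: "u \<in> VT T (Suc j)" "v \<in> last (?g u)" for u v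
    proof (cases "u \<in> last A0")
      case True
      then show ?thesis using uv by simp
    next
      case False
      then have v: "v \<in> last (h u)" using uv by simp
      then have "v \<in> VT T (Suc j)" using sub h[OF uv(1)] by blast
      then show ?thesis using hA[OF uv(1) v] hh[OF uv(1) _ v, of v] h[of v] False by auto
    qed
  qed simp
qed

text \<open>A partition of a level into intervals is recovered from the gaps interior to its parts.
  Here \<open>g u\<close> is the bracket whose top part contains \<open>u\<close>.\<close>

lemma cls_of_partition:
  assumes g: "\<And>u. u \<in> VT T k \<Longrightarrow> is_bracket T k (g u) \<and> u \<in> last (g u)"
    and part: "\<And>u v. u \<in> VT T k \<Longrightarrow> v \<in> last (g u) \<Longrightarrow> g v = g u"
    and k: "1 \<le> k" "k \<le> depth T" and u: "u \<in> VT T k"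
    and X: "\<And>i. (k, i) \<in> coords T \<Longrightarrow> (k, i) \<in> X \<longleftrightarrow> vtx T k (Suc i) \<in> last (g (vtx T k i))"
  shows "cls T X k u = last (g u)"
proof
  have sub: "last (g u) \<subseteq> VT T k" if "u \<in> VT T k" for u
    using g[OF that] is_bracket_subset[of T k "g u" k] is_bracket_last[of T k "g u"] by auto
  show "last (g u) \<subseteq> cls T X k u"
  proof (rule convex_linked[OF sub[OF u] k])
    show "c \<in> last (g u)" if "a \<in> last (g u)" "b \<in> last (g u)" "c \<in> VT T k" "a \<le> c" "c \<le> b" for a b c
      using is_bracket_convex[of k "g u" k a b c] g[OF u] that is_bracket_last[of T k "g u"] by simp
    show "(k, i) \<in> X" if "(k, i) \<in> coords T" "vtx T k i \<in> last (g u)" "vtx T k (Suc i) \<in> last (g u)" for i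
      using X[OF that(1)] part[OF u that(2)] that(3) by simp
    show "u \<in> last (g u)" using g[OF u] by simp
  qed
  have up: "b \<in> last (g a)" if a: "a \<in> VT T k" and b: "b \<in> VT T k" and "a < b" and l: "linked T X k a b" for a b
  proof -
    \<comment> \<open>The last vertex up to \<open>b\<close> in the part of \<open>a\<close>. If it
      were not \<open>b\<close>, the gap after it would be in \<open>X\<close> and the part would
      reach one vertex further.\<close>
    define S where "S = {z \<in> VT T k. z \<in> last (g a) \<and> z \<le> b}"
    have fin: "finite S" unfolding S_def by simp
    have "a \<in> S" using a g[OF a] \<open>a < b\<close> by (simp add: S_def)
    then obtain z where "z \<in> S" and az: "a \<le> z" and max: "\<And>y. y \<in> S \<Longrightarrow> y \<le> z"
      using Max_in[OF fin] Max_ge[OF fin] by (metis empty_iff)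
    then have z: "z \<in> VT T k" "z \<in> last (g a)" "z \<le> b" by (auto simp: S_def)
    show ?thesis
    proof (cases "z = b")
      case False
      then have "z < b" using z(3) by simp
      then obtain i where i: "1 \<le> i" "i \<le> tnum T k" "vtx T k i = z" "vtx T k (Suc i) \<le> b"
        using gap_above[OF z(1) b] by blast
      then have "(k, i) \<in> X" using l az unfolding linked_def by simp
      moreover have "(k, i) \<in> coords T" using i k by (simp add: coords_def)
      ultimately have "vtx T k (Suc i) \<in> last (g a)"
        using X[of i] i(3) part[OF a z(2)] by simp
      then have "vtx T k (Suc i) \<in> S"
        using i gap_vtx(2)[OF i(1,2)] by (simp add: S_def)
      then have "vtx T k (Suc i) \<le> z" by (rule max)
      then show ?thesis using gap_vtx(3)[OF i(1,2)] i(3) by simp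
    qed (use z in simp)
  qed
  show "cls T X k u \<subseteq> last (g u)"
  proof
    fix v assume "v \<in> cls T X k u"
    then have v: "v \<in> VT T k" "linked T X k u v" by (auto simp: cls_def)
    consider "u < v" | "u = v" | "v < u" by (metis linorder_neqE)
    then show "v \<in> last (g u)"
    proof cases
      case 1
      then show ?thesis using up[OF u v(1) _ v(2)] by simp
    next
      case 2
      then show ?thesis using g[OF u] by simp
    next
      case 3
      then have "u \<in> last (g v)" using up[OF v(1) u _ linked_sym[OF v(2)]] by simp
      then show ?thesis using part[OF v(1), of u] g[OF v(1)] by simp
    qed
  qed
qed

text \<open>The set \<open>X\<close> is built level by level. All vertices of the next level are
  children of \<open>cv k\<close>, so only the fibre over the family bracket of \<open>cv k\<close>
  is involved, and a partition of the next level by members of that fibre supplies the new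
  gaps.\<close>

lemma family_through_bracket:
  assumes B: "B \<in> KT T" and A: "A \<in> brackets B"
  obtains X u where "X \<subseteq> coords T" "\<And>u. u \<in> verts T \<Longrightarrow> fam T X u \<in> brackets B"
    "u \<in> verts T" "fam T X u = A"
proof -
  obtain m where m: "A \<in> level_set B m" using KT_level[OF B A] by blast
  have brA: "is_bracket T m A" "m \<le> depth T" using KT_bracket[OF B m] by auto
  have "\<exists>X\<subseteq>coords T. (\<forall>j\<le>k. \<forall>u\<in>VT T j. fam T X u \<in> brackets B) \<and>
      (\<forall>j\<le>k. j \<le> m \<longrightarrow> (\<forall>u\<in>A ! j. fam T X u = take (Suc j) A))" if "k \<le> depth T" for k
    using that
  proof (induction k)
    case 0
    have "fam T {} [] = take (Suc 0) A"
    proof -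
      have "A ! 0 = {[]}"
        using is_bracket_subset[OF brA(1), of 0] is_bracket_nonempty[OF brA(1), of 0] by auto
      moreover have "A \<noteq> []" using is_bracket_length[OF brA(1)] by auto
      ultimately show ?thesis
        using cls_empty[of "[]" T 0] by (cases A) (auto simp: fam_def)
    qed
    moreover have "fam T {} [] \<in> brackets B"
      using KT_singleton[OF B, of "[]" 0] fam_empty[of "[]" T] level_setD by (fastforce simp: verts_def)
    moreover have "A ! 0 \<subseteq> {[]}"
      using is_bracket_subset[OF brA(1), of 0] by auto
    ultimately show ?case by (intro exI[of _ "{}"]) auto
  next
    case (Suc k)
    then obtain X where X: "X \<subseteq> coords T" "\<forall>j\<le>k. \<forall>u\<in>VT T j. fam T X u \<in> brackets B"
      "\<forall>j\<le>k. j \<le> m \<longrightarrow> (\<forall>u\<in>A ! j. fam T X u = take (Suc j) A)"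
      by auto
    have kd: "k < depth T" using Suc.prems by simp
    note cvk = cv_in[OF kd]
    let ?P = "fam T X (cv k)"
    have P: "?P \<in> level_set B k"
      using bspec[OF X(2)[THEN spec, THEN mp, OF order_refl] cvk] length_VT[OF cvk]
      by (simp add: level_set_def)
    have cvP: "cv k \<in> ?P ! k" using cls_self[OF cvk] length_VT[OF cvk] by simp
    \<comment> \<open>\<open>A0\<close> steers the partition through \<open>A\<close> as long as
      \<open>A\<close> has a component at the next level; above the top of \<open>A\<close> any
      member of the fibre serves.\<close>
    have "\<exists>A0. A0 \<in> fibre B ?P \<and> (Suc k \<le> m \<longrightarrow> A0 = take (Suc (Suc k)) A)"
    proof (cases "Suc k \<le> m")
      case True
      have "take (Suc (Suc k)) A \<in> level_set B (Suc k)"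
        by (rule take_level_set[OF B m True])
      moreover have "?P = take (Suc k) A"
        using X(3) True is_bracket_cv[OF brA(1), of k] by simp
      moreover have "proj (take (Suc (Suc k)) A) = take (Suc k) A"
        using True is_bracket_length[OF brA(1)] by (simp add: butlast_take)
      ultimately have "take (Suc (Suc k)) A \<in> fibre B ?P"
        unfolding fibre_def length_fam length_VT[OF cvk] by simp
      then show ?thesis by blast
    next
      case False
      obtain v where "v \<in> VT T (Suc k)" using VT_nonempty[OF Suc.prems] by blast
      then have "v \<in> (\<Union>u\<in>?P ! k. ch T u)" using cvP ch_cv[OF kd] by blast
      then show ?thesis using KT_cover[OF B P kd] False by blast
    qed
    then obtain A0 where A0: "A0 \<in> fibre B ?P" "Suc k \<le> m \<longrightarrow> A0 = take (Suc (Suc k)) A" by blast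
    obtain g where g: "\<And>u. u \<in> VT T (Suc k) \<Longrightarrow> g u \<in> fibre B ?P \<and> u \<in> last (g u)"
      "\<And>u v. u \<in> VT T (Suc k) \<Longrightarrow> v \<in> last (g u) \<Longrightarrow> g v = g u"
      "\<And>u. u \<in> last A0 \<Longrightarrow> g u = A0"
      using fibre_partition[OF B P kd cvP A0(1)] by metis
    \<comment> \<open>Levels up to \<open>k\<close> are kept, which leaves the brackets already
      built unchanged; the gaps added at the next level are those interior to the parts of
      \<open>g\<close>.\<close>
    define Y where "Y = {(r, i) \<in> X. r \<le> k} \<union> {(r, i) \<in> coords T. r = Suc k \<and> vtx T r (Suc i) \<in> last (g (vtx T r i))}"
    have low: "fam T Y u = fam T X u" if "u \<in> VT T j" "j \<le> k" for u j
      using that length_VT[OF that(1)] cls_cong[of _ Y X T] by (auto simp: fam_eq_iff Y_def)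
    have brg: "is_bracket T (Suc k) (g u) \<and> u \<in> last (g u)" if "u \<in> VT T (Suc k)" for u
    proof -
      have "g u \<in> level_set B (Suc k)"
        using g(1)[OF that] length_VT[OF cvk] by (simp add: fibre_def)
      then show ?thesis using KT_bracket[OF B] g(1)[OF that] by blast
    qed
    have new: "fam T Y u = g u" if u: "u \<in> VT T (Suc k)" for u
    proof -
      have "cls T Y (Suc k) u = last (g u)"
        by (rule cls_of_partition[OF brg g(2)]) (use Suc.prems u in \<open>auto simp: Y_def\<close>)
      then have l: "last (fam T Y u) = last (g u)"
        using length_VT[OF u] by (simp add: last_fam)
      have b: "proj (fam T Y u) = proj (g u)"
        using butlast_fam_cv[OF u] low[OF cvk] length_fibre[of "g u" B ?P] g(1)[OF u] by simp
      have n: "g u \<noteq> []" using is_bracket_length brg[OF u] by fastforce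
      show ?thesis by (rule butlast_last_eqI[OF fam_nonempty n b l])
    qed
    show ?case
    proof (intro exI[of _ Y] conjI allI impI ballI)
      show "Y \<subseteq> coords T" using X(1) by (auto simp: Y_def)
    next
      fix j u assume j: "j \<le> Suc k" and u: "u \<in> VT T j"
      show "fam T Y u \<in> brackets B"
      proof (cases "j = Suc k")
        case True
        then show ?thesis using new[of u] g(1)[of u] length_fibre[of "g u" B ?P] u by simp
      next
        case False
        then have jk: "j \<le> k" using j by simp
        then have "fam T X u \<in> brackets B" using X(2) u by blast
        then show ?thesis using low[OF u jk] by simp
      qed
    next
      fix j u assume j: "j \<le> Suc k" "j \<le> m" and u: "u \<in> A ! j"
      have uV: "u \<in> VT T j" using is_bracket_subset[OF brA(1) j(2)] u by auto
      show "fam T Y u = take (Suc j) A"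
      proof (cases "j = Suc k")
        case True
        then have "A0 = take (Suc (Suc k)) A" using A0(2) j by simp
        then have "last A0 = A ! Suc k"
          using True j is_bracket_length[OF brA(1)] by (simp add: take_Suc_conv_app_nth)
        then show ?thesis using new[of u] g(3)[of u] u uV True A0(2) j by simp
      next
        case False
        then have jk: "j \<le> k" using j by simp
        then have "fam T X u = take (Suc j) A" using X(3) j(2) u by blast
        then show ?thesis using low[OF uV jk] by simp
      qed
    qed
  qed
  from this[of "depth T"] obtain X where X: "X \<subseteq> coords T" "\<forall>j\<le>depth T. \<forall>u\<in>VT T j. fam T X u \<in> brackets B"
      "\<forall>j\<le>depth T. j \<le> m \<longrightarrow> (\<forall>u\<in>A ! j. fam T X u = take (Suc j) A)"
    by auto
  obtain u where u: "u \<in> A ! m" using is_bracket_nonempty[OF brA(1), of m] by blast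
  show ?thesis
  proof (rule that[OF X(1)])
    show "fam T X v \<in> brackets B" if "v \<in> verts T" for v
      using X(2) that verts_iff_VT VT_le_depth by blast
    show "u \<in> verts T" using u is_bracket_subset[OF brA(1), of m] VT_verts by blast
    show "fam T X u = A" using X(3) u brA is_bracket_length[OF brA(1)] by simp
  qed
qed

end

section \<open>Collisions\<close>

lemma fam_singleton_take:
  assumes "u \<in> verts T" "fam T X u = fam T {} u" "j \<le> length u"
  shows "fam T X (take j u) = fam T {} (take j u)"
  using take_fam[OF assms(3), of T X] take_fam[OF assms(3), of T "{}"] assms(2) by simp

lemma fam_eq_last: "fam T X u = fam T Y v \<Longrightarrow> cls T X (length u) u = cls T Y (length v) v"
  by (metis last_fam)

text \<open>A gap belongs to the set exactly when its right end is in the class of its left end, and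
  that class is the top part of a family bracket.\<close>

lemma fam_inj:
  assumes "X \<subseteq> coords T" "Y \<subseteq> coords T" "\<And>u. u \<in> verts T \<Longrightarrow> fam T X u = fam T Y u"
  shows "X = Y"
proof -
  have "(k, i) \<in> X \<longleftrightarrow> (k, i) \<in> Y" if c: "(k, i) \<in> coords T" for k i
  proof -
    have v: "vtx T k i \<in> VT T k" using c gap_vtx(1) by (auto simp: coords_def)
    have "cls T X k (vtx T k i) = cls T Y k (vtx T k i)"
      using fam_eq_last[OF assms(3)[OF VT_verts[OF v]]] length_VT[OF v] by simp
    then have "linked T X k (vtx T k i) (vtx T k (Suc i)) \<longleftrightarrow> linked T Y k (vtx T k i) (vtx T k (Suc i))"
      using gap_vtx(2)[of i T k] c by (auto simp: cls_def coords_def)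
    then show ?thesis using gap_linked_iff[OF c] by blast
  qed
  then show ?thesis using assms(1,2) by auto
qed

lemma nontrivial_fam:
  assumes "u \<in> verts T"
  shows "nontrivial T (fam T X u) \<longleftrightarrow> fam T X u \<noteq> fam T {} u \<and> fam T X u \<noteq> fam T (coords T) u"
  using is_singleton_fam[OF assms] fam_coords[OF assms] by (auto simp: nontrivial_def)

section \<open>The bracketing of a connected set of gaps\<close>

context conc_tree
begin

text \<open>Here \<open>k\<close> is the lowest level that meets \<open>X\<close> and
  \<open>w\<close> is any vertex of the single interval there; the nonsingleton clause ensures that
  level \<open>k\<close> does meet \<open>X\<close>. Testing the left end of a gap suffices, because
  a gap in \<open>X\<close> puts both ends in one class.\<close>

definition connected_at :: "(nat \<times> nat) set \<Rightarrow> nat \<Rightarrow> vertex \<Rightarrow> bool" where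
  "connected_at X k w \<longleftrightarrow> X \<subseteq> coords T \<and> 1 \<le> k \<and> w \<in> VT T k \<and> cls T X k w \<noteq> {w} \<and>
     (\<forall>(r, i)\<in>X. r = k \<and> vtx T r i \<in> cls T X k w \<or> k < r \<and> cv k \<in> cls T X k w)"

abbreviation bracketing_of :: "(nat \<times> nat) set \<Rightarrow> bracketing" where
  "bracketing_of X \<equiv> chain_bracketing {{}, X, coords T}"

lemma connected_low:
  assumes "connected_at X k w" "i < k"
  shows "cls T X i = cls T {} i"
  by (rule cls_cong) (use assms in \<open>auto simp: connected_at_def\<close>)

lemma connected_not_singleton:
  assumes "connected_at X k w"
  shows "fam T X w \<noteq> fam T {} w"
proof
  assume "fam T X w = fam T {} w"
  then have "last (fam T X w) = last (fam T {} w)" by simp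
  then show False
    using assms cls_empty[of w T k] by (auto simp: last_fam connected_at_def VT_def)
qed

text \<open>A nonsingleton component of the family bracket of \<open>z\<close> exhibits a gap of
  \<open>X\<close>. At level \<open>k\<close> this gap lies in the class of \<open>w\<close>; at a
  higher level the ancestor of \<open>z\<close> at level \<open>k\<close> is \<open>cv k\<close>,
  which connectedness puts in that class.\<close>

lemma connected_prefix:
  assumes c: "connected_at X k w" and z: "z \<in> verts T" "fam T X z \<noteq> fam T {} z"
  shows "k \<le> length z \<and> fam T X (take k z) = fam T X w"
proof -
  obtain i where i: "i \<le> length z" "cls T X i (take i z) \<noteq> cls T {} i (take i z)"
    using z(2) unfolding fam_eq_iff by blast
  have V: "take i z \<in> VT T i" by (rule take_verts[OF z(1) i(1)])
  have w: "w \<in> VT T k" using c by (simp add: connected_at_def)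
  obtain v where v: "v \<in> cls T X i (take i z)" "v \<noteq> take i z"
    using i(2)[unfolded cls_empty[OF V]] cls_self[OF V, of X] by blast
  have "i \<noteq> 0"
  proof
    assume "i = 0" then show False using v cls_subset[of T X 0 "[]"] by auto
  qed
  then obtain g where g: "(i, g) \<in> X" "vtx T i g \<in> cls T X i (take i z)"
    using linked_gap[OF V v] by (metis One_nat_def Suc_leI bot_nat_0.not_eq_extremum)
  have k_le: "k \<le> i" using c g(1) by (auto simp: connected_at_def)
  have "take k z \<in> cls T X k w"
  proof (cases "i = k")
    case True
    have "vtx T k g \<in> cls T X k w" using c g(1) True by (auto simp: connected_at_def)
    then have "cls T X k w = cls T X k (take k z)"
      using cls_eqI[OF w V[unfolded True]] g(2) True by blast
    then show ?thesis using cls_self[OF V[unfolded True]] by simp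
  next
    case False
    then have "cv k \<in> cls T X k w" using c g(1) by (auto simp: connected_at_def)
    moreover have "take k z = cv k"
      using take_cv[OF V, of k] k_le False by (simp add: min_def)
    ultimately show ?thesis by simp
  qed
  then show ?thesis
    using fam_cong_cls[OF w] k_le i(1) by simp
qed

text \<open>If one class is the whole level, then it is the class of every vertex there.\<close>

lemma max_below:
  assumes "z \<in> VT T a" "fam T X z = fam T (coords T) z" "v \<in> VT T b" "b \<le> a"
  shows "fam T X v = fam T (coords T) v"
proof -
  have eq: "cls T X i (take i z) = VT T i" if "i \<le> a" for i
    using assms(2) that length_VT[OF assms(1)] cls_coords[OF take_VT[OF assms(1) that]]
    unfolding fam_eq_iff by simp
  have "cls T X i (take i v) = VT T i" if "i \<le> b" for i
    using cls_eq[OF take_VT[OF assms(1), of i], of "take i v" X] take_VT[OF assms(3) that] eq[of i]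
      assms(4) that by auto
  then show ?thesis
    using length_VT[OF assms(3)] cls_coords[OF take_VT[OF assms(3)]] by (simp add: fam_eq_iff)
qed

text \<open>The delicate case is a nonsingleton family bracket that is a maximum bracket. As
  \<open>X\<close> is proper, some family bracket is not maximum; by \<open>max_below\<close> it is
  deeper, and it projects to the given one because the class of \<open>z\<close> is the whole
  level.\<close>

lemma nontrivial_above:
  assumes X: "X \<subseteq> coords T" "X \<noteq> coords T" and z: "z \<in> verts T" "fam T X z \<noteq> fam T {} z"
  obtains v where "v \<in> verts T" "length z \<le> length v" "fam T X (take (length z) v) = fam T X z"
    "nontrivial T (fam T X v)"
proof (cases "fam T X z = fam T (coords T) z")
  case False
  then show ?thesis using that[of z] z nontrivial_fam[OF z(1)] by simp
next
  case True
  obtain v where v: "v \<in> verts T" "fam T X v \<noteq> fam T (coords T) v"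
    using fam_inj[of X T "coords T"] X by blast
  have zV: "z \<in> VT T (length z)" and vV: "v \<in> VT T (length v)"
    using z(1) v(1) verts_iff_VT by blast+
  have len: "length z < length v"
    using max_below[OF zV True vV] v(2) by fastforce
  have "cls T X (length z) z = VT T (length z)"
    using fam_eq_last[OF True] cls_coords[OF zV] by simp
  then have pre: "fam T X (take (length z) v) = fam T X z"
    using fam_cong_cls[OF zV, of "take (length z) v" X] take_VT[OF vV, of "length z"] len by simp
  have "fam T X v \<noteq> fam T {} v"
  proof
    assume triv: "fam T X v = fam T {} v"
    have "fam T X (take (length z) v) = fam T {} (take (length z) v)"
      using fam_singleton_take[OF v(1) triv] len by simp
    then have "is_singleton_bracket T (fam T X z)"
      using is_singleton_fam[OF take_in_verts[OF v(1)]] pre by metis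
    then show False using is_singleton_fam[OF z(1)] z(2) by simp
  qed
  then show ?thesis
    using that[OF v(1) _ pre] len v nontrivial_fam[OF v(1)] by simp
qed

lemma brackets_of: "A \<in> brackets (bracketing_of X) \<longleftrightarrow>
    (\<exists>u\<in>verts T. A = fam T {} u \<or> A = fam T X u \<or> A = fam T (coords T) u)"
  unfolding brackets_chain by blast

lemma bracketing_of_KT:
  assumes "X \<subseteq> coords T"
  shows "bracketing_of X \<in> KT T"
  by (rule chain_bracketing_KT) (use assms in auto)

lemma nontrivial_in:
  assumes "A \<in> brackets (bracketing_of X)" "nontrivial T A"
  obtains v where "v \<in> verts T" "A = fam T X v" "fam T X v \<noteq> fam T {} v"
proof -
  obtain v where v: "v \<in> verts T" "A = fam T {} v \<or> A = fam T X v \<or> A = fam T (coords T) v"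
    using assms(1) unfolding brackets_of by blast
  then have "A = fam T X v"
    using assms(2) nontrivial_fam[OF v(1), of "{}"] nontrivial_fam[OF v(1), of "coords T"] by auto
  then show ?thesis
    using that[OF v(1)] assms(2) nontrivial_fam[OF v(1)] by simp
qed

text \<open>Iterated \<open>proj\<close> can run down to \<open>[]\<close>, and a singleton bracket
  need not lie below a nontrivial one; hence the two exclusions. In the other cases
  \<open>nontrivial_above\<close> supplies the nontrivial bracket.\<close>

lemma below_nontrivial_iff:
  assumes X: "X \<subseteq> coords T" "X \<noteq> coords T" and ns: "\<not> is_singleton_bracket T E" "E \<noteq> []"
  shows "below_nontrivial T (bracketing_of X) E \<longleftrightarrow> (\<exists>z\<in>verts T. E = fam T X z)"
proof
  assume "below_nontrivial T (bracketing_of X) E"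
  then obtain A l where A: "A \<in> brackets (bracketing_of X)" "nontrivial T A" "E = (proj ^^ l) A"
    by (auto simp: below_nontrivial_def)
  obtain v where v: "v \<in> verts T" "A = fam T X v"
    using nontrivial_in[OF A(1,2)] by metis
  have E: "E = take (Suc (length v) - l) (fam T X v)"
    using A(3) v(2) butlast_power[of l A] by simp
  with ns(2) have "l \<le> length v" by (cases "l \<le> length v") auto
  then have "E = fam T X (take (length v - l) v)"
    using E take_fam[of "length v - l" v T X] by (simp add: Suc_diff_le)
  then show "\<exists>z\<in>verts T. E = fam T X z"
    using take_in_verts[OF v(1)] by blast
next
  assume "\<exists>z\<in>verts T. E = fam T X z"
  then obtain z where z: "z \<in> verts T" "E = fam T X z" by blast
  then have "fam T X z \<noteq> fam T {} z" using ns(1) is_singleton_fam[OF z(1)] by simp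
  then obtain v where v: "v \<in> verts T" "length z \<le> length v" "fam T X (take (length z) v) = fam T X z"
    "nontrivial T (fam T X v)"
    using nontrivial_above[OF X z(1)] by metis
  have "(proj ^^ (length v - length z)) (fam T X v) = E"
    using v(2,3) z(2) take_fam[OF v(2), of T X] by (simp add: butlast_power Suc_diff_le)
  moreover have "fam T X v \<in> brackets (bracketing_of X)"
    using v(1) brackets_of by blast
  ultimately show "below_nontrivial T (bracketing_of X) E"
    using v(4) unfolding below_nontrivial_def by metis
qed

text \<open>Every nonsingleton family bracket projects to that of \<open>w\<close> by
  \<open>connected_prefix\<close>. A strictly longer one therefore still has a nonsingleton
  projection, which gives uniqueness.\<close>

lemma fusion_bracket_of:
  assumes c: "connected_at X k w" and X: "X \<noteq> coords T"
  shows "fusion_bracket T (bracketing_of X) = fam T X w"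
proof -
  have Xc: "X \<subseteq> coords T" and w: "w \<in> VT T k" and k: "1 \<le> k"
    using c by (auto simp: connected_at_def)
  have ns: "\<not> is_singleton_bracket T (fam T X w)"
    using connected_not_singleton[OF c] is_singleton_fam[OF VT_verts[OF w]] by simp
  obtain j where j: "k = Suc j" using k by (cases k) auto
  have jd: "j < depth T" using VT_SucD w j by simp
  show ?thesis
    unfolding fusion_bracket_def
  proof (rule the_equality, intro conjI)
    show "fam T X w \<in> brackets (bracketing_of X)"
      using brackets_of VT_verts[OF w] by blast
    show "\<not> is_singleton_bracket T (fam T X w)" by (rule ns)
    have "fam T X (cv j) = fam T {} (cv j)"
      using connected_low[OF c] length_VT[OF cv_in[OF jd]] j by (auto simp: fam_eq_iff)
    then show "is_singleton_bracket T (proj (fam T X w))"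
      using butlast_fam_cv[of w j X] w j is_singleton_fam[OF VT_verts[OF cv_in[OF jd]]] by simp
    show "below_nontrivial T (bracketing_of X) (fam T X w)"
      using below_nontrivial_iff[OF Xc X ns] VT_verts[OF w] by auto
  next
    fix E assume E: "E \<in> brackets (bracketing_of X) \<and> \<not> is_singleton_bracket T E \<and>
        is_singleton_bracket T (proj E) \<and> below_nontrivial T (bracketing_of X) E"
    then have "E \<noteq> []" using fam_nonempty unfolding brackets_of by metis
    then obtain z where z: "z \<in> verts T" "E = fam T X z"
      using below_nontrivial_iff[OF Xc X, of E] E by blast
    then have nz: "fam T X z \<noteq> fam T {} z" using E is_singleton_fam[OF z(1)] by simp
    from connected_prefix[OF c z(1) nz] have kz: "k \<le> length z" "fam T X (take k z) = fam T X w" by auto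
    have "k = length z"
    proof (rule ccontr)
      assume "k \<noteq> length z"
      then have lt: "k < length z" using kz by simp
      have bz: "proj E = fam T X (butlast z)" using z(2) butlast_fam[of z T X] lt by fastforce
      have bv: "butlast z \<in> verts T" using take_in_verts[OF z(1)] by (simp add: butlast_conv_take)
      have triv: "fam T X (butlast z) = fam T {} (butlast z)"
        using E bz is_singleton_fam[OF bv] by simp
      have "fam T X (take k (butlast z)) = fam T {} (take k (butlast z))"
        using fam_singleton_take[OF bv triv] lt by simp
      moreover have "take k (butlast z) = take k z"
        using lt by (simp add: take_butlast)
      ultimately have "is_singleton_bracket T (fam T X (take k z))"
        using is_singleton_fam[OF take_in_verts[OF z(1)]] by metis
      then show False using kz(2) ns by simp
    qed
    then show "E = fam T X w" using kz(2) z(2) by simp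
  qed
qed

text \<open>\<open>connected_prefix\<close> shows that nonsingleton family brackets reach the fusion
  bracket. Conversely, projections of singleton brackets are singleton (or empty), so these never
  reach it.\<close>

lemma essential_iff:
  assumes c: "connected_at X k w" and X: "X \<noteq> coords T"
  shows "essential T (bracketing_of X) E \<longleftrightarrow> (\<exists>z\<in>verts T. E = fam T X z \<and> fam T X z \<noteq> fam T {} z)"
proof
  have Xc: "X \<subseteq> coords T" and w: "w \<in> VT T k"
    using c by (auto simp: connected_at_def)
  {
    assume "essential T (bracketing_of X) E"
    then obtain j where E: "E \<in> brackets (bracketing_of X)" "below_nontrivial T (bracketing_of X) E"
      "(proj ^^ j) E = fam T X w"
      using fusion_bracket_of[OF c X] by (auto simp: essential_def)
    have ne: "E \<noteq> []" using E(1) fam_nonempty unfolding brackets_of by metis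
    have ns: "\<not> is_singleton_bracket T E"
    proof
      assume "is_singleton_bracket T E"
      then obtain u where u: "u \<in> verts T" "E = fam T {} u"
        using fam_empty unfolding is_singleton_bracket_def by metis
      have pw: "fam T X w = take (Suc (length u) - j) (fam T {} u)"
        using E(3) u(2) butlast_power[of j E] by simp
      then have "j \<le> length u" by (cases "j \<le> length u") auto
      then have "fam T X w = fam T {} (take (length u - j) u)"
        using pw take_fam[of "length u - j" u T "{}"] by (simp add: Suc_diff_le)
      then have "is_singleton_bracket T (fam T X w)"
        using is_singleton_fam[OF take_in_verts[OF u(1)], of "{}"] by simp
      then show False
        using connected_not_singleton[OF c] is_singleton_fam[OF VT_verts[OF w]] by simp
    qed
    obtain z where z: "z \<in> verts T" "E = fam T X z"
      using below_nontrivial_iff[OF Xc X ns ne] E(2) by blast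
    then show "\<exists>z\<in>verts T. E = fam T X z \<and> fam T X z \<noteq> fam T {} z"
      using ns is_singleton_fam[OF z(1)] by auto
  }
  assume "\<exists>z\<in>verts T. E = fam T X z \<and> fam T X z \<noteq> fam T {} z"
  then obtain z where z: "z \<in> verts T" "E = fam T X z" "fam T X z \<noteq> fam T {} z" by blast
  have "\<not> is_singleton_bracket T E" "E \<noteq> []"
    using z is_singleton_fam[OF z(1)] by auto
  then have "below_nontrivial T (bracketing_of X) E"
    using below_nontrivial_iff[OF Xc X] z by blast
  moreover have "E \<in> brackets (bracketing_of X)" using z brackets_of by blast
  moreover have "(proj ^^ (length z - k)) E = fam T X w"
    using connected_prefix[OF c z(1,3)] take_fam[of k z T X] z(2)
    by (simp add: butlast_power Suc_diff_le)
  ultimately show "essential T (bracketing_of X) E"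
    using fusion_bracket_of[OF c X] by (auto simp: essential_def)
qed

text \<open>A gap of \<open>X\<close> is witnessed by the family bracket of its left end, which is
  nonsingleton because it also contains the right end.\<close>

lemma ray_support_of:
  assumes c: "connected_at X k w" and X: "X \<noteq> coords T"
  shows "ray_support T (bracketing_of X) = X"
proof (intro equalityI subrelI)
  have Xc: "X \<subseteq> coords T"
    using c by (auto simp: connected_at_def)
  {
    fix r i assume "(r, i) \<in> ray_support T (bracketing_of X)"
    then obtain E where E: "(r, i) \<in> coords T" "E \<in> level_set (bracketing_of X) r"
      "essential T (bracketing_of X) E" "vtx T r i \<in> E ! r" "vtx T r (Suc i) \<in> E ! r"
      by (auto simp: ray_support_def)
    then obtain z where z: "z \<in> verts T" "E = fam T X z"
      using essential_iff[OF c X] by blast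
    then have "length z = r" using E(2) by (simp add: level_set_def)
    then have "z \<in> VT T r" "E ! r = cls T X r z"
      using z verts_iff_VT by auto
    then show "(r, i) \<in> X" using gap_in_X[OF E(1)] E by simp
  next
    fix r i assume ri: "(r, i) \<in> X"
    then have rc: "(r, i) \<in> coords T" using Xc by blast
    then have i: "1 \<le> i" "i \<le> tnum T r" by (auto simp: coords_def)
    note V = gap_vtx[OF i]
    let ?E = "fam T X (vtx T r i)"
    have len: "length (vtx T r i) = r" by (rule length_VT[OF V(1)])
    have in_E: "vtx T r i \<in> ?E ! r" "vtx T r (Suc i) \<in> ?E ! r"
      using len cls_self[OF V(1)] gap_cls[OF rc ri] by auto
    have "?E \<noteq> fam T {} (vtx T r i)"
    proof
      assume "?E = fam T {} (vtx T r i)"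
      then have "fam T {} (vtx T r i) ! r = ?E ! r" by (rule arg_cong[OF sym])
      also have "fam T {} (vtx T r i) ! r = {vtx T r i}"
        using len cls_empty[OF V(1)] by simp
      finally show False using in_E(2) V(3) by (metis less_irrefl singletonD)
    qed
    then have "essential T (bracketing_of X) ?E"
      using essential_iff[OF c X] VT_verts[OF V(1)] by blast
    moreover have "?E \<in> level_set (bracketing_of X) r"
      using VT_verts[OF V(1)] len brackets_of unfolding level_set_def by auto
    ultimately show "(r, i) \<in> ray_support T (bracketing_of X)"
      unfolding ray_support_def using rc in_E by auto
  }
qed

text \<open>Both orders are \<open>bracket_order\<close> of the respective brackets by
  \<open>prec_eq\<close>, so restriction is automatic.\<close>

lemma bracketing_le_iff:
  assumes "B \<in> KT T" "B' \<in> KT T"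
  shows "B \<le>\<^sub>K B' \<longleftrightarrow> brackets B \<subseteq> brackets B'"
  unfolding bracketing_le_def prec_eq[OF assms(1)] prec_eq[OF assms(2)] bracket_order_def by auto

lemma bracketing_eqI:
  assumes "B \<in> KT T" "B' \<in> KT T" "brackets B = brackets B'"
  shows "B = B'"
  using prec_eq[OF assms(1)] prec_eq[OF assms(2)] assms(3) by simp

lemma trivial_in_KT:
  assumes B: "B \<in> KT T" and u: "u \<in> verts T"
  shows "fam T {} u \<in> brackets B" "fam T (coords T) u \<in> brackets B"
proof -
  have uV: "u \<in> VT T (length u)" using u verts_iff_VT by blast
  show "fam T {} u \<in> brackets B"
    using KT_singleton[OF B uV] fam_empty[OF u] level_setD by metis
  show "fam T (coords T) u \<in> brackets B"
    using KT_max[OF B VT_le_depth[OF uV]] fam_coords[OF u] level_setD by metis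
qed

lemma minimum_iff:
  assumes B: "B \<in> KT T"
  shows "is_minimum T B \<longleftrightarrow> (\<forall>A\<in>brackets B. \<not> nontrivial T A)"
proof
  assume min: "is_minimum T B"
  \<comment> \<open>A bracketing without nontrivial brackets to compare the minimum with.\<close>
  have KT0: "bracketing_of {} \<in> KT T" by (rule bracketing_of_KT) simp
  have "brackets B \<subseteq> brackets (bracketing_of {})"
    using min KT0 bracketing_le_iff[OF B KT0] by (simp add: is_minimum_def)
  then show "\<forall>A\<in>brackets B. \<not> nontrivial T A"
    using nontrivial_in[of _ "{}"] by blast
next
  assume triv: "\<forall>A\<in>brackets B. \<not> nontrivial T A"
  have "brackets B \<subseteq> brackets B'" if B': "B' \<in> KT T" for B'
  proof
    fix A assume A: "A \<in> brackets B"
    obtain k where k: "A \<in> level_set B k" using KT_level[OF B A] by blast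
    then have kd: "k \<le> depth T" "length A = Suc k" using KT_bracket[OF B k] level_setD[OF k] by auto
    from triv A consider u where "u \<in> verts T" "A = singleton_bracket u" | "A = max_bracket T k"
      using kd by (auto simp: nontrivial_def is_singleton_bracket_def)
    then show "A \<in> brackets B'"
    proof cases
      case 1
      then show ?thesis using trivial_in_KT(1)[OF B'] fam_empty by metis
    next
      case 2
      then show ?thesis using KT_max[OF B' kd(1)] level_setD by blast
    qed
  qed
  then show "is_minimum T B"
    using B bracketing_le_iff by (simp add: is_minimum_def)
qed

end

section \<open>Connected components and the atoms\<close>

definition gaps :: "plane_tree \<Rightarrow> bracket \<Rightarrow> (nat \<times> nat) set" where
  "gaps T A = {(r, i) \<in> coords T. r < length A \<and> vtx T r i \<in> A ! r \<and> vtx T r (Suc i) \<in> A ! r}"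

context conc_tree
begin

text \<open>At each level both brackets contain the ancestor of \<open>u\<close>. Comparing two
  intervals with a common vertex only requires comparing gaps.\<close>

lemma gaps_subset_iff:
  assumes A: "is_bracket T l A" and l: "l \<le> depth T" and u: "u \<in> A ! l" and X: "X \<subseteq> coords T"
  shows "gaps T A \<subseteq> X \<longleftrightarrow> A \<sqsubseteq>\<^sub>b fam T X u"
proof
  have uV: "u \<in> VT T l" using is_bracket_subset[OF A, of l] u by auto
  note len = length_VT[OF uV]
  note lenA = is_bracket_length[OF A]
  have ti: "take i u \<in> A ! i" if "i \<le> l" for i
    using that take_cv[OF uV, of i] is_bracket_cv[OF A, of i] u len by (cases "i = l") auto
  {
    assume g: "gaps T A \<subseteq> X"
    have "A ! i \<subseteq> cls T X i (take i u)" if i: "i \<le> l" for i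
    proof (cases "i = 0")
      case True
      then show ?thesis
        using is_bracket_subset[OF A, of 0] cls_self[of "[]" T 0 X] by auto
    next
      case False
      show ?thesis
      proof (rule convex_linked[OF is_bracket_subset[OF A i]])
        show "c \<in> A ! i" if "a \<in> A ! i" "b \<in> A ! i" "c \<in> VT T i" "a \<le> c" "c \<le> b" for a b c
          using is_bracket_convex[OF A i] that by blast
        show "(i, j) \<in> X" if "(i, j) \<in> coords T" "vtx T i j \<in> A ! i" "vtx T i (Suc j) \<in> A ! i" for j
          using g that i lenA unfolding gaps_def by auto
      qed (use False i l ti[OF i] in auto)
    qed
    then show "A \<sqsubseteq>\<^sub>b fam T X u"
      using len lenA by (simp add: bracket_le_iff less_Suc_eq_le)
  next
    assume le: "A \<sqsubseteq>\<^sub>b fam T X u"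
    show "gaps T A \<subseteq> X"
    proof (rule subrelI)
      fix r i assume ri: "(r, i) \<in> gaps T A"
      then have r: "r \<le> l" and c: "(r, i) \<in> coords T" using lenA by (auto simp: gaps_def)
      have "A ! r \<subseteq> cls T X r (take r u)"
        using le r len lenA by (auto simp: bracket_le_iff less_Suc_eq_le)
      then show "(r, i) \<in> X"
        using ri gap_in_X[OF c take_VT[OF uV r]] by (auto simp: gaps_def)
    qed
  }
qed

text \<open>A vertex whose path meets the chosen class has the same bracket for \<open>Y\<close> as
  for \<open>X\<close>; for all others \<open>Y\<close> leaves singletons. The last clause keeps the
  families of \<open>Y\<close> inside any bracketing that contains those of
  \<open>X\<close>.\<close>

lemma component:
  assumes X: "X \<subseteq> coords T" "X \<noteq> {}"
  obtains Y k w where "Y \<subseteq> X" "connected_at Y k w"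
    "\<And>u. u \<in> verts T \<Longrightarrow> fam T Y u = fam T X u \<or> fam T Y u = fam T {} u"
proof -
  define k where "k = (LEAST r. \<exists>i. (r, i) \<in> X)"
  obtain i where ki: "(k, i) \<in> X"
    using X(2) LeastI_ex[of "\<lambda>r. \<exists>i. (r, i) \<in> X"] unfolding k_def by fast
  have low: "k \<le> r" if "(r, j) \<in> X" for r j
    unfolding k_def using that by (blast intro: Least_le)
  have kc: "(k, i) \<in> coords T" using ki X by blast
  then have k1: "1 \<le> k" "k \<le> depth T" and i: "1 \<le> i" "i \<le> tnum T k" by (auto simp: coords_def)
  define w where "w = vtx T k i"
  have w: "w \<in> VT T k" unfolding w_def by (rule gap_vtx(1)[OF i])
  define C where "C = cls T X k w"
  have wC: "w \<in> C" "vtx T k (Suc i) \<in> C" "vtx T k (Suc i) \<noteq> w"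
    using cls_self[OF w] gap_cls[OF kc ki] gap_vtx(3)[OF i] unfolding C_def w_def by auto
  \<comment> \<open>The higher levels belong to the component exactly when \<open>C\<close> contains
    \<open>cv k\<close>, since family brackets of deeper vertices pass through the class of
    \<open>cv k\<close>.\<close>
  define Y where "Y = {(r, j) \<in> X. r = k \<and> vtx T r j \<in> C \<or> k < r \<and> cv k \<in> C}"
  have YX: "Y \<subseteq> X" unfolding Y_def by blast
  have CV: "C \<subseteq> VT T k" unfolding C_def by (rule cls_subset)
  have inC: "cls T X k z = C" if "z \<in> C" for z
    using cls_eq[OF w] that unfolding C_def by blast
  have clsY: "cls T Y k z = cls T X k z" if z: "z \<in> C" for z
  proof
    show "cls T Y k z \<subseteq> cls T X k z" by (rule cls_mono[OF YX])
    have "C \<subseteq> cls T Y k z"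
    proof (rule convex_linked[OF CV k1])
      show "c \<in> C" if "a \<in> C" "b \<in> C" "c \<in> VT T k" "a \<le> c" "c \<le> b" for a b c
        using cls_convex[OF w] that unfolding C_def by blast
      show "(k, j) \<in> Y" if "(k, j) \<in> coords T" "vtx T k j \<in> C" "vtx T k (Suc j) \<in> C" for j
        using gap_in_X[OF that(1) w] that unfolding Y_def C_def by blast
    qed (rule z)
    then show "cls T X k z \<subseteq> cls T Y k z" using inC[OF z] by simp
  qed
  have clsY': "cls T Y k z = cls T {} k z" if z: "z \<in> VT T k" "z \<notin> C" for z
  proof -
    have "v = z" if v: "v \<in> cls T Y k z" for v
    proof (rule ccontr)
      assume "v \<noteq> z"
      then obtain j where j: "(k, j) \<in> Y" "vtx T k j \<in> cls T Y k z"
        using linked_gap[OF z(1) v _ k1(1)] by metis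
      then have "vtx T k j \<in> C" "vtx T k j \<in> cls T X k z"
        using cls_mono[OF YX] unfolding Y_def by auto
      then have "cls T X k z = C"
        using cls_eqI[OF z(1) w] unfolding C_def by blast
      then show False using z(2) cls_self[OF z(1)] by blast
    qed
    then have "cls T Y k z = {z}" using cls_self[OF z(1), of Y] by blast
    then show ?thesis using cls_empty[OF z(1)] by simp
  qed
  have lowX: "cls T X r = cls T {} r" and lowY: "cls T Y r = cls T {} r" if "r < k" for r
    using that low YX by (auto intro!: cls_cong dest: leD)
  have highX: "cls T Y r = cls T X r" if "k < r" "cv k \<in> C" for r
    using that by (intro cls_cong) (auto simp: Y_def)
  have highY: "cls T Y r = cls T {} r" if "k < r" "cv k \<notin> C" for r
    using that by (intro cls_cong) (auto simp: Y_def)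
  show ?thesis
  proof (rule that[OF YX])
    have cw: "cls T Y k w = C" using clsY[OF wC(1)] inC[OF wC(1)] by simp
    then have "cls T Y k w \<noteq> {w}" using wC by blast
    then show "connected_at Y k w"
      unfolding connected_at_def cw using X(1) YX k1 w cw by (auto simp: Y_def)
  next
    fix u assume u: "u \<in> verts T"
    let ?z = "take k u"
    show "fam T Y u = fam T X u \<or> fam T Y u = fam T {} u"
    proof (cases "k \<le> length u")
      case False
      then show ?thesis using lowY by (simp add: fam_eq_iff)
    next
      case True
      have uV: "u \<in> VT T (length u)" using u verts_iff_VT by blast
      have z: "?z \<in> VT T k" by (rule take_verts[OF u True])
      have zcv: "?z = cv k" if "k < r" "r \<le> length u" for r
        using take_cv[OF uV] that by simp
      show ?thesis
      proof (cases "?z \<in> C")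
        case zC: True
        have "cls T Y r (take r u) = cls T X r (take r u)" if "r \<le> length u" for r
        proof (cases r k rule: linorder_cases)
          case less
          then show ?thesis using lowX lowY by simp
        next
          case equal
          then show ?thesis using clsY[OF zC] by simp
        next
          case greater
          then show ?thesis using highX[OF greater] zcv[OF greater that] zC by simp
        qed
        then show ?thesis by (simp add: fam_eq_iff)
      next
        case zC: False
        have "cls T Y r (take r u) = cls T {} r (take r u)" if "r \<le> length u" for r
        proof (cases r k rule: linorder_cases)
          case less
          then show ?thesis using lowY by simp
        next
          case equal
          then show ?thesis using clsY'[OF z zC] by simp
        next
          case greater
          then show ?thesis using highY[OF greater] zcv[OF greater that] zC by simp
        qed
        then show ?thesis by (simp add: fam_eq_iff)
      qed
    qed
  qed
qed

text \<open>\<open>A\<close> lies in the family bracket of one of its top vertices \<open>u\<close>.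
  If \<open>Y\<close> agrees with \<open>X\<close> there, all gaps are in \<open>Y\<close>.
  Otherwise \<open>Y\<close> gives a singleton at \<open>u\<close>, and a gap of \<open>A\<close> in
  \<open>Y\<close> would make the bracket of an ancestor-or-self of \<open>u\<close>
  nonsingleton.\<close>

lemma gaps_split:
  assumes X: "X \<subseteq> coords T" "Y \<subseteq> X"
    and fam: "\<And>u. u \<in> verts T \<Longrightarrow> fam T Y u = fam T X u \<or> fam T Y u = fam T {} u"
    and A: "is_bracket T l A" "l \<le> depth T" "gaps T A \<subseteq> X"
  shows "gaps T A \<subseteq> Y \<or> gaps T A \<subseteq> X - Y"
proof (rule ccontr)
  assume neg: "\<not> ?thesis"
  obtain u where u: "u \<in> A ! l" using is_bracket_nonempty[OF A(1), of l] by blast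
  then have uV: "u \<in> VT T l" using is_bracket_subset[OF A(1), of l] by auto
  have le: "A \<sqsubseteq>\<^sub>b fam T X u" using gaps_subset_iff[OF A(1,2) u X(1)] A(3) by simp
  have "Y \<subseteq> coords T" using X by blast
  then have "fam T Y u \<noteq> fam T X u"
    using gaps_subset_iff[OF A(1,2) u, of Y] le neg by auto
  then have triv: "fam T Y u = fam T {} u" using fam[OF VT_verts[OF uV]] by simp
  obtain r i where ri: "(r, i) \<in> gaps T A" "(r, i) \<in> Y" using neg A(3) by auto
  then have r: "r \<le> l" and c: "(r, i) \<in> coords T" and v: "vtx T r i \<in> A ! r"
    using is_bracket_length[OF A(1)] by (auto simp: gaps_def)
  let ?v = "vtx T r i"
  have g: "1 \<le> i" "i \<le> tnum T r" using c by (auto simp: coords_def)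
  have vV: "?v \<in> VT T r" by (rule gap_vtx(1)[OF g])
  have "cls T Y r ?v \<noteq> {?v}"
    using gap_cls[OF c ri(2)] gap_vtx(3)[OF g] by (metis less_irrefl singletonD)
  then have ntv: "fam T Y ?v \<noteq> fam T {} ?v"
    using fam_eq_last[of T Y ?v "{}" ?v] cls_empty[OF vV] length_VT[OF vV] by metis
  then have eq: "fam T Y ?v = fam T X ?v" using fam[OF VT_verts[OF vV]] by simp
  have tV: "take r u \<in> VT T r" by (rule take_VT[OF uV r])
  have "?v \<in> cls T X r (take r u)"
    using le v r length_VT[OF uV] is_bracket_length[OF A(1)] by (auto simp: bracket_le_iff less_Suc_eq_le)
  then have "cls T X r ?v = cls T X r (take r u)" by (rule cls_eq[OF tV])
  moreover have "cls T Y r ?v = cls T X r ?v"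
    using fam_eq_last[OF eq] length_VT[OF vV] by simp
  ultimately have "take r u \<in> cls T Y r ?v" using cls_self[OF tV] by simp
  then have "fam T Y (take r u) = fam T Y ?v" by (rule fam_cong_cls[OF vV])
  moreover have "fam T Y (take r u) = fam T {} (take r u)"
    using fam_singleton_take[OF VT_verts[OF uV] triv] r length_VT[OF uV] by simp
  ultimately have "is_singleton_bracket T (fam T Y ?v)"
    using is_singleton_fam[OF VT_verts[OF tV], of Y] by simp
  then show False using ntv is_singleton_fam[OF VT_verts[OF vV]] by simp
qed

text \<open>A component of a family through a nontrivial bracket: its brackets are singletons or
  members of that family, so they all belong to \<open>B\<close>.\<close>

lemma nonminimal_contains_connected:
  assumes B: "B \<in> KT T" and "\<not> is_minimum T B"
  obtains Y k w where "connected_at Y k w" "Y \<noteq> coords T" "bracketing_of Y \<le>\<^sub>K B"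
proof -
  obtain A where A: "A \<in> brackets B" "nontrivial T A"
    using assms minimum_iff by blast
  obtain X u where X: "X \<subseteq> coords T" "\<And>u. u \<in> verts T \<Longrightarrow> fam T X u \<in> brackets B"
    "u \<in> verts T" "fam T X u = A"
    using family_through_bracket[OF B A(1)] by metis
  have ne: "X \<noteq> {}" "X \<noteq> coords T"
    using A(2) X(4) nontrivial_fam[OF X(3), of X] by auto
  obtain Y k w where Y: "Y \<subseteq> X" "connected_at Y k w"
    "\<And>u. u \<in> verts T \<Longrightarrow> fam T Y u = fam T X u \<or> fam T Y u = fam T {} u"
    using component[OF X(1) ne(1)] by metis
  have "Y \<subseteq> coords T" "Y \<noteq> coords T" using Y(1) X(1) ne(2) by auto
  moreover have "brackets (bracketing_of Y) \<subseteq> brackets B"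
  proof
    fix D assume "D \<in> brackets (bracketing_of Y)"
    then obtain v where v: "v \<in> verts T" "D = fam T {} v \<or> D = fam T Y v \<or> D = fam T (coords T) v"
      unfolding brackets_of by blast
    then show "D \<in> brackets B"
      using trivial_in_KT[OF B v(1)] X(2)[OF v(1)] Y(3)[OF v(1)] by auto
  qed
  ultimately show ?thesis
    using that[OF Y(2)] bracketing_le_iff[OF bracketing_of_KT B] by blast
qed

text \<open>A vertex \<open>v\<close> with nontrivial bracket for \<open>Y\<close> has the same
  bracket for \<open>X\<close>. Any other disagreement is excluded: a maximum bracket for
  \<open>Y\<close> lies below level \<open>length v\<close> and so is also maximum for
  \<open>X\<close>, while a nonsingleton bracket for \<open>X\<close> passes through the fusion
  bracket shared with \<open>v\<close>.\<close>

lemma connected_unique: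
  assumes c: "connected_at X k w" "X \<noteq> coords T" and c': "connected_at Y k' w'" "Y \<noteq> coords T"
    and sub: "brackets (bracketing_of Y) \<subseteq> brackets (bracketing_of X)"
  shows "X = Y"
proof -
  have Xc: "X \<subseteq> coords T" and w: "w \<in> VT T k" and Yc: "Y \<subseteq> coords T" and w': "w' \<in> VT T k'"
    using c(1) c'(1) by (auto simp: connected_at_def)
  have tri: "fam T Y u = fam T {} u \<or> fam T Y u = fam T X u \<or> fam T Y u = fam T (coords T) u"
    if u: "u \<in> verts T" for u
  proof -
    have uV: "u \<in> VT T (length u)" using u verts_iff_VT by blast
    have "fam T Y u \<in> brackets (bracketing_of X)" using sub u brackets_of by blast
    then obtain v Z where vZ: "v \<in> verts T" "Z \<in> {{}, X, coords T}" "fam T Y u = fam T Z v"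
      unfolding brackets_of by blast
    have len: "length u = length v" using arg_cong[OF vZ(3), of length] by simp
    have vV: "v \<in> VT T (length u)" using vZ(1) verts_iff_VT len by simp
    have "u \<in> cls T Z (length u) v"
      using fam_eq_last[OF vZ(3)] cls_self[OF uV, of Y] len by simp
    then have "fam T Z u = fam T Z v" by (rule fam_cong_cls[OF vV])
    then show ?thesis using vZ by auto
  qed
  obtain v where v: "v \<in> verts T" "nontrivial T (fam T Y v)"
    using nontrivial_above[OF Yc c'(2) VT_verts[OF w'] connected_not_singleton[OF c'(1)]] by metis
  then have nt: "fam T Y v \<noteq> fam T {} v" "fam T Y v \<noteq> fam T (coords T) v" and eqv: "fam T Y v = fam T X v"
    using nontrivial_fam[OF v(1)] tri[OF v(1)] by auto
  have vV: "v \<in> VT T (length v)" using v(1) verts_iff_VT by blast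
  have pre: "fam T Y (take j v) = fam T X (take j v)" if "j \<le> length v" for j
    using take_fam[OF that, of T] eqv by metis
  have kv: "k \<le> length v" "fam T X (take k v) = fam T X w"
    using connected_prefix[OF c(1) v(1)] nt eqv by auto
  show ?thesis
  proof (rule fam_inj[OF Xc Yc])
    fix u assume u: "u \<in> verts T"
    have uV: "u \<in> VT T (length u)" using u verts_iff_VT by blast
    show "fam T X u = fam T Y u"
    proof (cases "fam T Y u = fam T {} u")
      case False
      show ?thesis
      proof (rule ccontr)
        assume ne: "fam T X u \<noteq> fam T Y u"
        then have max: "fam T Y u = fam T (coords T) u" using tri[OF u] False by auto
        have lt: "length u < length v"
          using max_below[OF uV max vV] nt(2) by fastforce
        have tV: "take (length u) v \<in> VT T (length u)" using take_VT[OF vV] lt by simp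
        have "fam T Y (take (length u) v) = fam T (coords T) (take (length u) v)"
          by (rule max_below[OF uV max tV]) simp
        then have "fam T X (take (length u) v) = fam T (coords T) (take (length u) v)"
          using pre[of "length u"] lt by simp
        then have "fam T X u = fam T (coords T) u"
          by (rule max_below[OF tV _ uV]) simp
        then show False using ne max by simp
      qed
    next
      case True
      show ?thesis
      proof (rule ccontr)
        assume ne: "fam T X u \<noteq> fam T Y u"
        then have "fam T X u \<noteq> fam T {} u" using True by simp
        from connected_prefix[OF c(1) u this]
        have ku: "k \<le> length u" "fam T X (take k u) = fam T X w" by auto
        have tuV: "take k u \<in> VT T k" and tvV: "take k v \<in> VT T k"
          using take_VT[OF uV ku(1)] take_VT[OF vV kv(1)] by auto
        have eq: "fam T X (take k u) = fam T Y (take k v)"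
          using ku kv pre[OF kv(1)] by simp
        have "take k u \<in> cls T Y k (take k v)"
          using fam_eq_last[OF eq] cls_self[OF tuV, of X] length_VT[OF tuV] length_VT[OF tvV] by simp
        then have "fam T Y (take k u) = fam T X w"
          using fam_cong_cls[OF tvV] eq ku(2) by metis
        moreover have "fam T Y (take k u) = fam T {} (take k u)"
          by (rule fam_singleton_take[OF u True ku(1)])
        ultimately have "is_singleton_bracket T (fam T X w)"
          using is_singleton_fam[OF VT_verts[OF tuV], of Y] by simp
        then show False
          using connected_not_singleton[OF c(1)] is_singleton_fam[OF VT_verts[OF w]] by simp
      qed
    qed
  qed
qed

text \<open>An atom coincides with the connected bracketing found below it by
  \<open>nonminimal_contains_connected\<close>; conversely, \<open>connected_unique\<close> leaves
  no room below a proper connected one.\<close>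

lemma collision_iff:
  "is_collision T C \<longleftrightarrow> (\<exists>X k w. connected_at X k w \<and> X \<noteq> coords T \<and> C = bracketing_of X)"
proof -
  have nonmin: "bracketing_of X \<in> KT T \<and> \<not> is_minimum T (bracketing_of X)"
    if c: "connected_at X k w" "X \<noteq> coords T" for X k w
  proof -
    have Xc: "X \<subseteq> coords T" and w: "w \<in> VT T k" using c by (auto simp: connected_at_def)
    obtain v where "v \<in> verts T" "nontrivial T (fam T X v)"
      using nontrivial_above[OF Xc c(2) VT_verts[OF w] connected_not_singleton[OF c(1)]] by metis
    then show ?thesis
      using minimum_iff[OF bracketing_of_KT[OF Xc]] bracketing_of_KT[OF Xc] brackets_of by blast
  qed
  show ?thesis
  proof
    assume C: "is_collision T C"
    then have "C \<in> KT T" "\<not> is_minimum T C" by (auto simp: is_collision_def)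
    then obtain Y k w where Y: "connected_at Y k w" "Y \<noteq> coords T" "bracketing_of Y \<le>\<^sub>K C"
      by (rule nonminimal_contains_connected)
    then have "bracketing_of Y = C"
      using C nonmin[OF Y(1,2)] unfolding is_collision_def by blast
    then show "\<exists>X k w. connected_at X k w \<and> X \<noteq> coords T \<and> C = bracketing_of X"
      using Y by blast
  next
    assume "\<exists>X k w. connected_at X k w \<and> X \<noteq> coords T \<and> C = bracketing_of X"
    then obtain X k w where c: "connected_at X k w" "X \<noteq> coords T" and C: "C = bracketing_of X" by blast
    note nm = nonmin[OF c]
    show "is_collision T C"
      unfolding is_collision_def C
    proof (intro conjI ballI impI)
      fix B assume B: "B \<in> KT T" "B \<le>\<^sub>K bracketing_of X"
      show "B = bracketing_of X \<or> is_minimum T B"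
      proof (rule disjCI)
        assume "\<not> is_minimum T B"
        then obtain Y k' w' where Y: "connected_at Y k' w'" "Y \<noteq> coords T" "bracketing_of Y \<le>\<^sub>K B"
          by (rule nonminimal_contains_connected[OF B(1)])
        have 1: "brackets (bracketing_of Y) \<subseteq> brackets B" "brackets B \<subseteq> brackets (bracketing_of X)"
          using Y(3) B(2) unfolding bracketing_le_def by auto
        then have "X = Y" using connected_unique[OF c Y(1,2)] by blast
        then show "B = bracketing_of X"
          using 1 bracketing_eqI[OF B(1)] nm by blast
      qed
    qed (use nm in auto)
  qed
qed

end

section \<open>Collision units\<close>

definition hull_at :: "plane_tree \<Rightarrow> nat \<Rightarrow> vertex set \<Rightarrow> vertex set" where
  "hull_at T k W = {v \<in> VT T k. \<exists>a\<in>W. \<exists>b\<in>W. a \<le> v \<and> v \<le> b}"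

lemma hull_at_superset: "W \<subseteq> VT T k \<Longrightarrow> W \<subseteq> hull_at T k W"
  unfolding hull_at_def by blast

lemma hull_at_singleton: "v \<in> VT T k \<Longrightarrow> hull_at T k {v} = {v}"
  unfolding hull_at_def by auto

lemma hull_at_convex:
  "a \<in> hull_at T k W \<Longrightarrow> b \<in> hull_at T k W \<Longrightarrow> c \<in> VT T k \<Longrightarrow> a \<le> c \<Longrightarrow> c \<le> b \<Longrightarrow> c \<in> hull_at T k W"
  unfolding hull_at_def mem_Collect_eq by (meson order_trans)

text \<open>Every vertex of a hull with at least two elements has a neighbour in it. Hence such a
  hull is recovered from its gaps.\<close>

lemma hull_at_gaps:
  assumes "a \<in> hull_at T k W" "b \<in> hull_at T k W" "a \<noteq> b" "v \<in> hull_at T k W"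
  obtains i where "1 \<le> i" "i \<le> tnum T k" "vtx T k i \<in> hull_at T k W" "vtx T k (Suc i) \<in> hull_at T k W"
    "v = vtx T k i \<or> v = vtx T k (Suc i)"
proof -
  have V: "v \<in> VT T k" using assms(4) by (simp add: hull_at_def)
  obtain z where z: "z \<in> hull_at T k W" "z \<noteq> v" using assms by metis
  then have zV: "z \<in> VT T k" by (simp add: hull_at_def)
  show ?thesis
  proof (cases "v < z")
    case True
    then obtain i where i: "1 \<le> i" "i \<le> tnum T k" "vtx T k i = v" "vtx T k (Suc i) \<le> z"
      using gap_above[OF V zV] by blast
    then have "v \<le> vtx T k (Suc i)" using gap_vtx(3)[OF i(1,2)] by simp
    then have "vtx T k (Suc i) \<in> hull_at T k W"
      using hull_at_convex[OF assms(4) z(1) gap_vtx(2)[OF i(1,2)]] i by blast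
    then show ?thesis using that[OF i(1,2)] i(3) assms(4) by simp
  next
    case False
    then have "z < v" using z(2) by simp
    then obtain i where i: "1 \<le> i" "i \<le> tnum T k" "z \<le> vtx T k i" "vtx T k (Suc i) = v"
      using gap_below[OF zV V] by blast
    then have "vtx T k i \<le> v" using gap_vtx(3)[OF i(1,2)] by simp
    then have "vtx T k i \<in> hull_at T k W"
      using hull_at_convex[OF z(1) assms(4) gap_vtx(1)[OF i(1,2)]] i by blast
    then show ?thesis using that[OF i(1,2)] i(4) assms(4) by simp
  qed
qed

lemma hull_at_pair_inj:
  assumes "a \<in> VT T k" "b \<in> VT T k" "a' \<in> VT T k" "b' \<in> VT T k"
    and eq: "hull_at T k {a, b} = hull_at T k {a', b'}"
  shows "{a, b} = {a', b'}"
proof -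
  have "a' \<in> hull_at T k {a, b}" "b' \<in> hull_at T k {a, b}"
    unfolding eq using hull_at_superset[of "{a', b'}" T k] assms by auto
  moreover have "a \<in> hull_at T k {a', b'}" "b \<in> hull_at T k {a', b'}"
    unfolding eq[symmetric] using hull_at_superset[of "{a, b}" T k] assms by auto
  ultimately have m: "min a b \<le> a'" "a' \<le> max a b" "min a b \<le> b'" "b' \<le> max a b"
      "min a' b' \<le> a" "a \<le> max a' b'" "min a' b' \<le> b" "b \<le> max a' b'"
    unfolding hull_at_def by (auto simp: min_le_iff_disj le_max_iff_disj)
  have "min a b = min a' b'" "max a b = max a' b'"
    by (intro antisym min.boundedI max.boundedI m)+
  moreover have "{x, y} = {min x y, max x y}" for x y :: vertex
    by (auto simp: min_def max_def)
  ultimately show ?thesis by metis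
qed

text \<open>Adjoining \<open>p\<close> may hide one end of the pair, but the end facing away from
  \<open>p\<close> stays extremal, and for an adjacent pair it determines the other.\<close>

lemma hull_at_gap_inj:
  assumes i: "1 \<le> i" "i \<le> tnum T k" and j: "1 \<le> j" "j \<le> tnum T k" and p: "p \<in> VT T k"
    and eq: "hull_at T k {vtx T k i, vtx T k (Suc i), p} = hull_at T k {vtx T k j, vtx T k (Suc j), p}"
  shows "i = j"
proof -
  have False if i: "1 \<le> i" "i \<le> tnum T k" and j: "1 \<le> j" "j \<le> tnum T k" and "i < j"
    and eq: "hull_at T k {vtx T k i, vtx T k (Suc i), p} = hull_at T k {vtx T k j, vtx T k (Suc j), p}" for i j
  proof -
    note I = gap_vtx[OF i] and J = gap_vtx[OF j]
    have ne: "VT T k \<noteq> {}" using p by blast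
    have ij: "vtx T k (Suc i) \<le> vtx T k j"
      using vtx_less_iff[of j T k "Suc i"] i j \<open>i < j\<close> ne by (auto simp: not_less[symmetric])
    \<comment> \<open>If \<open>p\<close> is on the left, the hull for \<open>i\<close> stops at
      \<open>vtx T k (Suc i)\<close> and misses \<open>vtx T k (Suc j)\<close>; if \<open>p\<close>
      is on the right, the hull for \<open>j\<close> starts after \<open>vtx T k i\<close>.\<close>
    show False
    proof (cases "p \<le> vtx T k i")
      case True
      have "vtx T k (Suc j) \<in> hull_at T k {vtx T k i, vtx T k (Suc i), p}"
        unfolding eq using hull_at_superset[of "{vtx T k j, vtx T k (Suc j), p}" T k] J p by auto
      then obtain b where "b \<in> {vtx T k i, vtx T k (Suc i), p}" "vtx T k (Suc j) \<le> b"
        unfolding hull_at_def by blast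
      then have "vtx T k (Suc j) \<le> vtx T k (Suc i)"
        using True I(3) by (elim insertE) (auto dest: order_trans[of _ p] less_imp_le)
      then show False using ij J(3) by simp
    next
      case False
      then have ip: "vtx T k (Suc i) \<le> p" using gap_no_between[OF i p] by simp
      have "vtx T k i \<in> hull_at T k {vtx T k j, vtx T k (Suc j), p}"
        unfolding eq[symmetric] using hull_at_superset[of "{vtx T k i, vtx T k (Suc i), p}" T k] I p by auto
      then obtain a where a: "a \<in> {vtx T k j, vtx T k (Suc j), p}" "a \<le> vtx T k i"
        unfolding hull_at_def by blast
      have "vtx T k (Suc i) \<le> vtx T k (Suc j)" using ij J(3) by simp
      then have "vtx T k (Suc i) \<le> a" using a(1) ij ip by blast
      then show False using a(2) I(3) by simp
    qed
  qed
  then show ?thesis using i j eq by (metis linorder_neqE_nat)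
qed

lemma finite_collision_units: "finite (collision_units T)"
proof (rule finite_subset)
  show "collision_units T \<subseteq> {c. \<forall>k. (k \<in> {1..depth T} \<longrightarrow> c k \<in> Pow (verts T)) \<and> (k \<notin> {1..depth T} \<longrightarrow> c k = {})}"
  proof
    fix c assume c: "c \<in> collision_units T"
    have "c k \<subseteq> verts T" if "k \<in> {1..depth T}" for k
    proof -
      have "c k = {} \<or> (\<exists>u\<in>VT T k. \<exists>v\<in>VT T k. u \<noteq> v \<and> c k = {u, v})"
        using c that unfolding collision_units_def by blast
      then show ?thesis by (auto simp: VT_def)
    qed
    moreover have "c k = {}" if "k \<notin> {1..depth T}" for k
      using c that unfolding collision_units_def by blast
    ultimately show "c \<in> {c. \<forall>k. (k \<in> {1..depth T} \<longrightarrow> c k \<in> Pow (verts T)) \<and> (k \<notin> {1..depth T} \<longrightarrow> c k = {})}"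
      by blast
  qed
  show "finite {c. \<forall>k. (k \<in> {1..depth T} \<longrightarrow> c k \<in> Pow (verts T)) \<and> (k \<notin> {1..depth T} \<longrightarrow> c k = {})}"
    by (rule finite_set_of_finite_funs) (simp_all add: finite_verts)
qed

lemma
  assumes c: "c \<in> collision_units T"
  shows unit_pair: "\<And>k. c k \<noteq> {} \<Longrightarrow> \<exists>u\<in>VT T k. \<exists>v\<in>VT T k. u \<noteq> v \<and> c k = {u, v}"
    and unit_range: "\<And>k. c k \<noteq> {} \<Longrightarrow> 1 \<le> k \<and> k \<le> depth T"
    and unit_subset: "\<And>k. c k \<subseteq> VT T k"
    and unit_multi: "\<And>k l. k \<noteq> l \<Longrightarrow> c k \<noteq> {} \<Longrightarrow> c l \<noteq> {} \<Longrightarrow>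
       \<exists>i. 1 \<le> i \<and> i \<le> tnum T k \<and> c k = {vtx T k i, vtx T k (Suc i)}"
    and unit_level_nonempty: "c (unit_level c) \<noteq> {}"
    and unit_level_max: "\<And>k. c k \<noteq> {} \<Longrightarrow> k \<le> unit_level c"
proof -
  show range: "1 \<le> k \<and> k \<le> depth T" if "c k \<noteq> {}" for k
  proof -
    have "\<forall>k. k \<notin> {1..depth T} \<longrightarrow> c k = {}"
      using c unfolding collision_units_def by blast
    then show ?thesis using that by (meson atLeastAtMost_iff)
  qed
  show pair: "\<exists>u\<in>VT T k. \<exists>v\<in>VT T k. u \<noteq> v \<and> c k = {u, v}" if "c k \<noteq> {}" for k
  proof -
    have "\<forall>k\<in>{1..depth T}. c k = {} \<or> (\<exists>u\<in>VT T k. \<exists>v\<in>VT T k. u \<noteq> v \<and> c k = {u, v})"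
      using c unfolding collision_units_def by blast
    then show ?thesis using that range[OF that] by (meson atLeastAtMost_iff)
  qed
  show "c k \<subseteq> VT T k" for k
  proof (cases "c k = {}")
    case False
    from pair[OF this] show ?thesis by auto
  qed simp
  show "\<exists>i. 1 \<le> i \<and> i \<le> tnum T k \<and> c k = {vtx T k i, vtx T k (Suc i)}"
    if "k \<noteq> l" "c k \<noteq> {}" "c l \<noteq> {}" for k l
  proof -
    have "(\<exists>k k'. k \<noteq> k' \<and> c k \<noteq> {} \<and> c k' \<noteq> {}) \<longrightarrow>
        (\<forall>k. c k \<noteq> {} \<longrightarrow> (\<exists>i\<in>{1..tnum T k}. c k = {vtx T k i, vtx T k (i + 1)}))"
      using c unfolding collision_units_def by blast
    then have "\<exists>i\<in>{1..tnum T k}. c k = {vtx T k i, vtx T k (i + 1)}" using that by blast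
    then show ?thesis by auto
  qed
  have fin: "finite {k. c k \<noteq> {}}"
    by (rule finite_subset[of _ "{1..depth T}"]) (use range in \<open>simp_all add: subset_iff\<close>)
  have "{k. c k \<noteq> {}} \<noteq> {}"
    using c unfolding collision_units_def by blast
  from Max_in[OF fin this] show "c (unit_level c) \<noteq> {}"
    unfolding unit_level_def by simp
  show "k \<le> unit_level c" if "c k \<noteq> {}" for k
    unfolding unit_level_def using Max_ge[OF fin] that by simp
qed

section \<open>The smallest bracket of a unit and its support\<close>

context conc_tree
begin

text \<open>Below the top level \<open>cv r\<close> is included because every bracket contains it
  there (\<open>is_bracket_cv\<close>); at the top level no vertex is forced.\<close>

definition unit_hull :: "collision_unit \<Rightarrow> nat \<Rightarrow> vertex set" where
  "unit_hull c r = hull_at T r (c r \<union> (if r < unit_level c then {cv r} else {}))"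

definition unit_bracket :: "collision_unit \<Rightarrow> bracket" where
  "unit_bracket c = map (unit_hull c) [0..<Suc (unit_level c)]"

lemma nth_unit_bracket: "r \<le> unit_level c \<Longrightarrow> unit_bracket c ! r = unit_hull c r"
  unfolding unit_bracket_def by (subst nth_map) (auto simp del: upt_Suc)

lemma length_unit_bracket: "length (unit_bracket c) = Suc (unit_level c)"
  by (simp add: unit_bracket_def)

lemma unit_level_range: "c \<in> collision_units T \<Longrightarrow> 1 \<le> unit_level c \<and> unit_level c \<le> depth T"
  using unit_range[OF _ unit_level_nonempty] .

lemma unit_gens_subset:
  assumes c: "c \<in> collision_units T" and "r \<le> unit_level c"
  shows "c r \<union> (if r < unit_level c then {cv r} else {}) \<subseteq> VT T r"
  using unit_subset[OF c, of r] cv_in[of r] unit_level_range[OF c] by auto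

lemma unit_hull_superset:
  assumes c: "c \<in> collision_units T" and "r \<le> unit_level c"
  shows "c r \<subseteq> unit_hull c r" "r < unit_level c \<Longrightarrow> cv r \<in> unit_hull c r"
  using hull_at_superset[OF unit_gens_subset[OF assms]] unfolding unit_hull_def by auto

lemma is_bracket_unit:
  assumes c: "c \<in> collision_units T"
  shows "is_bracket T (unit_level c) (unit_bracket c)"
proof (rule is_bracketI)
  show "length (unit_bracket c) = Suc (unit_level c)" by (rule length_unit_bracket)
  show "unit_bracket c ! i \<subseteq> VT T i" if "i \<le> unit_level c" for i
    using that by (auto simp: nth_unit_bracket unit_hull_def hull_at_def)
  show "unit_bracket c ! unit_level c \<noteq> {}"
    using unit_hull_superset(1)[OF c order_refl] unit_level_nonempty[OF c] by (simp add: nth_unit_bracket) blast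
  show "cv i \<in> unit_bracket c ! i" if "i < unit_level c" for i
    using unit_hull_superset(2)[OF c, of i] that by (simp add: nth_unit_bracket)
  show "z \<in> unit_bracket c ! i" if "i \<le> unit_level c" "a \<in> unit_bracket c ! i" "b \<in> unit_bracket c ! i"
    "z \<in> VT T i" "a \<le> z" "z \<le> b" for i a b z
    using that hull_at_convex unfolding nth_unit_bracket[OF that(1)] unit_hull_def by blast
qed

lemma contained_in_iff:
  assumes c: "c \<in> collision_units T" and A: "is_bracket T (unit_level c) A"
  shows "contained_in c A \<longleftrightarrow> unit_bracket c \<sqsubseteq>\<^sub>b A"
proof
  assume "unit_bracket c \<sqsubseteq>\<^sub>b A"
  then have "unit_hull c i \<subseteq> A ! i" if "i \<le> unit_level c" for i
    using that nth_unit_bracket[OF that] by (auto simp: bracket_le_iff length_unit_bracket less_Suc_eq_le)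
  then show "contained_in c A"
    using unit_hull_superset(1)[OF c] unfolding contained_in_def by blast
next
  assume con: "contained_in c A"
  have "unit_hull c i \<subseteq> A ! i" if i: "i \<le> unit_level c" for i
  proof
    fix v assume "v \<in> unit_hull c i"
    then obtain a b where ab: "v \<in> VT T i" "a \<le> v" "v \<le> b"
      "a \<in> c i \<union> (if i < unit_level c then {cv i} else {})"
      "b \<in> c i \<union> (if i < unit_level c then {cv i} else {})"
      unfolding unit_hull_def hull_at_def by blast
    have "c i \<union> (if i < unit_level c then {cv i} else {}) \<subseteq> A ! i"
      using con i is_bracket_cv[OF A, of i] unfolding contained_in_def by auto
    then show "v \<in> A ! i"
      using is_bracket_convex[OF A i _ _ ab(1-3)] ab(4,5) by blast
  qed
  then show "unit_bracket c \<sqsubseteq>\<^sub>b A"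
    using is_bracket_length[OF A] by (simp add: bracket_le_iff length_unit_bracket less_Suc_eq_le nth_unit_bracket)
qed

lemma smallest_bracket_eq:
  assumes c: "c \<in> collision_units T"
  shows "smallest_bracket T c = unit_bracket c"
  unfolding smallest_bracket_def
proof (rule the_equality)
  show "is_bracket T (unit_level c) (unit_bracket c) \<and> contained_in c (unit_bracket c) \<and>
    (\<forall>A'. is_bracket T (unit_level c) A' \<and> contained_in c A' \<longrightarrow> unit_bracket c \<sqsubseteq>\<^sub>b A')"
    using is_bracket_unit[OF c] contained_in_iff[OF c] bracket_le_refl by blast
next
  fix A assume "is_bracket T (unit_level c) A \<and> contained_in c A \<and>
    (\<forall>A'. is_bracket T (unit_level c) A' \<and> contained_in c A' \<longrightarrow> A \<sqsubseteq>\<^sub>b A')"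
  then show "A = unit_bracket c"
    using is_bracket_unit[OF c] contained_in_iff[OF c] bracket_le_refl bracket_le_antisym by blast
qed

lemma unit_support_eq:
  assumes c: "c \<in> collision_units T"
  shows "unit_support T c = gaps T (unit_bracket c)"
  unfolding unit_support_def gaps_def smallest_bracket_eq[OF c]
  by (auto simp: length_unit_bracket less_Suc_eq_le)

lemma unit_support_mem:
  assumes c: "c \<in> collision_units T"
  shows "(r, i) \<in> unit_support T c \<longleftrightarrow> (r, i) \<in> coords T \<and> r \<le> unit_level c \<and>
    vtx T r i \<in> unit_hull c r \<and> vtx T r (Suc i) \<in> unit_hull c r"
  unfolding unit_support_eq[OF c] gaps_def by (auto simp: length_unit_bracket less_Suc_eq_le nth_unit_bracket)

text \<open>Where the unit is empty below its top, the hull is the single vertex \<open>cv r\<close>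
  and has no gap; a pair spans at least one gap.\<close>

lemma unit_support_level:
  assumes c: "c \<in> collision_units T"
  shows "c r \<noteq> {} \<longleftrightarrow> (\<exists>i. (r, i) \<in> unit_support T c)"
proof
  assume r: "c r \<noteq> {}"
  then obtain u v where uv: "u \<noteq> v" "c r = {u, v}" using unit_pair[OF c r] by blast
  have rl: "r \<le> unit_level c" by (rule unit_level_max[OF c r])
  have "u \<in> unit_hull c r" "v \<in> unit_hull c r"
    using unit_hull_superset(1)[OF c rl] uv by auto
  then obtain i where "1 \<le> i" "i \<le> tnum T r" "vtx T r i \<in> unit_hull c r" "vtx T r (Suc i) \<in> unit_hull c r"
    using hull_at_gaps uv(1) unfolding unit_hull_def by metis
  then have "(r, i) \<in> unit_support T c"
    using unit_support_mem[OF c] rl unit_range[OF c r] by (simp add: coords_def)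
  then show "\<exists>i. (r, i) \<in> unit_support T c" by blast
next
  assume "\<exists>i. (r, i) \<in> unit_support T c"
  then obtain i where i: "(r, i) \<in> coords T" "r \<le> unit_level c"
    "vtx T r i \<in> unit_hull c r" "vtx T r (Suc i) \<in> unit_hull c r"
    using unit_support_mem[OF c] by blast
  show "c r \<noteq> {}"
  proof
    assume e: "c r = {}"
    then have lt: "r < unit_level c" using i(2) unit_level_nonempty[OF c] by (cases "r = unit_level c") auto
    then have "cv r \<in> VT T r" using cv_in unit_level_range[OF c] by simp
    then have "unit_hull c r = {cv r}"
      using e lt hull_at_singleton by (simp add: unit_hull_def)
    then show False using i(3,4) gap_vtx(3)[of i T r] i(1) by (simp add: coords_def)
  qed
qed

lemma unit_support_nonempty: "c \<in> collision_units T \<Longrightarrow> unit_support T c \<noteq> {}"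
  using unit_support_level[of c "unit_level c"] unit_level_nonempty[of c T] by auto

lemma unit_support_coords: "c \<in> collision_units T \<Longrightarrow> unit_support T c \<subseteq> coords T"
  by (auto simp: unit_support_def)

text \<open>The support shows which levels are nonempty and, by \<open>hull_at_gaps\<close>, the
  hulls there. It remains to recover the pair from its hull.\<close>

lemma inj_unit_support: "inj_on (unit_support T) (collision_units T)"
proof (rule inj_onI)
  fix c c' assume c: "c \<in> collision_units T" and c': "c' \<in> collision_units T"
    and eq: "unit_support T c = unit_support T c'"
  have emp: "c r \<noteq> {} \<longleftrightarrow> c' r \<noteq> {}" for r
    using unit_support_level[OF c] unit_support_level[OF c'] eq by simp
  then have lev: "unit_level c = unit_level c'" by (simp add: unit_level_def)
  have hull: "unit_hull c r \<subseteq> unit_hull c' r"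
    if c: "c \<in> collision_units T" and c': "c' \<in> collision_units T"
    and eq: "unit_support T c = unit_support T c'" and r: "c r \<noteq> {}" for c c' r
  proof
    fix v assume v: "v \<in> unit_hull c r"
    obtain a b where ab: "a \<noteq> b" "c r = {a, b}" using unit_pair[OF c r] by blast
    have rl: "r \<le> unit_level c" by (rule unit_level_max[OF c r])
    have "a \<in> unit_hull c r" "b \<in> unit_hull c r"
      using unit_hull_superset(1)[OF c rl] ab by auto
    then obtain i where i: "1 \<le> i" "i \<le> tnum T r" "vtx T r i \<in> unit_hull c r" "vtx T r (Suc i) \<in> unit_hull c r"
      "v = vtx T r i \<or> v = vtx T r (Suc i)"
      using hull_at_gaps[OF _ _ ab(1)] v unfolding unit_hull_def by metis
    then have "(r, i) \<in> unit_support T c'"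
      using unit_support_mem[OF c] eq rl unit_range[OF c r] by (simp add: coords_def)
    then show "v \<in> unit_hull c' r" using unit_support_mem[OF c'] i(5) by blast
  qed
  have "c r = c' r" for r
  proof (cases "c r = {}")
    case True
    then show ?thesis using emp by auto
  next
    case False
    then have F': "c' r \<noteq> {}" using emp by simp
    have hr: "unit_hull c r = unit_hull c' r"
      using hull[OF c c' eq False] hull[OF c' c eq[symmetric] F'] by blast
    show ?thesis
    proof (cases "r = unit_level c")
      case True
      obtain a b where ab: "a \<in> VT T r" "b \<in> VT T r" "c r = {a, b}" using unit_pair[OF c False] by blast
      obtain a' b' where ab': "a' \<in> VT T r" "b' \<in> VT T r" "c' r = {a', b'}" using unit_pair[OF c' F'] by blast
      have "hull_at T r {a, b} = hull_at T r {a', b'}"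
        using hr True lev ab(3) ab'(3) by (simp add: unit_hull_def)
      then show ?thesis using hull_at_pair_inj[OF ab(1,2) ab'(1,2)] ab(3) ab'(3) by simp
    next
      case ne: False
      \<comment> \<open>A nonempty level below the top means that at least two levels are nonempty,
        so the pairs are adjacent and \<open>hull_at_gap_inj\<close> applies with
        \<open>cv r\<close> as the extra vertex.\<close>
      then have lt: "r < unit_level c" using unit_level_max[OF c False] by simp
      obtain i where i: "1 \<le> i" "i \<le> tnum T r" "c r = {vtx T r i, vtx T r (Suc i)}"
        using unit_multi[OF c ne False unit_level_nonempty[OF c]] by blast
      have "r \<noteq> unit_level c'" using ne lev by simp
      then obtain j where j: "1 \<le> j" "j \<le> tnum T r" "c' r = {vtx T r j, vtx T r (Suc j)}"
        using unit_multi[OF c' _ F' unit_level_nonempty[OF c']] by blast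
      have p: "cv r \<in> VT T r" using cv_in lt unit_level_range[OF c] by simp
      have "hull_at T r {vtx T r i, vtx T r (Suc i), cv r} = hull_at T r {vtx T r j, vtx T r (Suc j), cv r}"
        using hr lt lev i(3) j(3) by (simp add: unit_hull_def insert_commute)
      then have "i = j" by (rule hull_at_gap_inj[OF i(1,2) j(1,2) p])
      then show ?thesis using i(3) j(3) by simp
    qed
  qed
  then show "c = c'" by (rule ext)
qed

lemma unit_support_subset_iff:
  assumes c: "c \<in> collision_units T" and X: "X \<subseteq> coords T" and u: "u \<in> c (unit_level c)"
  shows "unit_support T c \<subseteq> X \<longleftrightarrow> contained_in c (fam T X u)"
proof -
  have uV: "u \<in> VT T (unit_level c)" using unit_subset[OF c] u by blast
  have "u \<in> unit_bracket c ! unit_level c"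
    using unit_hull_superset(1)[OF c order_refl] u by (auto simp: nth_unit_bracket)
  then show ?thesis
    using gaps_subset_iff[OF is_bracket_unit[OF c] _ _ X] unit_level_range[OF c]
      contained_in_iff[OF c is_bracket_fam[OF uV]] unit_support_eq[OF c] by simp
qed

text \<open>A unit with support in \<open>X\<close> is contained in exactly one essential bracket,
  that of either vertex of its top pair; the bracket is nonsingleton because it contains
  both.\<close>

lemma ray_height_eq:
  assumes con: "connected_at X k w" and ne: "X \<noteq> coords T"
  shows "ray_height T (bracketing_of X) = card {c \<in> collision_units T. unit_support T c \<subseteq> X}"
proof -
  have X: "X \<subseteq> coords T" using con by (simp add: connected_at_def)
  let ?E = "{E. essential T (bracketing_of X) E}"
  have E: "?E = {fam T X z |z. z \<in> verts T \<and> fam T X z \<noteq> fam T {} z}"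
    using essential_iff[OF con ne] by blast
  have finE: "finite ?E"
    by (rule finite_subset[of _ "fam T X ` verts T"]) (auto simp: E finite_verts)
  have mem: "\<exists>u. u \<in> c (unit_level c) \<and> u \<in> VT T (unit_level c) \<and> E = fam T X u"
    if "c \<in> units_in T E" "E \<in> ?E" for c E
  proof -
    obtain z where z: "z \<in> verts T" "E = fam T X z" using \<open>E \<in> ?E\<close> unfolding E by blast
    have c: "c \<in> collision_units T" "length z = unit_level c" "contained_in c E"
      using \<open>c \<in> units_in T E\<close> z by (auto simp: units_in_def)
    have zV: "z \<in> VT T (unit_level c)" using z(1) c(2) verts_iff_VT by metis
    obtain u where u: "u \<in> c (unit_level c)" using unit_level_nonempty[OF c(1)] by blast
    have "c (unit_level c) \<subseteq> E ! unit_level c" using c(3) by (simp add: contained_in_def)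
    then have "u \<in> cls T X (unit_level c) z" using u z(2) c(2) by auto
    then have "fam T X u = E" using fam_cong_cls[OF zV] z(2) by simp
    then show ?thesis using u unit_subset[OF c(1)] by blast
  qed
  have disj: "units_in T E1 \<inter> units_in T E2 = {}" if E12: "E1 \<in> ?E" "E2 \<in> ?E" "E1 \<noteq> E2" for E1 E2
  proof (rule ccontr)
    assume "units_in T E1 \<inter> units_in T E2 \<noteq> {}"
    then obtain c where c: "c \<in> units_in T E1" "c \<in> units_in T E2" by blast
    obtain u where u: "u \<in> c (unit_level c)" "u \<in> VT T (unit_level c)" "E1 = fam T X u"
      using mem[OF c(1) E12(1)] by blast
    obtain v where v: "v \<in> VT T (unit_level c)" "E2 = fam T X v"
      using mem[OF c(2) E12(2)] by blast
    have "c (unit_level c) \<subseteq> E2 ! unit_level c" using c(2) by (simp add: units_in_def contained_in_def)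
    then have "u \<in> cls T X (unit_level c) v" using u(1) v length_VT[OF v(1)] by auto
    then show False using fam_cong_cls[OF v(1)] u(3) v(2) E12(3) by simp
  qed
  have "(\<Union>E\<in>?E. units_in T E) = {c \<in> collision_units T. unit_support T c \<subseteq> X}"
  proof (intro equalityI subsetI)
    fix c assume "c \<in> (\<Union>E\<in>?E. units_in T E)"
    then obtain E' where E': "E' \<in> ?E" "c \<in> units_in T E'" by blast
    then have c: "c \<in> collision_units T" "contained_in c E'" by (auto simp: units_in_def)
    obtain u where u: "u \<in> c (unit_level c)" "E' = fam T X u" using mem[OF E'(2,1)] by blast
    then show "c \<in> {c \<in> collision_units T. unit_support T c \<subseteq> X}"
      using unit_support_subset_iff[OF c(1) X u(1)] c by simp
  next
    fix c assume "c \<in> {c \<in> collision_units T. unit_support T c \<subseteq> X}"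
    then have c: "c \<in> collision_units T" "unit_support T c \<subseteq> X" by auto
    obtain u v where uv: "u \<in> VT T (unit_level c)" "u \<noteq> v" "c (unit_level c) = {u, v}"
      using unit_pair[OF c(1) unit_level_nonempty[OF c(1)]] by blast
    have con: "contained_in c (fam T X u)"
      using unit_support_subset_iff[OF c(1) X, of u] c(2) uv(3) by simp
    have len: "length u = unit_level c" by (rule length_VT[OF uv(1)])
    have "c (unit_level c) \<subseteq> fam T X u ! unit_level c" using con by (simp add: contained_in_def)
    then have "v \<in> cls T X (unit_level c) u" using uv(3) len by simp
    then have "fam T X u \<noteq> fam T {} u"
      using fam_eq_last[of T X u "{}" u] cls_empty[OF uv(1)] len uv(2) by auto
    then have "fam T X u \<in> ?E" unfolding E using VT_verts[OF uv(1)] by blast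
    moreover have "c \<in> units_in T (fam T X u)"
      using c(1) con len by (simp add: units_in_def)
    ultimately show "c \<in> (\<Union>E\<in>?E. units_in T E)" by blast
  qed
  moreover have "card (\<Union>E\<in>?E. units_in T E) = (\<Sum>E\<in>?E. card (units_in T E))"
  proof (rule card_UN_disjoint[OF finE])
    show "\<forall>E\<in>?E. finite (units_in T E)"
      by (intro ballI finite_subset[OF _ finite_collision_units[of T]]) (auto simp: units_in_def)
    show "\<forall>E1\<in>?E. \<forall>E2\<in>?E. E1 \<noteq> E2 \<longrightarrow> units_in T E1 \<inter> units_in T E2 = {}"
      using disj by blast
  qed
  ultimately show ?thesis by (simp add: ray_height_def)
qed

end

section \<open>Minkowski sums of simplices\<close>

text \<open>Layer-cake argument: lowering the top level of \<open>a\<close> to the next one changes both sides by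
  multiples of the inequality for the corresponding upper level set.\<close>

lemma sum_min_le_of_superlevel:
  fixes x a :: "'m::finite \<Rightarrow> real" and A :: "'i \<Rightarrow> 'm set"
  assumes I: "finite I" and ne: "\<And>i. i \<in> I \<Longrightarrow> A i \<noteq> {}"
    and tot: "sum x UNIV = real (card I)"
    and sub: "\<And>X. real (card {i \<in> I. A i \<subseteq> X}) \<le> sum x X"
    and m: "\<And>i c. i \<in> I \<Longrightarrow> c \<in> A i \<Longrightarrow> m i \<le> a c"
  shows "sum m I \<le> (\<Sum>c\<in>UNIV. a c * x c)"
  using m
proof (induction "card (range a)" arbitrary: a m rule: less_induct)
  case less
  define \<alpha> where "\<alpha> = Max (range a)"
  have le: "a c \<le> \<alpha>" for c unfolding \<alpha>_def by simp
  define R where "R = range a - {\<alpha>}"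
  show ?case
  proof (cases "R = {}")
    case True
    then have a: "a c = \<alpha>" for c unfolding R_def by blast
    \<comment> \<open>For constant \<open>a\<close> only the total of \<open>x\<close> enters, and
      it is the number of summands.\<close>
    have "sum m I \<le> (\<Sum>i\<in>I. \<alpha>)"
      using ne less.prems a by (intro sum_mono) (metis ex_in_conv)
    also have "\<dots> = (\<Sum>c\<in>UNIV. a c * x c)"
      using a tot by (simp add: sum_distrib_left[symmetric])
    finally show ?thesis .
  next
    case False
    define \<beta> where "\<beta> = Max R"
    have finR: "finite R" unfolding R_def by simp
    have "\<beta> \<in> R" unfolding \<beta>_def using finR False by (rule Max_in)
    then have \<beta>: "\<beta> < \<alpha>" using le unfolding R_def by (auto simp: order.strict_iff_order)
    define X where "X = {c. a c = \<alpha>}"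
    have out: "a c \<le> \<beta>" if "c \<notin> X" for c
      unfolding \<beta>_def by (rule Max_ge[OF finR]) (use that in \<open>auto simp: R_def X_def\<close>)
    define a' where "a' c = (if c \<in> X then \<beta> else a c)" for c
    define m' where "m' i = m i - (if A i \<subseteq> X then \<alpha> - \<beta> else 0)" for i
    have "range a' \<subseteq> R"
      using \<open>\<beta> \<in> R\<close> by (auto simp: a'_def R_def X_def)
    then have "card (range a') \<le> card R" by (rule card_mono[OF finR])
    moreover have "card R < card (range a)"
      unfolding R_def by (rule card_Diff1_less) (auto simp: \<alpha>_def)
    ultimately have "card (range a') < card (range a)" by simp
    moreover have "m' i \<le> a' c" if i: "i \<in> I" "c \<in> A i" for i c
    proof (cases "A i \<subseteq> X")
      case True
      then show ?thesis using less.prems[OF i] i(2) by (auto simp: a'_def m'_def X_def)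
    next
      case False
      \<comment> \<open>An element outside the top level set already bounds \<open>m i\<close> by
        the second largest value, so nothing has to be subtracted.\<close>
      then obtain d where d: "d \<in> A i" "d \<notin> X" by blast
      have "m i \<le> \<beta>" using less.prems[OF i(1) d(1)] out[OF d(2)] by simp
      then show ?thesis using less.prems[OF i] False by (auto simp: a'_def m'_def)
    qed
    ultimately have IH: "sum m' I \<le> (\<Sum>c\<in>UNIV. a' c * x c)" by (rule less.hyps)
    have "sum m I = sum m' I + (\<Sum>i\<in>I. if A i \<subseteq> X then \<alpha> - \<beta> else 0)"
      by (simp add: m'_def sum_subtractf)
    also have "(\<Sum>i\<in>I. if A i \<subseteq> X then \<alpha> - \<beta> else 0) = (\<alpha> - \<beta>) * card {i \<in> I. A i \<subseteq> X}"
      using I by (simp add: sum.If_cases Int_def)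
    also have "\<dots> \<le> (\<alpha> - \<beta>) * sum x X"
      using sub[of X] \<beta> by (intro mult_left_mono) auto
    also have "(\<alpha> - \<beta>) * sum x X = (\<Sum>c\<in>UNIV. (if c \<in> X then \<alpha> - \<beta> else 0) * x c)"
      by (simp add: sum_distrib_left if_distrib[of "\<lambda>t. t * _"] sum.If_cases cong: if_cong)
    finally have "sum m I \<le> (\<Sum>c\<in>UNIV. a' c * x c) + (\<Sum>c\<in>UNIV. (if c \<in> X then \<alpha> - \<beta> else 0) * x c)"
      using IH by simp
    also have "\<dots> = (\<Sum>c\<in>UNIV. a c * x c)"
      unfolding sum.distrib[symmetric] by (rule sum.cong) (auto simp: a'_def X_def algebra_simps)
    finally show ?thesis .
  qed
qed

definition coord_simplex :: "'m::finite set \<Rightarrow> (real ^ 'm) set" where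
  "coord_simplex A = convex hull ((\<lambda>c. axis c 1) ` A)"

lemma coord_simplexD:
  fixes x :: "real ^ 'm::finite"
  assumes "x \<in> coord_simplex A"
  shows "0 \<le> x $ c" "c \<notin> A \<Longrightarrow> x $ c = 0" "(\<Sum>c\<in>UNIV. x $ c) = 1"
proof -
  let ?C = "{x :: real ^ 'm. (\<forall>c. 0 \<le> x $ c) \<and> (\<forall>c. c \<notin> A \<longrightarrow> x $ c = 0) \<and> (\<Sum>c\<in>UNIV. x $ c) = 1}"
  have "convex ?C"
    by (auto simp: convex_def sum.distrib sum_distrib_left[symmetric])
  moreover have "(\<lambda>c. axis c 1) ` A \<subseteq> ?C"
    by (auto simp: axis_def)
  ultimately have "coord_simplex A \<subseteq> ?C"
    unfolding coord_simplex_def by (rule hull_minimal[rotated])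
  then show "0 \<le> x $ c" "c \<notin> A \<Longrightarrow> x $ c = 0" "(\<Sum>c\<in>UNIV. x $ c) = 1"
    using assms by auto
qed

lemma compact_convex_coord_simplex: "compact (coord_simplex A)" "convex (coord_simplex A)"
  unfolding coord_simplex_def
  by (auto intro: finite_imp_compact_convex_hull)

lemma compact_convex_sum:
  fixes S :: "'i \<Rightarrow> 'a::real_normed_vector set"
  assumes "finite I" "\<And>i. i \<in> I \<Longrightarrow> compact (S i)" "\<And>i. i \<in> I \<Longrightarrow> convex (S i)"
  shows "compact (\<Sum>i\<in>I. S i) \<and> convex (\<Sum>i\<in>I. S i)"
  using assms
proof (induction I rule: finite_induct)
  case empty
  then show ?case by (simp add: set_zero)
next
  case (insert i I)
  have "S i + (\<Sum>i\<in>I. S i) = {x + y |x y. x \<in> S i \<and> y \<in> (\<Sum>i\<in>I. S i)}"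
    by (auto simp: set_plus_def)
  then have "compact (S i + (\<Sum>i\<in>I. S i))"
    using insert compact_sums[of "S i" "\<Sum>i\<in>I. S i"] by simp
  moreover have "convex (S i + (\<Sum>i\<in>I. S i))"
    using insert by (simp add: convex_set_plus)
  ultimately show ?case using insert by simp
qed

text \<open>The inclusion from right to left separates a point outside the sum by a hyperplane, the
  minimum of a linear form over a simplex being attained at a vertex.\<close>

lemma sum_coord_simplices:
  fixes A :: "'i \<Rightarrow> 'm::finite set"
  assumes I: "finite I" and ne: "\<And>i. i \<in> I \<Longrightarrow> A i \<noteq> {}"
  shows "(\<Sum>i\<in>I. coord_simplex (A i)) =
    {x. (\<Sum>c\<in>UNIV. x $ c) = real (card I) \<and> (\<forall>X. real (card {i \<in> I. A i \<subseteq> X}) \<le> (\<Sum>c\<in>X. x $ c))}"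
    (is "?M = ?P")
proof (intro equalityI subsetI)
  fix x assume "x \<in> ?M"
  then obtain s where s: "x = sum s I" "\<And>i. i \<in> I \<Longrightarrow> s i \<in> coord_simplex (A i)"
    unfolding set_sum_alt[OF I] by blast
  note D = coord_simplexD[OF s(2)]
  have swap: "(\<Sum>c\<in>X. x $ c) = (\<Sum>i\<in>I. \<Sum>c\<in>X. s i $ c)" for X
    unfolding s(1) by (simp add: sum.swap[of _ I])
  have "real (card {i \<in> I. A i \<subseteq> X}) \<le> (\<Sum>c\<in>X. x $ c)" for X
  proof -
    have "real (card {i \<in> I. A i \<subseteq> X}) = (\<Sum>i\<in>I. if A i \<subseteq> X then 1 else 0)"
      using I by (simp add: sum.If_cases Int_def)
    also have "\<dots> \<le> (\<Sum>i\<in>I. \<Sum>c\<in>X. s i $ c)"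
    proof (rule sum_mono)
      fix i assume i: "i \<in> I"
      \<comment> \<open>A summand supported in \<open>X\<close> contributes its whole mass 1; the
        others contribute a nonnegative amount.\<close>
      have "(\<Sum>c\<in>X. s i $ c) = (\<Sum>c\<in>UNIV. s i $ c)" if "A i \<subseteq> X"
        using that D(2)[OF i] by (intro sum.mono_neutral_left) auto
      then show "(if A i \<subseteq> X then 1 else 0) \<le> (\<Sum>c\<in>X. s i $ c)"
        using D(1,3)[OF i] by (auto intro: sum_nonneg)
    qed
    finally show ?thesis using swap by simp
  qed
  moreover have "(\<Sum>c\<in>UNIV. x $ c) = real (card I)"
    using swap D(3) by simp
  ultimately show "x \<in> ?P" by simp
next
  fix x assume x: "x \<in> ?P"
  show "x \<in> ?M"
  proof (rule ccontr)
    assume nx: "x \<notin> ?M"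
    have M: "compact ?M" "convex ?M"
      using compact_convex_sum[OF I, of "\<lambda>i. coord_simplex (A i)"] compact_convex_coord_simplex by auto
    obtain a b where ab: "a \<bullet> x < b" "\<And>y. y \<in> ?M \<Longrightarrow> b < a \<bullet> y"
      using separating_hyperplane_closed_point[OF M(2) compact_imp_closed[OF M(1)] nx] by blast
    have "\<exists>c. c \<in> A i \<and> (\<forall>d\<in>A i. a $ c \<le> a $ d)" if "i \<in> I" for i
      using ex_is_arg_min_if_finite[of "A i" "\<lambda>c. a $ c"] ne[OF that] finite_class.finite
      by (metis (no_types, lifting) finite is_arg_min_linorder)
    then obtain g where g: "\<And>i. i \<in> I \<Longrightarrow> g i \<in> A i" "\<And>i d. i \<in> I \<Longrightarrow> d \<in> A i \<Longrightarrow> a $ g i \<le> a $ d"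
      by metis
    \<comment> \<open>This point minimises \<open>a\<close> on each summand. The layer-cake bound
      says that its value is at most that of \<open>x\<close>, against the separation.\<close>
    have "(\<Sum>i\<in>I. axis (g i) 1) \<in> ?M"
      unfolding set_sum_alt[OF I] using g(1) by (auto simp: coord_simplex_def intro!: hull_inc)
    then have "b < a \<bullet> (\<Sum>i\<in>I. axis (g i) 1)" by (rule ab(2))
    also have "\<dots> = (\<Sum>i\<in>I. a $ g i)"
      by (simp add: inner_sum_right inner_axis)
    also have "\<dots> \<le> (\<Sum>c\<in>UNIV. a $ c * x $ c)"
      by (rule sum_min_le_of_superlevel[OF I ne]) (use x g in auto)
    also have "\<dots> = a \<bullet> x" by (simp add: inner_vec_def)
    finally show False using ab(1) by simp
  qed
qed

section \<open>The polytope\<close>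

context conc_tree
begin

text \<open>Splitting off connected components reduces the inequalities for arbitrary sets of gaps to
  those for collisions.\<close>

lemma unit_count_le:
  fixes v :: "nat \<times> nat \<Rightarrow> real"
  assumes fin: "finite (coords T)" and tot: "real (card (collision_units T)) \<le> sum v (coords T)"
    and con: "\<And>X k w. connected_at X k w \<Longrightarrow> X \<noteq> coords T \<Longrightarrow>
      real (card {c \<in> collision_units T. unit_support T c \<subseteq> X}) \<le> sum v X"
    and "X \<subseteq> coords T"
  shows "real (card {c \<in> collision_units T. unit_support T c \<subseteq> X}) \<le> sum v X"
  using assms(4)
proof (induction "card X" arbitrary: X rule: less_induct)
  case less
  let ?U = "\<lambda>X. {c \<in> collision_units T. unit_support T c \<subseteq> X}"
  have finX: "finite X" using less.prems fin finite_subset by blast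
  have finU: "finite (?U Z)" for Z using finite_collision_units[of T] by simp
  show ?case
  proof (cases "X = {}")
    case True
    then have "?U X = {}" using unit_support_nonempty by blast
    then show ?thesis using True by (simp only: card.empty sum.empty)
  next
    case False
    obtain Y k w where Y: "Y \<subseteq> X" "connected_at Y k w"
      "\<And>u. u \<in> verts T \<Longrightarrow> fam T Y u = fam T X u \<or> fam T Y u = fam T {} u"
      using component[OF less.prems False] by metis
    have "Y \<noteq> {}"
      using Y(2) cls_empty by (auto simp: connected_at_def)
    show ?thesis
    proof (cases "Y = X")
      case True
      show ?thesis
      proof (cases "X = coords T")
        \<comment> \<open>For the full set the inequality comes from the hypothesis on the total, as
          no collision has this set.\<close>
        case True
        then have "?U X = collision_units T" using unit_support_coords by auto
        then show ?thesis using tot True by simp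
      next
        case False
        then show ?thesis using con Y(2) \<open>Y = X\<close> by blast
      qed
    next
      case False
      have "?U X \<subseteq> ?U Y \<union> ?U (X - Y)"
      proof
        fix c assume "c \<in> ?U X"
        then have c: "c \<in> collision_units T" "gaps T (unit_bracket c) \<subseteq> X"
          using unit_support_eq by auto
        have "gaps T (unit_bracket c) \<subseteq> Y \<or> gaps T (unit_bracket c) \<subseteq> X - Y"
          by (rule gaps_split[OF less.prems Y(1,3) is_bracket_unit[OF c(1)] _ c(2)])
            (use unit_level_range[OF c(1)] in auto)
        then show "c \<in> ?U Y \<union> ?U (X - Y)" using c(1) unit_support_eq[OF c(1)] by auto
      qed
      \<comment> \<open>An upper bound for the count is enough here, since \<open>v\<close> is
        exactly additive over \<open>Y\<close> and \<open>X - Y\<close>.\<close>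
      then have "card (?U X) \<le> card (?U Y \<union> ?U (X - Y))"
        by (rule card_mono[rotated]) (use finU in auto)
      also have "\<dots> \<le> card (?U Y) + card (?U (X - Y))"
        by (rule card_Un_le)
      finally have "real (card (?U X)) \<le> real (card (?U Y)) + real (card (?U (X - Y)))"
        by simp
      also have "real (card (?U Y)) \<le> sum v Y"
        by (rule less.hyps) (use Y(1) False finX less.prems psubset_card_mono[of X Y] in auto)
      also have "real (card (?U (X - Y))) \<le> sum v (X - Y)"
        by (rule less.hyps)
          (use Y(1) \<open>Y \<noteq> {}\<close> finX less.prems psubset_card_mono[of X "X - Y"] in auto)
      also have "sum v Y + sum v (X - Y) = sum v X"
        using sum.subset_diff[OF Y(1) finX, of v] by simp
      finally show ?thesis by simp
    qed
  qed
qed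

text \<open>Bridges the inequalities indexed by collisions and those indexed by all sets in
  \<open>sum_coord_simplices\<close>: rays and heights become sums and counts over \<open>X\<close>,
  and \<open>unit_count_le\<close> passes from connected sets to arbitrary ones.\<close>

lemma PT_iff:
  fixes lab :: "'m::finite \<Rightarrow> nat \<times> nat"
  assumes lab: "bij_betw lab UNIV (coords T)"
  shows "x \<in> PT T lab \<longleftrightarrow> (\<Sum>c\<in>UNIV. x $ c) = real (card (collision_units T)) \<and>
    (\<forall>Z. real (card {u \<in> collision_units T. lab -` unit_support T u \<subseteq> Z}) \<le> (\<Sum>c\<in>Z. x $ c))"
proof -
  let ?U = "\<lambda>X. {c \<in> collision_units T. unit_support T c \<subseteq> X}"
  have inj: "inj lab" and ran: "range lab = coords T"
    using lab by (auto simp: bij_betw_def)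
  have fin: "finite (coords T)" using ran finite_imageI[of UNIV lab] by simp
  have Z: "{u \<in> collision_units T. lab -` unit_support T u \<subseteq> Z} = ?U (lab ` Z)" for Z
  proof -
    have "lab -` unit_support T u \<subseteq> Z \<longleftrightarrow> unit_support T u \<subseteq> lab ` Z" if "u \<in> collision_units T" for u
      using unit_support_coords[OF that] ran inj by (fastforce simp: inj_def)
    then show ?thesis by blast
  qed
  define v where "v p = x $ inv lab p" for p
  have v: "sum v (lab ` Z) = (\<Sum>c\<in>Z. x $ c)" for Z
    using inj by (simp add: sum.reindex inj_on_subset[OF inj] v_def)
  have ray: "ray T lab (bracketing_of X) \<bullet> x = sum v X" if c: "connected_at X k w" "X \<noteq> coords T" for X k w
  proof -
    have "X \<subseteq> coords T" using c by (simp add: connected_at_def)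
    then have X: "X = lab ` (lab -` X)" using ran by auto
    have "ray T lab (bracketing_of X) \<bullet> x = (\<Sum>c\<in>UNIV. (if lab c \<in> X then 1 else 0) * x $ c)"
      by (simp add: ray_def inner_vec_def ray_support_of[OF c])
    also have "\<dots> = (\<Sum>c\<in>UNIV. if c \<in> lab -` X then x $ c else 0)"
      by (rule sum.cong) auto
    also have "\<dots> = (\<Sum>c\<in>lab -` X. x $ c)"
      by (simp add: sum.If_cases vimage_def)
    also have "\<dots> = sum v X" using v[of "lab -` X"] X by simp
    finally show ?thesis .
  qed
  have tot: "(\<Sum>c\<in>UNIV. x $ c) = sum v (coords T)" using v[of UNIV] ran by simp
  have coll: "(\<forall>C. is_collision T C \<longrightarrow> ray T lab C \<bullet> x \<ge> real (ray_height T C)) \<longleftrightarrow>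
      (\<forall>X k w. connected_at X k w \<and> X \<noteq> coords T \<longrightarrow> real (card (?U X)) \<le> sum v X)"
    (is "?L \<longleftrightarrow> ?R")
  proof
    assume L: ?L
    show ?R
    proof (intro allI impI)
      fix X k w assume c: "connected_at X k w \<and> X \<noteq> coords T"
      then have "is_collision T (bracketing_of X)" using collision_iff by blast
      from L[rule_format, OF this] show "real (card (?U X)) \<le> sum v X"
        using ray[of X k w] ray_height_eq[of X k w] c by simp
    qed
  next
    assume R: ?R
    show ?L
    proof (intro allI impI)
      fix C assume "is_collision T C"
      then obtain X k w where c: "connected_at X k w" "X \<noteq> coords T" and C: "C = bracketing_of X"
        using collision_iff by blast
      have "real (card (?U X)) \<le> sum v X" using R c by blast
      then show "ray T lab C \<bullet> x \<ge> real (ray_height T C)"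
        using ray[OF c] ray_height_eq[OF c] C by simp
    qed
  qed
  have "x \<in> PT T lab \<longleftrightarrow> sum v (coords T) = real (card (collision_units T)) \<and>
      (\<forall>X k w. connected_at X k w \<and> X \<noteq> coords T \<longrightarrow> real (card (?U X)) \<le> sum v X)"
    unfolding PT_def tot mem_Collect_eq coll ..
  also have "\<dots> \<longleftrightarrow> sum v (coords T) = real (card (collision_units T)) \<and>
      (\<forall>X\<subseteq>coords T. real (card (?U X)) \<le> sum v X)"
    (is "?tot \<and> ?L \<longleftrightarrow> ?tot \<and> ?R")
  proof (rule conj_cong[OF refl])
    assume ?tot
    show "?L \<longleftrightarrow> ?R"
    proof
      show ?R if ?L
        using unit_count_le[OF fin, of v] \<open>?tot\<close> \<open>?L\<close> by simp
      show ?L if ?R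
        using \<open>?R\<close> connected_at_def by blast
    qed
  qed
  also have "(\<forall>X\<subseteq>coords T. real (card (?U X)) \<le> sum v X) \<longleftrightarrow>
      (\<forall>Z. real (card (?U (lab ` Z))) \<le> sum v (lab ` Z))"
    (is "?L \<longleftrightarrow> ?R")
  proof
    show ?R if L: ?L
    proof
      fix Z :: "'m set"
      have "lab ` Z \<subseteq> coords T" using ran by auto
      then show "real (card (?U (lab ` Z))) \<le> sum v (lab ` Z)" by (rule L[rule_format])
    qed
    show ?L if R: ?R
    proof (intro allI impI)
      fix X assume "X \<subseteq> coords T"
      then have "X = lab ` (lab -` X)" using ran by auto
      then show "real (card (?U X)) \<le> sum v X" using spec[OF R, of "lab -` X"] by (simp only:)
    qed
  qed
  finally show ?thesis
    unfolding Z v tot .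
qed

end

lemma simplex_on_eq: "simplex_on lab S = coord_simplex (lab -` S)"
  unfolding simplex_on_def coord_simplex_def by (rule arg_cong[of _ _ "\<lambda>A. convex hull A"]) auto

theorem theorem8p34:
  fixes T :: plane_tree and lab :: "'m::finite \<Rightarrow> nat \<times> nat"
  assumes "1 \<le> depth T" and "\<not> is_path T" and "concentrated T"
    and "bij_betw lab UNIV (coords T)"
  shows "PT T lab = (\<Sum>S\<in>Pow (coords T) - {{}}. (*\<^sub>R) (ycoef T S) ` simplex_on lab S)"
proof -
  interpret conc_tree T
    by unfold_locales fact
  let ?U = "collision_units T"
  have ran: "range lab = coords T"
    using assms(4) by (auto simp: bij_betw_def)
  have fin: "finite (coords T)" using ran finite_imageI[of UNIV lab] by simp
  have ne: "lab -` S \<noteq> {}" if "S \<in> Pow (coords T) - {{}}" for S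
  proof -
    obtain p where "p \<in> S" "p \<in> range lab"
      using \<open>S \<in> Pow (coords T) - {{}}\<close> ran by blast
    then show ?thesis by blast
  qed
  have "(\<Sum>S\<in>Pow (coords T) - {{}}. (*\<^sub>R) (ycoef T S) ` simplex_on lab S) =
      (\<Sum>S\<in>unit_support T ` ?U. simplex_on lab S)"
  proof (rule sum.mono_neutral_cong_right)
    show "finite (Pow (coords T) - {{}})" using fin by simp
    show "unit_support T ` ?U \<subseteq> Pow (coords T) - {{}}"
      using unit_support_coords unit_support_nonempty by blast
    \<comment> \<open>Scaling by 0 gives \<open>{0}\<close>, the neutral element of Minkowski
      addition, only because the simplex is nonempty; the empty set would annihilate the
      sum.\<close>
    show "\<forall>S\<in>Pow (coords T) - {{}} - unit_support T ` ?U. (*\<^sub>R) (ycoef T S) ` simplex_on lab S = 0"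
    proof
      fix S assume S: "S \<in> Pow (coords T) - {{}} - unit_support T ` ?U"
      then have "ycoef T S = 0" by (auto simp: ycoef_def)
      moreover have "simplex_on lab S \<noteq> {}"
        using ne[of S] S by (simp add: simplex_on_eq coord_simplex_def)
      ultimately show "(*\<^sub>R) (ycoef T S) ` simplex_on lab S = 0"
        by (simp add: set_zero image_constant_conv)
    qed
    show "(*\<^sub>R) (ycoef T S) ` simplex_on lab S = simplex_on lab S" if "S \<in> unit_support T ` ?U" for S
    proof -
      have "ycoef T S = 1" using that by (auto simp: ycoef_def)
      then show ?thesis by simp
    qed
  qed
  \<comment> \<open>Distinct units have distinct supports, so coefficients 0 and 1 count every unit
    exactly once.\<close>
  also have "\<dots> = (\<Sum>u\<in>?U. coord_simplex (lab -` unit_support T u))"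
    by (simp add: sum.reindex[OF inj_unit_support] simplex_on_eq)
  also have "\<dots> = {x. (\<Sum>c\<in>UNIV. x $ c) = real (card ?U) \<and>
      (\<forall>Z. real (card {u \<in> ?U. lab -` unit_support T u \<subseteq> Z}) \<le> (\<Sum>c\<in>Z. x $ c))}"
  proof (rule sum_coord_simplices[OF finite_collision_units])
    show "lab -` unit_support T u \<noteq> {}" if "u \<in> ?U" for u
      using unit_support_coords[OF that] unit_support_nonempty[OF that] by (intro ne) simp
  qed
  also have "\<dots> = PT T lab"
    using PT_iff[OF assms(4)] by blast
  finally show ?thesis by simp
qed

end
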